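(* Let $\omega\in\hat{\mathcal D}$ and $0<p\le q<\infty$. There is $\gamma_0>0$, depending only on $\omega,p,q$, such that for each fixed $\gamma>\gamma_0$ the following holds: for every measurable function $u:\mathbb D\to\mathbb C$, every analytic self-map $\varphi$ of $\mathbb D$ and every positive Borel measure $\mu$ on $\mathbb D$, $$\|uC_\varphi\|_{A_\omega^p\to L^q_\mu}^q\approx\sup_{a\in\mathbb D}\int_{\mathbb D}|F_{a,p,\gamma}(\varphi(z))|^q\,|u(z)|^q\,d\mu(z).$$
   Context: $\mathbb D$ is the open unit disk in $\mathbb C$, $H(\mathbb D)$ is the set of analytic functions on $\mathbb D$, and $dA(z)=\frac1\pi dx\,dy$. A weight is a positive radial function $\omega$ on $\mathbb D$, $\omega(z)=\omega(|z|)$, integrable on $(0,1)$; put $\hat\omega(r)=\int_r^1\omega(s)\,ds$. We write $\omega\in\hat{\mathcal D}$ if there is $C>0$ with $\hat\omega(r)<C\hat\omega(\frac{1+r}2)$ for all $0<r<1$. $A_\omega^p$ is the space of $f\in H(\mathbb D)$ with $\|f\|_{A_\omega^p}^p=\int_{\mathbb D}|f|^p\omega\,dA<\infty$. $L^q_\mu$ is the space of measurable $f$ with $\|f\|_{L^q_\mu}^q=\int_{\mathbb D}|f|^q\,d\mu<\infty$. For an operator $T$ (between possibly quasi-normed spaces $Y\to Z$), $\|T\|_{Y\to Z}=\sup\{\|Tf\|_Z:\|f\|_Y\le1\}\in[0,\infty]$. The weighted composition operator is $(uC_\varphi f)(z)=u(z)f(\varphi(z))$. For $a\in\mathbb D\setminus\{0\}$,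 let $I_a=\{e^{i\theta}:|\arg(ae^{-i\theta})|\le\frac{1-|a|}2\}$ and $S(a)=\{re^{it}:e^{it}\in I_a,\ |a|\le r<1\}$ (Carleson square); $S(0)=\mathbb D$. Put $\omega(S(a))=\int_{S(a)}\omega\,dA$ and $$F_{a,p,\gamma}(z)=\left(\frac{1-|a|^2}{1-\bar az}\right)^{\frac{\gamma+1}p}\frac1{\omega(S(a))^{1/p}},\qquad z\in\mathbb D.$$ $A\approx B$ means $C^{-1}B\le A\le CB$ for a constant $C>0$ (both sides may be $+\infty$); here $C$ depends only on $\omega,p,q,\gamma$ and not on $u,\varphi,\mu$. *)

theory Defs
  imports "HOL-Complex_Analysis.Complex_Analysis"
begin

abbreviation unit_disc :: "complex set" where
  "unit_disc \<equiv> ball 0 1"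

definition dA :: "complex measure" where
  "dA = density lebesgue (\<lambda>_. ennreal (1 / pi))"

definition weight :: "(complex \<Rightarrow> real) \<Rightarrow> bool" where
  "weight \<omega> \<longleftrightarrow>
     (\<forall>z\<in>unit_disc. 0 < \<omega> z \<and> \<omega> z = \<omega> (of_real (cmod z))) \<and>
     set_integrable lebesgue {0<..<1} (\<lambda>r. \<omega> (of_real r))"

definition weight_hat :: "(complex \<Rightarrow> real) \<Rightarrow> real \<Rightarrow> real" where
  "weight_hat \<omega> r = (LINT s:{r..<1}|lebesgue. \<omega> (of_real s))"

definition D_hat :: "(complex \<Rightarrow> real) set" where
  "D_hat = {\<omega>. weight \<omega> \<and>
     (\<exists>C>0. \<forall>r. 0 < r \<and> r < 1 \<longrightarrow> weight_hat \<omega> r < C * weight_hat \<omega> ((1 + r) / 2))}"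

text \<open>Real powers on \<open>[0,\<infinity>]\<close>; only used with positive exponents, so that \<open>\<infinity>\<close> is sent to \<open>\<infinity>\<close>.\<close>

definition ennpowr :: "ennreal \<Rightarrow> real \<Rightarrow> ennreal" where
  "ennpowr x s = (if x = \<infinity> then \<infinity> else ennreal (enn2real x powr s))"

definition bergman_norm :: "(complex \<Rightarrow> real) \<Rightarrow> real \<Rightarrow> (complex \<Rightarrow> complex) \<Rightarrow> ennreal" where
  "bergman_norm \<omega> p f =
     ennpowr (\<integral>\<^sup>+z\<in>unit_disc. ennreal (cmod (f z) powr p * \<omega> z) \<partial>dA) (1 / p)"

definition bergman_space :: "(complex \<Rightarrow> real) \<Rightarrow> real \<Rightarrow> (complex \<Rightarrow> complex) set" where
  "bergman_space \<omega> p = {f. f holomorphic_on unit_disc \<and> bergman_norm \<omega> p f < \<infinity>}"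

definition Lq_norm :: "'a measure \<Rightarrow> real \<Rightarrow> ('a \<Rightarrow> complex) \<Rightarrow> ennreal" where
  "Lq_norm \<mu> q f = ennpowr (\<integral>\<^sup>+z. ennreal (cmod (f z) powr q) \<partial>\<mu>) (1 / q)"

text \<open>Quasi-norms take the value \<open>\<infinity>\<close> off the space they define, so a map that does not send
  \<open>Y\<close> into the target space has infinite operator norm.\<close>

definition op_norm ::
    "'a set \<Rightarrow> ('a \<Rightarrow> ennreal) \<Rightarrow> ('b \<Rightarrow> ennreal) \<Rightarrow> ('a \<Rightarrow> 'b) \<Rightarrow> ennreal" where
  "op_norm Y normY normZ T = (SUP f\<in>{f\<in>Y. normY f \<le> 1}. normZ (T f))"

definition weighted_comp ::
    "(complex \<Rightarrow> complex) \<Rightarrow> (complex \<Rightarrow> complex) \<Rightarrow> (complex \<Rightarrow> complex) \<Rightarrow> complex \<Rightarrow> complex" where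
  "weighted_comp u \<phi> f = (\<lambda>z. u z * f (\<phi> z))"

definition carleson_arc :: "complex \<Rightarrow> complex set" where
  "carleson_arc a = {cis \<theta> | \<theta>. \<bar>Arg (a * cis (- \<theta>))\<bar> \<le> (1 - cmod a) / 2}"

definition carleson_square :: "complex \<Rightarrow> complex set" where
  "carleson_square a =
     (if a = 0 then unit_disc
      else {of_real r * cis t | r t. cis t \<in> carleson_arc a \<and> cmod a \<le> r \<and> r < 1})"

definition carleson_mass :: "(complex \<Rightarrow> real) \<Rightarrow> complex \<Rightarrow> real" where
  "carleson_mass \<omega> a = (LINT z:carleson_square a|dA. \<omega> z)"

text \<open>The base of the complex power has positive real part when \<open>a\<close> and \<open>z\<close> lie in the disc,
  so the principal branch is holomorphic in \<open>z\<close>.\<close>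

definition test_fun ::
    "(complex \<Rightarrow> real) \<Rightarrow> complex \<Rightarrow> real \<Rightarrow> real \<Rightarrow> complex \<Rightarrow> complex" where
  "test_fun \<omega> a p \<gamma> z =
     (of_real (1 - (cmod a)\<^sup>2) / (1 - cnj a * z)) powr of_real ((\<gamma> + 1) / p)
       * of_real (1 / carleson_mass \<omega> a powr (1 / p))"

end

theory Submission
  imports Defs
begin

text \<open>
  Write \<open>W\<close> for the measure \<open>\<omega> dA\<close> and \<open>\<Delta>(\<zeta>, t)\<close> for the part of the disc within distance \<open>t\<close> of a
  boundary point \<open>\<zeta>\<close>. The condition on \<open>\<omega>\<close> makes \<open>W\<close> doubling on these boundary balls,
  and \<open>W(S(a))\<close> is comparable to \<open>W(\<Delta>(a/|a|, 1 - |a|))\<close>. Hence a kernel decaying like a sufficiently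
  high power of \<open>(1 - |a|) / |z - a/|a||\<close> has integral \<open>O(W(S(a)))\<close>, which bounds the norms of the
  test functions and yields one inequality.

  For the other one, push \<open>|u|\<^sup>q d\<mu>\<close> forward by \<open>\<phi>\<close> to a measure \<open>\<nu>\<close>; testing gives the Carleson
  condition \<open>\<nu>(\<Delta>) \<le> M W(\<Delta>)\<^bsup>q/p\<^esup>\<close>. Cauchy's formula with a rapidly decaying kernel on circles close to
  the boundary, applied after the zeros have been removed by Blaschke factors, shows that
  \<open>|f(z)|\<^bsup>p/2\<^esup> > \<lambda>\<close> forces the average of \<open>|f|\<^bsup>p/2\<^esup>\<close> over some \<open>\<Delta>\<close> containing \<open>z\<close> to exceed a multiple of
  \<open>\<lambda>\<close>. The Vitali covering lemma turns this into a weak type estimate for \<open>\<nu>\<close>, and integration over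
  \<open>\<lambda>\<close> gives the embedding into \<open>L\<^sup>q(\<nu>)\<close> as in the Marcinkiewicz interpolation theorem.
\<close>

section \<open>Polar coordinates\<close>

text \<open>The weight may crowd towards the circle inside each \<Delta>. For the profile 1 / ((1 -
  r) (log (e / (1 - r)))^2) a hyperbolic disc about z carries a vanishing fraction of
  W(\<Delta>(z/|z|, 1 - |z|)) as |z| tends to 1. So the sub-mean value property over hyperbolic
  discs is too weak, and circle means are integrated over all radii up to 1, where only the tail of
  the profile enters. The second obstacle is the size of the doubling constant: the quadratic decay
  of the Poisson kernel need not beat it. Cauchy's kernel is therefore multiplied by a high power of
  a holomorphic factor that equals 1 at the point of evaluation. This power, like \<gamma>, is
  chosen after the doubling constant. The exponent p/2 leaves room for interpolation: the weak
  estimate uses averages, that is exponent 1, and the available norm of |f|^(p/2) has exponent 2. As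
  p/2 may be small, holomorphic powers are taken in place of convexity, and these require a function
  without zeros.\<close>

lemma borel_measurable_cis [measurable]: "cis \<in> borel_measurable borel"
  by (intro borel_measurable_continuous_onI continuous_intros)

text \<open>Opens the way to Tonelli's theorem in the two real coordinates: a Borel measure with the
  right values on boxes is Lebesgue measure.\<close>

lemma lborel_complex_eq_distr:
  "(lborel :: complex measure) = distr (lborel \<Otimes>\<^sub>M lborel) borel (\<lambda>(x, y). Complex x y)"
proof (rule lborel_eqI)
  have meas: "(\<lambda>(x, y). Complex x y) \<in> borel_measurable (lborel \<Otimes>\<^sub>M lborel)"
    by (simp add: Complex_eq case_prod_unfold)
  fix l u :: complex
  assume le: "\<And>b. b \<in> Basis \<Longrightarrow> l \<bullet> b \<le> u \<bullet> b"
  have le': "Re l \<le> Re u" "Im l \<le> Im u"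
    using le[of 1] le[of \<i>] by (auto simp: Basis_complex_def inner_complex_def)
  have "(\<lambda>(x, y). Complex x y) -` box l u \<inter> space (lborel \<Otimes>\<^sub>M lborel)
      = {Re l<..<Re u} \<times> {Im l<..<Im u}"
    by (auto simp: box_complex_eq space_pair_measure in_box_complex_iff)
  then show "emeasure (distr (lborel \<Otimes>\<^sub>M lborel) borel (\<lambda>(x, y). Complex x y)) (box l u)
      = (\<Prod>b\<in>Basis. (u - l) \<bullet> b)"
    using le'
    by (simp add: emeasure_distr[OF meas] lborel.emeasure_pair_measure_Times Basis_complex_def
        inner_complex_def ennreal_mult)
qed simp

lemma nn_integral_lborel_complex:
  assumes F: "F \<in> borel_measurable borel"
  shows "(\<integral>\<^sup>+z. F z \<partial>lborel) = (\<integral>\<^sup>+x. \<integral>\<^sup>+y. F (Complex x y) \<partial>lborel \<partial>lborel)"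
    and "(\<integral>\<^sup>+z. F z \<partial>lborel) = (\<integral>\<^sup>+y. \<integral>\<^sup>+x. F (Complex x y) \<partial>lborel \<partial>lborel)"
proof -
  have meas: "(\<lambda>(x, y). Complex x y) \<in> borel_measurable (lborel \<Otimes>\<^sub>M lborel)"
    by (simp add: Complex_eq case_prod_unfold)
  have F': "(\<lambda>(x, y). F (Complex x y)) \<in> borel_measurable (lborel \<Otimes>\<^sub>M lborel)"
    using measurable_compose[OF meas, of F borel] F by (simp add: case_prod_unfold)
  have "(\<integral>\<^sup>+z. F z \<partial>lborel) = (\<integral>\<^sup>+z. F z \<partial>distr (lborel \<Otimes>\<^sub>M lborel) borel (\<lambda>(x, y). Complex x y))"
    by (simp flip: lborel_complex_eq_distr)
  also have "\<dots> = (\<integral>\<^sup>+z. (\<lambda>(x, y). F (Complex x y)) z \<partial>(lborel \<Otimes>\<^sub>M lborel))"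
    using F by (subst nn_integral_distr[OF meas]) (auto simp: case_prod_unfold)
  finally have *: "(\<integral>\<^sup>+z. F z \<partial>lborel) = (\<integral>\<^sup>+z. (\<lambda>(x, y). F (Complex x y)) z \<partial>(lborel \<Otimes>\<^sub>M lborel))" .
  show "(\<integral>\<^sup>+z. F z \<partial>lborel) = (\<integral>\<^sup>+x. \<integral>\<^sup>+y. F (Complex x y) \<partial>lborel \<partial>lborel)"
    unfolding * using lborel.nn_integral_fst[OF F'] by simp
  show "(\<integral>\<^sup>+z. F z \<partial>lborel) = (\<integral>\<^sup>+y. \<integral>\<^sup>+x. F (Complex x y) \<partial>lborel \<partial>lborel)"
    unfolding * using lborel_pair.nn_integral_snd[OF F'] by simp
qed

text \<open>Substituting first \<open>x' = Re c x - Im c y\<close> and then \<open>y\<close> uses only affine changes of one real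
  variable; it needs \<open>Re c \<noteq> 0\<close>, and the remaining rotations are squares of rotations of this kind.\<close>

lemma nn_integral_lborel_rotate_aux:
  assumes F[measurable]: "F \<in> borel_measurable borel" and c: "cmod c = 1" "Re c \<noteq> 0"
  shows "(\<integral>\<^sup>+z. F (c * z) \<partial>lborel) = (\<integral>\<^sup>+z. F z \<partial>lborel)"
proof -
  let ?a = "Re c" and ?b = "Im c"
  have ab: "?a\<^sup>2 + ?b\<^sup>2 = 1"
    using c by (simp add: cmod_def)
  have CM[measurable]: "(\<lambda>x. Complex (f x) (g x)) \<in> borel_measurable M"
    if "f \<in> borel_measurable M" "g \<in> borel_measurable M" for f g and M :: "'x measure"
    using that by (simp add: Complex_eq)
  define G where "G = (\<lambda>x y. F (Complex x (x * ?b / ?a + y / ?a)))"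
  have "(\<integral>\<^sup>+z. F (c * z) \<partial>lborel) = (\<integral>\<^sup>+y. \<integral>\<^sup>+x. F (c * Complex x y) \<partial>lborel \<partial>lborel)"
    by (subst nn_integral_lborel_complex(2)) auto
  also have "\<dots> = (\<integral>\<^sup>+y. \<integral>\<^sup>+x. G (- y * ?b + ?a * x) y \<partial>lborel \<partial>lborel)"
  proof (intro nn_integral_cong)
    fix x y
    have "x * ?b + y * ?a = (- y * ?b + ?a * x) * ?b / ?a + y / ?a"
      using c(2) ab
      apply (simp add: divide_simps power2_eq_square)
      by algebra
    then have "c * Complex x y = Complex (- y * ?b + ?a * x) ((- y * ?b + ?a * x) * ?b / ?a + y / ?a)"
      by (auto simp: complex_eq_iff algebra_simps)
    then show "F (c * Complex x y) = G (- y * ?b + ?a * x) y"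
      by (simp add: G_def)
  qed
  also have "\<dots> = (\<integral>\<^sup>+y. (\<integral>\<^sup>+x. G x y \<partial>lborel) / \<bar>?a\<bar> \<partial>lborel)"
  proof (intro nn_integral_cong)
    fix y
    have "(\<integral>\<^sup>+x. G x y \<partial>lborel) = \<bar>?a\<bar> * (\<integral>\<^sup>+x. G (- y * ?b + ?a * x) y \<partial>lborel)"
      using c(2) by (intro nn_integral_real_affine) (auto simp: G_def)
    then show "(\<integral>\<^sup>+x. G (- y * ?b + ?a * x) y \<partial>lborel) = (\<integral>\<^sup>+x. G x y \<partial>lborel) / \<bar>?a\<bar>"
      using c(2) by (simp add: ennreal_mult_divide_eq mult.commute[of "ennreal \<bar>?a\<bar>"])
  qed
  also have "\<dots> = (\<integral>\<^sup>+y. \<integral>\<^sup>+x. G x y \<partial>lborel \<partial>lborel) / \<bar>?a\<bar>"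
    by (simp add: nn_integral_divide G_def)
  also have "(\<integral>\<^sup>+y. \<integral>\<^sup>+x. G x y \<partial>lborel \<partial>lborel) = (\<integral>\<^sup>+x. \<integral>\<^sup>+y. G x y \<partial>lborel \<partial>lborel)"
    by (rule lborel_pair.Fubini') (simp add: G_def)
  also have "\<dots> = (\<integral>\<^sup>+x. \<bar>?a\<bar> * (\<integral>\<^sup>+y. F (Complex x y) \<partial>lborel) \<partial>lborel)"
  proof (intro nn_integral_cong)
    fix x
    have "(\<integral>\<^sup>+y. F (Complex x y) \<partial>lborel) = \<bar>1 / ?a\<bar> * (\<integral>\<^sup>+y. F (Complex x (x * ?b / ?a + (1 / ?a) * y)) \<partial>lborel)"
      using c(2) by (intro nn_integral_real_affine) auto
    then have "(\<integral>\<^sup>+y. F (Complex x y) \<partial>lborel) = ennreal (1 / \<bar>?a\<bar>) * (\<integral>\<^sup>+y. G x y \<partial>lborel)"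
      by (simp add: G_def abs_divide)
    then have "\<bar>?a\<bar> * (\<integral>\<^sup>+y. F (Complex x y) \<partial>lborel) = (ennreal \<bar>?a\<bar> * ennreal (1 / \<bar>?a\<bar>)) * (\<integral>\<^sup>+y. G x y \<partial>lborel)"
      by (simp add: mult.assoc)
    also have "ennreal \<bar>?a\<bar> * ennreal (1 / \<bar>?a\<bar>) = 1"
      using c(2) by (simp flip: ennreal_mult ennreal_1)
    finally show "(\<integral>\<^sup>+y. G x y \<partial>lborel) = \<bar>?a\<bar> * (\<integral>\<^sup>+y. F (Complex x y) \<partial>lborel)"
      by simp
  qed
  also have "\<dots> = \<bar>?a\<bar> * (\<integral>\<^sup>+z. F z \<partial>lborel)"
    by (subst nn_integral_lborel_complex(1)[OF F]) (simp add: nn_integral_cmult)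
  also have "\<dots> / \<bar>?a\<bar> = (\<integral>\<^sup>+z. F z \<partial>lborel)"
    using c(2) by (simp add: ennreal_mult_divide_eq mult.commute[of "ennreal \<bar>?a\<bar>"])
  finally show ?thesis .
qed

lemma nn_integral_lborel_rotate:
  assumes F[measurable]: "F \<in> borel_measurable borel" and c: "cmod c = 1"
  shows "(\<integral>\<^sup>+z. F (c * z) \<partial>lborel) = (\<integral>\<^sup>+z. F z \<partial>lborel)"
proof (cases "Re c = 0")
  case False
  then show ?thesis by (intro nn_integral_lborel_rotate_aux assms)
next
  case True
  define d where "d = csqrt c"
  have dd: "c = d * d"
    by (simp add: d_def flip: power2_eq_square)
  have d1: "cmod d = 1"
    using c by (simp add: d_def norm_csqrt)
  have "Re d \<noteq> 0"
  proof
    assume "Re d = 0"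
    then have "Re c = - (Im d)\<^sup>2" "Im d \<noteq> 0"
      using d1 by (auto simp: dd power2_eq_square cmod_def)
    with True show False by simp
  qed
  then show ?thesis
    using nn_integral_lborel_rotate_aux[of "\<lambda>z. F (d * z)" d]
      nn_integral_lborel_rotate_aux[of F d] d1
    by (simp add: dd mult.assoc)
qed

text \<open>The area pi a^2 of a disc is the integral of 2 pi r over [0, a]. Agreement on half-lines
  suffices, because they generate the Borel sets and are stable under intersection.\<close>

lemma distr_lborel_cmod:
  "distr lborel borel cmod = density lborel (\<lambda>r. ennreal (2 * pi * r) * indicator {0..} r)"
  (is "?M = ?N")
proof (rule measure_eqI_generator_eq[where E = "range (\<lambda>a. {..a})" and \<Omega> = UNIV
      and A = "\<lambda>n. {..real n}"])
  show "Int_stable (range (\<lambda>a::real. {..a}))"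
    by (auto simp: Int_stable_def)
  show "sets ?M = sigma_sets UNIV (range (\<lambda>a. {..a}))" "sets ?N = sigma_sets UNIV (range (\<lambda>a. {..a}))"
    by (simp_all add: borel_eq_atMost)
  have M: "emeasure ?M {..a} = ennreal (if a < 0 then 0 else pi * a\<^sup>2)" for a
  proof -
    have "emeasure ?M {..a} = emeasure lborel (cball (0 :: complex) a)"
      by (subst emeasure_distr) (auto simp: cball_def intro!: arg_cong2[where f = emeasure])
    also have "\<dots> = ennreal (if a < 0 then 0 else pi * a\<^sup>2)"
      by (auto simp: emeasure_cball unit_ball_vol_2)
    finally show ?thesis .
  qed
  show "emeasure ?M X = emeasure ?N X" if X: "X \<in> range (\<lambda>a. {..a})" for X
  proof -
    obtain a where a: "X = {..a}"
      using X by auto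
    have N: "emeasure ?N X = (\<integral>\<^sup>+r. ennreal (2 * pi * r) * indicator {0..a} r \<partial>lborel)"
      by (subst emeasure_density) (auto simp: a intro!: nn_integral_cong split: split_indicator)
    show ?thesis
    proof (cases "a < 0")
      case True
      then show ?thesis using M[of a] by (simp add: N) (simp add: a)
    next
      case False
      have "(\<integral>\<^sup>+r. ennreal (2 * pi * r) * indicator {0..a} r \<partial>lborel) = pi * a\<^sup>2 - pi * 0\<^sup>2"
        using False
        by (intro nn_integral_FTC_Icc) (auto intro!: derivative_eq_intros)
      then show ?thesis using M[of a] False by (simp add: N) (simp add: a)
    qed
  qed
  show "range (\<lambda>n. {..real n}) \<subseteq> range (\<lambda>a. {..a})" by auto
  show "(\<Union>n. {..real n}) = UNIV"
    using real_arch_simple by auto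
  show "emeasure ?M {..real n} \<noteq> \<infinity>" for n
    by (simp add: M)
qed auto

lemma nn_integral_lborel_shift:
  fixes t :: real
  assumes [measurable]: "G \<in> borel_measurable borel"
  shows "(\<integral>\<^sup>+x. G (x + t) \<partial>lborel) = (\<integral>\<^sup>+x. G x \<partial>lborel)"
  using nn_integral_real_affine[of G 1 t] by (simp add: add.commute)

text \<open>The integrand has period 2 pi, so the part of the shifted interval beyond 2 pi is moved
  back by one period.\<close>

lemma nn_integral_cis_shift:
  assumes F[measurable]: "F \<in> borel_measurable borel" and t: "0 \<le> t" "t \<le> 2 * pi"
  shows "(\<integral>\<^sup>+x\<in>{0..<2*pi}. F (r * cis (x + t)) \<partial>lborel) = (\<integral>\<^sup>+x\<in>{0..<2*pi}. F (r * cis x) \<partial>lborel)"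
proof -
  define G where "G x = F (r * cis x)" for x
  have [measurable]: "G \<in> borel_measurable borel"
    unfolding G_def by measurable
  have per: "G (x + 2 * pi) = G x" for x
    by (simp add: G_def flip: cis_mult)
  have "(\<integral>\<^sup>+x\<in>{0..<2*pi}. G (x + t) \<partial>lborel) = (\<integral>\<^sup>+x. G (x + t) * indicator {t..<2*pi+t} (x + t) \<partial>lborel)"
    by (intro nn_integral_cong) (auto split: split_indicator)
  also have "\<dots> = (\<integral>\<^sup>+x. G x * indicator {t..<2*pi+t} x \<partial>lborel)"
    by (rule nn_integral_lborel_shift) auto
  also have "\<dots> = (\<integral>\<^sup>+x. G x * indicator {t..<2*pi} x + G x * indicator {2*pi..<2*pi+t} x \<partial>lborel)"
    using t by (intro nn_integral_cong) (auto split: split_indicator)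
  also have "\<dots> = (\<integral>\<^sup>+x. G x * indicator {t..<2*pi} x \<partial>lborel) + (\<integral>\<^sup>+x. G x * indicator {2*pi..<2*pi+t} x \<partial>lborel)"
    by (rule nn_integral_add) auto
  also have "(\<integral>\<^sup>+x. G x * indicator {2*pi..<2*pi+t} x \<partial>lborel) = (\<integral>\<^sup>+x. G (x + 2*pi) * indicator {2*pi..<2*pi+t} (x + 2*pi) \<partial>lborel)"
    by (rule nn_integral_lborel_shift[symmetric]) auto
  also have "\<dots> = (\<integral>\<^sup>+x. G x * indicator {0..<t} x \<partial>lborel)"
    by (intro nn_integral_cong) (auto simp: per split: split_indicator)
  also have "(\<integral>\<^sup>+x. G x * indicator {t..<2*pi} x \<partial>lborel) + (\<integral>\<^sup>+x. G x * indicator {0..<t} x \<partial>lborel)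
      = (\<integral>\<^sup>+x. G x * indicator {t..<2*pi} x + G x * indicator {0..<t} x \<partial>lborel)"
    by (rule nn_integral_add[symmetric]) auto
  also have "\<dots> = (\<integral>\<^sup>+x\<in>{0..<2*pi}. G x \<partial>lborel)"
    using t by (intro nn_integral_cong) (auto split: split_indicator)
  finally show ?thesis by (simp add: G_def)
qed

text \<open>Rotation invariance replaces a Jacobian: averaging F over all rotations turns it into
  the radial function \<Phi>(|z|), whose integral depends only on the distribution of |z|.\<close>

theorem nn_integral_polar:
  assumes F[measurable]: "F \<in> borel_measurable borel"
  shows "(\<integral>\<^sup>+z. F z \<partial>lborel) =
    (\<integral>\<^sup>+r\<in>{0..}. ennreal r * (\<integral>\<^sup>+x\<in>{0..<2*pi}. F (r * cis x) \<partial>lborel) \<partial>lborel)"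
proof -
  define \<Phi> where "\<Phi> r = (\<integral>\<^sup>+x\<in>{0..<2*pi}. F (of_real r * cis x) \<partial>lborel)" for r :: real
  have [measurable]: "\<Phi> \<in> borel_measurable borel"
    unfolding \<Phi>_def by measurable
  have inner: "(\<integral>\<^sup>+x\<in>{0..<2*pi}. F (cis x * z) \<partial>lborel) = \<Phi> (cmod z)" for z
  proof -
    obtain t where t: "0 \<le> t" "t < 2 * pi" "z = of_real (cmod z) * cis t"
      using that[of "Arg2pi z"] Arg2pi[of z] by (simp add: is_Arg_def cis_conv_exp)
    have "cis x * z = of_real (cmod z) * cis (x + t)" for x
      by (subst t(3)) (simp add: mult_ac flip: cis_mult)
    then show ?thesis
      using nn_integral_cis_shift[OF F, of t "cmod z"] t(1,2) by (simp add: \<Phi>_def)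
  qed
  have "ennreal (2*pi) * (\<integral>\<^sup>+z. F z \<partial>lborel) = (\<integral>\<^sup>+x\<in>{0..<2*pi}. (\<integral>\<^sup>+z. F z \<partial>lborel) \<partial>lborel)"
    by (simp add: nn_integral_cmult mult.commute)
  also have "\<dots> = (\<integral>\<^sup>+x. \<integral>\<^sup>+z. F (cis x * z) * indicator {0..<2*pi} x \<partial>lborel \<partial>lborel)"
    by (intro nn_integral_cong) (simp add: nn_integral_multc nn_integral_lborel_rotate)
  also have "\<dots> = (\<integral>\<^sup>+z. \<integral>\<^sup>+x. F (cis x * z) * indicator {0..<2*pi} x \<partial>lborel \<partial>lborel)"
    by (rule lborel_pair.Fubini') simp
  also have "\<dots> = (\<integral>\<^sup>+z. \<Phi> (cmod z) \<partial>lborel)"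
    by (simp add: inner)
  also have "\<dots> = (\<integral>\<^sup>+r. \<Phi> r \<partial>distr lborel borel cmod)"
    by (subst nn_integral_distr) auto
  also have "\<dots> = (\<integral>\<^sup>+r. (ennreal (2 * pi * r) * indicator {0..} r) * \<Phi> r \<partial>lborel)"
    by (subst distr_lborel_cmod, subst nn_integral_density) auto
  also have "\<dots> = (\<integral>\<^sup>+r. ennreal (2 * pi) * (ennreal r * \<Phi> r * indicator {0..} r) \<partial>lborel)"
    by (intro nn_integral_cong) (auto simp: ennreal_mult mult_ac split: split_indicator)
  also have "\<dots> = ennreal (2 * pi) * (\<integral>\<^sup>+r\<in>{0..}. ennreal r * \<Phi> r \<partial>lborel)"
    by (simp add: nn_integral_cmult)
  finally show ?thesis
    by (simp add: \<Phi>_def ennreal_mult_cancel_left)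
qed

section \<open>A weighted mean value inequality for powers of holomorphic functions\<close>

text \<open>This is the identity behind the Blaschke factor s (w - a) / (s^2 - cnj a * w) of the
  disc of radius s. Its right-hand side vanishes for |w| = s and is nonnegative inside, so the
  factor has modulus one on the circle and at most one in the disc.\<close>

lemma cmod_reflection_diff:
  "(cmod (of_real (s\<^sup>2) - cnj a * w))\<^sup>2 - (s * cmod (w - a))\<^sup>2 = (s\<^sup>2 - (cmod a)\<^sup>2) * (s\<^sup>2 - (cmod w)\<^sup>2)"
  unfolding power_mult_distrib cmod_power2
  by (simp add: power2_eq_square algebra_simps)

lemma cmod_reflection_circle:
  assumes "0 < s" "cmod w = s"
  shows "cmod (of_real (s\<^sup>2) - cnj a * w) = s * cmod (w - a)"
  using cmod_reflection_diff[of s a w] assms by (simp add: power2_eq_iff_nonneg)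

lemma cmod_reflection_ge:
  assumes "0 < s" "cmod w \<le> s" "cmod a \<le> s"
  shows "s * cmod (w - a) \<le> cmod (of_real (s\<^sup>2) - cnj a * w)"
proof -
  have "0 \<le> (s\<^sup>2 - (cmod a)\<^sup>2) * (s\<^sup>2 - (cmod w)\<^sup>2)"
    using assms by (intro mult_nonneg_nonneg) (auto simp: power_mono)
  then have "(s * cmod (w - a))\<^sup>2 \<le> (cmod (of_real (s\<^sup>2) - cnj a * w))\<^sup>2"
    unfolding cmod_reflection_diff[symmetric] by simp
  then show ?thesis
    by (rule power2_le_imp_le) simp
qed

lemma reflection_nonzero:
  assumes "cmod a < s" "cmod w \<le> s"
  shows "of_real (s\<^sup>2) - cnj a * w \<noteq> 0"
proof -
  have s: "0 < s"
    using assms(1) norm_ge_zero[of a] by linarith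
  have "cmod a * cmod w \<le> cmod a * s"
    using assms(2) by (intro mult_left_mono) auto
  also have "\<dots> < s * s"
    using assms(1) s by (intro mult_strict_right_mono)
  finally have "cmod (cnj a * w) < cmod (of_real (s\<^sup>2))"
    by (simp add: norm_mult power2_eq_square)
  then show ?thesis by auto
qed

section \<open>Removal of zeros by Blaschke factors\<close>

lemma holomorphic_divide_zero:
  assumes f: "f holomorphic_on S" and S: "open S" "connected S" "a \<in> S"
    and nz: "f a = 0" "b \<in> S" "f b \<noteq> 0"
  obtains g n where "g holomorphic_on S" "\<And>w. w \<in> S \<Longrightarrow> f w = (w - a) ^ n * g w" "g a \<noteq> 0"
proof -
  have "\<not> f constant_on S"
    using nz S(3) by (metis constant_on_def)
  then obtain g r n where g: "0 < n" "0 < r" "ball a r \<subseteq> S" "g holomorphic_on ball a r"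
      "\<And>w. w \<in> ball a r \<Longrightarrow> f w = (w - a) ^ n * g w" "\<And>w. w \<in> ball a r \<Longrightarrow> g w \<noteq> 0"
    using holomorphic_factor_zero_nonconstant[OF f S nz(1)] by metis
  \<comment> \<open>The local cofactor near a is glued to the quotient on the rest of S; the two
    agree on the punctured ball.\<close>
  define G where "G w = (if w \<in> ball a r then g w else f w / (w - a) ^ n)" for w
  have eq: "G w = f w / (w - a) ^ n" if "w \<noteq> a" for w
    using that g(5) by (auto simp: G_def)
  have "G holomorphic_on ball a r"
    using g(4) by (rule holomorphic_transform) (auto simp: G_def)
  moreover have "G holomorphic_on S - {a}"
  proof (rule holomorphic_transform)
    show "(\<lambda>w. f w / (w - a) ^ n) holomorphic_on S - {a}"
      using f by (auto intro!: holomorphic_intros intro: holomorphic_on_subset)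
  qed (use eq in auto)
  ultimately have "G holomorphic_on ball a r \<union> (S - {a})"
    using S by (intro holomorphic_on_Un) auto
  moreover have "ball a r \<union> (S - {a}) = S"
    using g(2,3) S(3) by auto
  moreover have "f w = (w - a) ^ n * G w" for w
    using eq[of w] nz(1) g(1,2) by (cases "w = a") auto
  moreover have "G a \<noteq> 0"
    using g(2,6) by (auto simp: G_def)
  ultimately show ?thesis
    using that[of G n] by simp
qed

text \<open>Induction on the number of distinct zeros in the closed disc. Dividing by the Blaschke
  factor at a, raised to the full order of the zero, removes it without changing the modulus on the
  circle or lowering it inside. The zeros introduced lie at reflected points, outside the closed
  disc of radius s.\<close>

lemma Blaschke_zero_removal:
  assumes "f holomorphic_on ball 0 1" "0 < s" "s < 1" "\<And>w. cmod w = s \<Longrightarrow> f w \<noteq> 0"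
  shows "\<exists>h. h holomorphic_on ball 0 1 \<and> (\<forall>w. cmod w \<le> s \<longrightarrow> h w \<noteq> 0) \<and>
    (\<forall>w. cmod w = s \<longrightarrow> cmod (h w) = cmod (f w)) \<and> (\<forall>w. cmod w \<le> s \<longrightarrow> cmod (f w) \<le> cmod (h w))"
  using assms(1,4)
proof (induction "card {w \<in> cball 0 s. f w = 0}" arbitrary: f rule: less_induct)
  case (less f)
  let ?Z = "\<lambda>f. {w \<in> cball 0 s. f w = 0}"
  have s1: "complex_of_real s \<in> ball 0 1" "f (of_real s) \<noteq> 0"
    using assms less(3)[of "of_real s"] by auto
  show ?case
  proof (cases "?Z f = {}")
    case True
    then show ?thesis using less by (intro exI[of _ f]) auto
  next
    case False
    then obtain a where a: "cmod a \<le> s" "f a = 0"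
      by auto
    have "a \<in> ball 0 1"
      using a(1) assms(3) by simp
    then have "\<not> f constant_on ball 0 1"
      using s1 a(2) unfolding constant_on_def by metis
    moreover have "cball 0 s \<subseteq> ball (0 :: complex) 1"
      using assms(3) by auto
    ultimately have fin: "finite (?Z f)"
      using holomorphic_compact_finite_zeros[OF less(2) open_ball connected_ball compact_cball] by blast
    have as: "cmod a < s"
      using a less(3)[of a] by force
    obtain g n where g: "g holomorphic_on ball 0 1" "\<And>w. w \<in> ball 0 1 \<Longrightarrow> f w = (w - a) ^ n * g w" "g a \<noteq> 0"
      using holomorphic_divide_zero[OF less(2) _ _ _ a(2) s1] as assms(3) by auto
    \<comment> \<open>This is f times the n-th power of (s^2 - cnj a * w) / (s (w - a)), with the
      powers of w - a already cancelled.\<close>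
    define k where "k w = g w * ((of_real (s\<^sup>2) - cnj a * w) / of_real s) ^ n" for w
    have k: "k holomorphic_on ball 0 1"
      unfolding k_def by (intro holomorphic_intros g) (use assms in auto)
    have kz: "k w = 0 \<longleftrightarrow> g w = 0" if "cmod w \<le> s" for w
    proof -
      have "of_real (s\<^sup>2) - cnj a * w \<noteq> 0"
        using reflection_nonzero[OF as that] .
      then show ?thesis
        using assms(2) by (auto simp: k_def)
    qed
    have nk: "cmod (k w) = cmod (g w) * (cmod (of_real (s\<^sup>2) - cnj a * w) / s) ^ n" for w
      using assms(2) by (simp add: k_def norm_mult norm_power norm_divide)
    have nf: "cmod (f w) = cmod (g w) * cmod (w - a) ^ n" if "cmod w \<le> s" for w
      using g(2)[of w] that assms(3) by (simp add: norm_mult norm_power)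
    have ks: "cmod (k w) = cmod (f w)" if "cmod w = s" for w
      using nk[of w] nf[of w] that assms(2) cmod_reflection_circle[OF assms(2) that, of a] by simp
    have kle: "cmod (f w) \<le> cmod (k w)" if "cmod w \<le> s" for w
      unfolding nk nf[OF that] using assms(2) cmod_reflection_ge[OF assms(2) that a(1)]
      by (intro mult_left_mono power_mono) (auto simp: field_simps)
    have "?Z k \<subset> ?Z f"
    proof
      show "?Z k \<subseteq> ?Z f"
        using kle by force
      show "?Z k \<noteq> ?Z f"
        using a kz[of a] g(3) by force
    qed
    then have "card (?Z k) < card (?Z f)"
      using fin by (simp add: psubset_card_mono)
    moreover have "k w \<noteq> 0" if "cmod w = s" for w
      using ks[OF that] less(3)[OF that] by force
    ultimately obtain h where h: "h holomorphic_on ball 0 1" "\<forall>w. cmod w \<le> s \<longrightarrow> h w \<noteq> 0"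
        "\<forall>w. cmod w = s \<longrightarrow> cmod (h w) = cmod (k w)" "\<forall>w. cmod w \<le> s \<longrightarrow> cmod (k w) \<le> cmod (h w)"
      using less(1)[of k] k by blast
    show ?thesis
      using h ks kle by (intro exI[of _ h]) force
  qed
qed

text \<open>On |w| = s this is the Cauchy kernel s / |w - z| times the m-th power of the modulus of
  (s^2 - |z|^2) / (s^2 - cnj z * w). For m = 1 it is the Poisson kernel; larger m gives decay of
  order m + 1 away from z.\<close>

definition circle_kernel :: "nat \<Rightarrow> real \<Rightarrow> complex \<Rightarrow> complex \<Rightarrow> real" where
  "circle_kernel m s z w = s * ((s\<^sup>2 - (cmod z)\<^sup>2) / s) ^ m / cmod (w - z) ^ (m + 1)"

lemma norm_le_circle_integral:
  assumes F: "F holomorphic_on cball 0 s" and s: "0 < s" and z: "cmod z < s"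
  shows "ennreal (2 * pi * cmod (F z)) \<le>
    (\<integral>\<^sup>+x\<in>{0..<2*pi}. ennreal (cmod (F (of_real s * cis x)) * s / cmod (of_real s * cis x - z)) \<partial>lborel)"
proof -
  let ?w = "\<lambda>x. of_real s * cis x"
  have "((\<lambda>u. F u / (u - z)) has_contour_integral (2 * of_real pi * \<i> * F z)) (circlepath 0 s)"
    using Cauchy_integral_circlepath_simple[OF F, of z] z by simp
  then have I: "((\<lambda>t. F (?w t) / (?w t - z) * of_real s * \<i> * cis t) has_integral (2 * of_real pi * \<i> * F z)) {0..2*pi}"
    unfolding circlepath_def by (subst (asm) has_contour_integral_part_circlepath_iff) auto
  let ?k = "\<lambda>x. cmod (F (?w x)) * s / cmod (?w x - z)"
  have nz: "?w x \<noteq> z" for x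
  proof
    assume "?w x = z"
    then have "cmod z = s"
      using s by (auto simp: norm_mult)
    with z show False by simp
  qed
  have "continuous_on {0..2*pi} (\<lambda>x. F (?w x))"
    using s by (intro continuous_on_compose2[OF holomorphic_on_imp_continuous_on[OF F]] continuous_intros)
      (auto simp: norm_mult)
  then have cont: "continuous_on {0..2*pi} ?k"
    by (intro continuous_intros) (auto simp: nz)
  then have K: "(?k has_integral integral {0..2*pi} ?k) {0..2*pi}"
    by (intro integrable_integral integrable_continuous_real)
  have "norm (integral {0..2*pi} (\<lambda>t. F (?w t) / (?w t - z) * of_real s * \<i> * cis t)) \<le> integral {0..2*pi} ?k"
  proof (rule integral_norm_bound_integral)
    fix t
    show "norm (F (?w t) / (?w t - z) * of_real s * \<i> * cis t) \<le> ?k t"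
      using s by (simp add: norm_mult norm_divide)
  qed (rule has_integral_integrable[OF I] has_integral_integrable[OF K])+
  then have "norm (2 * of_real pi * \<i> * F z) \<le> integral {0..2*pi} ?k"
    unfolding integral_unique[OF I] .
  then have "ennreal (2 * pi * cmod (F z)) \<le> ennreal (integral {0..2*pi} ?k)"
    by (intro ennreal_leI) (simp add: norm_mult)
  also have "\<dots> = (\<integral>\<^sup>+x. ennreal (indicator {0..2*pi} x * ?k x) \<partial>lborel)"
    by (rule nn_integral_has_integral_lebesgue[OF _ K, symmetric]) (use s in simp)
  also have "\<dots> = (\<integral>\<^sup>+x\<in>{0..2*pi}. ?k x \<partial>lborel)"
    by (intro nn_integral_cong) (simp split: split_indicator)
  also have "\<dots> = (\<integral>\<^sup>+x\<in>{0..<2*pi}. ?k x \<partial>lborel)"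
  proof (rule nn_integral_cong_AE)
    show "AE x in lborel. ennreal (?k x) * indicator {0..2*pi} x = ennreal (?k x) * indicator {0..<2*pi} x"
      using AE_lborel_singleton[of "2*pi"] by eventually_elim (simp split: split_indicator)
  qed
  finally show ?thesis .
qed

text \<open>Once its zeros are removed, f is replaced by a function h with a holomorphic logarithm
  near the closed disc, so exp (\<alpha> log h) is available for every \<alpha> > 0, however small.
  Cauchy's formula is applied to it, and h returns to f because the moduli agree on the circle and
  |f| \<le> |h| inside.\<close>

theorem powr_norm_le_circle_integral:
  assumes f: "f holomorphic_on ball 0 1" and s: "s < 1" and z: "cmod z < s"
    and nz: "\<And>w. cmod w = s \<Longrightarrow> f w \<noteq> 0" and \<alpha>: "0 < \<alpha>"
  shows "ennreal (2 * pi * cmod (f z) powr \<alpha>) \<le>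
    (\<integral>\<^sup>+x\<in>{0..<2*pi}. ennreal (cmod (f (of_real s * cis x)) powr \<alpha> * circle_kernel m s z (of_real s * cis x)) \<partial>lborel)"
proof -
  have s0: "0 < s"
    using z norm_ge_zero[of z] by linarith
  obtain h where h: "h holomorphic_on ball 0 1" "\<And>w. cmod w \<le> s \<Longrightarrow> h w \<noteq> 0"
      "\<And>w. cmod w = s \<Longrightarrow> cmod (h w) = cmod (f w)" "\<And>w. cmod w \<le> s \<Longrightarrow> cmod (f w) \<le> cmod (h w)"
    using Blaschke_zero_removal[OF f s0 s nz] by metis
  define U where "U = {w \<in> ball 0 1. h w \<noteq> 0}"
  have "open U"
  proof -
    have "open (ball 0 1 \<inter> h -` (- {0}))"
      by (intro continuous_open_preimage holomorphic_on_imp_continuous_on[OF h(1)]) auto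
    moreover have "U = ball 0 1 \<inter> h -` (- {0})"
      by (auto simp: U_def)
    ultimately show ?thesis by simp
  qed
  moreover have "cball 0 s \<subseteq> U"
    using h(2) s by (auto simp: U_def)
  \<comment> \<open>Compactness makes h zero-free on a slightly larger disc, which is convex and so
    carries a logarithm of h.\<close>
  ultimately obtain e where e: "0 < e" "(\<Union>x\<in>cball 0 s. ball x e) \<subseteq> U"
    using compact_subset_open_imp_ball_epsilon_subset[of "cball 0 s" U] by auto
  have sub: "ball 0 (s + e) \<subseteq> U"
  proof
    fix w :: complex assume w: "w \<in> ball 0 (s + e)"
    show "w \<in> U"
    proof (cases "cmod w \<le> s")
      case True
      then show ?thesis using \<open>cball 0 s \<subseteq> U\<close> by auto
    next
      case False
      then have w0: "w \<noteq> 0"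
        using s0 by auto
      \<comment> \<open>The radial projection of w to the circle of radius s; its distance from w is
        |w| - s < e.\<close>
      define v where "v = of_real (s / cmod w) * w"
      have "cmod v = s"
        using False s0 by (auto simp: v_def norm_mult norm_divide)
      moreover have "w - v = of_real ((cmod w - s) / cmod w) * w"
        using w0 by (simp add: v_def diff_divide_distrib left_diff_distrib)
      then have "cmod (w - v) = cmod w - s"
        using False w0 by (simp add: norm_mult norm_divide flip: of_real_diff)
      ultimately have "v \<in> cball 0 s" "w \<in> ball v e"
        using w by (auto simp: dist_norm norm_minus_commute)
      then show ?thesis using e(2) by blast
    qed
  qed
  have "h holomorphic_on ball 0 (s + e)"
    by (rule holomorphic_on_subset[OF h(1)]) (use sub in \<open>auto simp: U_def\<close>)
  moreover have "\<And>w. w \<in> ball 0 (s + e) \<Longrightarrow> h w \<noteq> 0"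
    using sub by (auto simp: U_def)
  ultimately obtain L where L: "L holomorphic_on ball 0 (s + e)" "\<And>w. w \<in> ball 0 (s + e) \<Longrightarrow> h w = exp (L w)"
    using contractible_imp_holomorphic_log[of h "ball 0 (s + e)"] convex_imp_contractible[OF convex_ball] by metis
  have cb: "cball 0 s \<subseteq> ball 0 (s + e)"
    using e(1) by auto
  define Q where "Q w = of_real (s\<^sup>2) - cnj z * w" for w
  have Q: "Q w \<noteq> 0" if "cmod w \<le> s" for w
    unfolding Q_def using reflection_nonzero[OF z that] .
  define F where "F w = exp (of_real \<alpha> * L w) * (of_real (s\<^sup>2 - (cmod z)\<^sup>2) / Q w) ^ m" for w
  have "F holomorphic_on cball 0 s"
    unfolding F_def Q_def
    by (intro holomorphic_intros holomorphic_on_subset[OF L(1) cb]) (use Q in \<open>auto simp: Q_def\<close>)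
  note main = norm_le_circle_integral[OF this s0 z]
  have nexp: "cmod (exp (of_real \<alpha> * L w)) = cmod (h w) powr \<alpha>" if "cmod w \<le> s" for w
    using L(2)[of w] that e(1) by (simp add: powr_def)
  \<comment> \<open>Hence the extra factor in F is 1 at z: it leaves the value at z alone and only
    improves the decay on the circle.\<close>
  have "Q z = of_real (s\<^sup>2 - (cmod z)\<^sup>2)"
    by (simp add: Q_def complex_norm_square mult.commute flip: of_real_power)
  then have "cmod (F z) = cmod (h z) powr \<alpha>"
    using nexp[of z] z Q[of z] by (simp add: F_def norm_mult)
  then have "ennreal (2 * pi * cmod (f z) powr \<alpha>) \<le> ennreal (2 * pi * cmod (F z))"
    using h(4)[of z] z \<alpha> by (intro ennreal_leI) (auto intro: powr_mono2)
  also note main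
  also have "(\<integral>\<^sup>+x\<in>{0..<2*pi}. ennreal (cmod (F (of_real s * cis x)) * s / cmod (of_real s * cis x - z)) \<partial>lborel)
    = (\<integral>\<^sup>+x\<in>{0..<2*pi}. ennreal (cmod (f (of_real s * cis x)) powr \<alpha> * circle_kernel m s z (of_real s * cis x)) \<partial>lborel)"
  proof (intro nn_integral_cong)
    fix x :: real
    let ?w = "of_real s * cis x"
    have w: "cmod ?w = s"
      using s0 by (simp add: norm_mult)
    have zz: "0 \<le> s\<^sup>2 - (cmod z)\<^sup>2"
      using z by (simp add: power_mono)
    have "cmod (F ?w) = cmod (f ?w) powr \<alpha> * ((s\<^sup>2 - (cmod z)\<^sup>2) / (s * cmod (?w - z))) ^ m"
      using nexp[of ?w] h(3)[of ?w] w cmod_reflection_circle[OF s0 w, of z] zz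
      unfolding F_def Q_def norm_mult norm_power norm_divide norm_of_real by simp
    then have "cmod (F ?w) * s / cmod (?w - z) = cmod (f ?w) powr \<alpha> * circle_kernel m s z ?w"
      by (simp add: circle_kernel_def power_divide power_mult_distrib mult_ac)
    then show "ennreal (cmod (F ?w) * s / cmod (?w - z)) * indicator {0..<2*pi} x =
        ennreal (cmod (f ?w) powr \<alpha> * circle_kernel m s z ?w) * indicator {0..<2*pi} x"
      by simp
  qed
  finally show ?thesis .
qed

section \<open>Radial weights and boundary balls\<close>

lemma sin_ge_half:
  fixes x :: real
  assumes "0 \<le> x" "x \<le> pi / 2"
  shows "x / 2 \<le> sin x"
proof -
  \<comment> \<open>Halving the angle puts y into [0, pi/4], where the cosine is at least sqrt 2 / 2
    and hence sin y \<ge> y sqrt 2 / 2; multiply and use sin x = 2 sin y cos y.\<close>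
  define y where "y = x / 2"
  have y: "0 \<le> y" "y \<le> pi / 4"
    using assms by (auto simp: y_def)
  have c: "sqrt 2 / 2 \<le> cos t" if "0 \<le> t" "t \<le> y" for t
    using cos_monotone_0_pi_le[of t "pi / 4"] that y by (simp add: cos_45)
  have "sin 0 - 0 * (sqrt 2 / 2) \<le> sin y - y * (sqrt 2 / 2)"
  proof (rule DERIV_nonneg_imp_nondecreasing[OF y(1)])
    fix t assume t: "0 \<le> t" "t \<le> y"
    show "\<exists>d. ((\<lambda>t. sin t - t * (sqrt 2 / 2)) has_real_derivative d) (at t) \<and> 0 \<le> d"
      by (rule exI[of _ "cos t - sqrt 2 / 2"]) (use c[OF t] in \<open>auto intro!: derivative_eq_intros\<close>)
  qed
  then have "y * (sqrt 2 / 2) * (sqrt 2 / 2) \<le> sin y * cos y"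
    using c[of y] y sin_ge_zero[of y] by (intro mult_mono) auto
  moreover have "sin x = 2 * (sin y * cos y)"
    using sin_double[of y] by (simp add: y_def)
  moreover have "y * (sqrt 2 / 2) * (sqrt 2 / 2) = y / 2"
    by simp
  ultimately show ?thesis
    unfolding y_def by linarith
qed

lemma cmod_cis_minus_one: "cmod (cis t - 1) = 2 * \<bar>sin (t / 2)\<bar>"
  using dist_exp_i_1[of t] by (simp add: cis_conv_exp)

lemma cmod_cis_minus_one_le: "cmod (cis t - 1) \<le> \<bar>t\<bar>"
  using abs_sin_x_le_abs_x[of "t / 2"] by (simp add: cmod_cis_minus_one)

lemma cmod_cis_minus_one_ge:
  assumes "\<bar>t\<bar> \<le> pi"
  shows "\<bar>t\<bar> / 2 \<le> cmod (cis t - 1)"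
proof -
  have "\<bar>t\<bar> / 2 / 2 \<le> sin (\<bar>t\<bar> / 2)"
    using assms by (intro sin_ge_half) auto
  also have "\<dots> \<le> \<bar>sin (t / 2)\<bar>"
    by (cases "t \<ge> 0") auto
  finally show ?thesis
    by (simp add: cmod_cis_minus_one)
qed

lemma cis_plus_one: "cmod (cis x + 1) = cmod (cis (x - pi) - 1)"
  by (simp add: norm_minus_commute flip: norm_minus_cancel[of "cis x + 1"] cis_divide)

text \<open>Traces of Euclidean balls centred on the circle replace Carleson squares throughout,
  since the Vitali lemma applies to balls.\<close>

definition boundary_ball :: "complex \<Rightarrow> real \<Rightarrow> complex set" where
  "boundary_ball \<zeta> t = cball \<zeta> t \<inter> unit_disc"

lemma unit_disc_borel [measurable]: "unit_disc \<in> sets borel"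
  by simp

lemma boundary_ball_borel [measurable]: "boundary_ball \<zeta> t \<in> sets borel"
  unfolding boundary_ball_def by measurable

lemma boundary_ball_eq_disc:
  assumes "cmod \<zeta> = 1" "2 \<le> t"
  shows "boundary_ball \<zeta> t = unit_disc"
proof -
  have "dist \<zeta> w \<le> t" if "cmod w < 1" for w
    using norm_triangle_ineq4[of \<zeta> w] that assms by (simp add: dist_norm)
  then show ?thesis
    by (auto simp: boundary_ball_def)
qed

lemma boundary_ball_mono: "s \<le> t \<Longrightarrow> boundary_ball \<zeta> s \<subseteq> boundary_ball \<zeta> t"
  by (auto simp: boundary_ball_def)

text \<open>The centre -1 corresponds to the angle pi, in the middle of [0, 2 pi), so small balls do
  not wrap around in polar coordinates. Rotation invariance makes it a representative of all
  boundary centres.\<close>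

lemma mem_boundary_ball_minus_one:
  "of_real s * cis x \<in> boundary_ball (- 1) t \<longleftrightarrow> cmod (of_real s * cis x + 1) \<le> t \<and> \<bar>s\<bar> < 1"
  using norm_minus_commute[of "- 1" "of_real s * cis x"]
  by (simp add: boundary_ball_def dist_norm norm_mult)

section \<open>Radial profiles, their tails and the mass of boundary balls\<close>

definition weight_tail :: "(real \<Rightarrow> ennreal) \<Rightarrow> real \<Rightarrow> ennreal" where
  "weight_tail w r = (\<integral>\<^sup>+s\<in>{r..<1}. w s \<partial>lborel)"

definition disc_measure :: "(real \<Rightarrow> ennreal) \<Rightarrow> complex measure" where
  "disc_measure w = density lborel (\<lambda>z. w (cmod z) * indicator unit_disc z * ennreal (1 / pi))"

lemma sets_disc_measure [simp, measurable_cong]: "sets (disc_measure w) = sets borel"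
  and space_disc_measure [simp]: "space (disc_measure w) = UNIV"
  by (simp_all add: disc_measure_def)

lemma tail_antimono: "r \<le> r' \<Longrightarrow> weight_tail w r' \<le> weight_tail w r"
  unfolding weight_tail_def by (intro nn_integral_mono) (auto split: split_indicator)

text \<open>The profile is Borel and extended-valued, which makes all integrals nonnegative Borel
  integrals; it stands for an almost everywhere version of the given weight. Doubling is asked for
  at r = 0 as well, so that it covers the whole disc.\<close>

locale radial_weight =
  fixes w :: "real \<Rightarrow> ennreal" and C :: real
  assumes w [measurable]: "w \<in> borel_measurable borel"
    and tail_finite: "weight_tail w 0 < \<infinity>"
    and tail_pos: "\<And>r. 0 \<le> r \<Longrightarrow> r < 1 \<Longrightarrow> 0 < weight_tail w r"
    and C_pos: "0 < C"
    and tail_doubling: "\<And>r. 0 \<le> r \<Longrightarrow> r < 1 \<Longrightarrow> weight_tail w r \<le> ennreal C * weight_tail w ((1 + r) / 2)"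
begin

abbreviation "W \<equiv> disc_measure w"

lemma nn_integral_W_polar:
  assumes F[measurable]: "F \<in> borel_measurable borel"
  shows "(\<integral>\<^sup>+z. F z \<partial>W) = (\<integral>\<^sup>+s\<in>{0..<1}. w s * ennreal (s / pi) *
      (\<integral>\<^sup>+x\<in>{0..<2*pi}. F (of_real s * cis x) \<partial>lborel) \<partial>lborel)"
proof -
  have "(\<integral>\<^sup>+z. F z \<partial>W) = (\<integral>\<^sup>+z. (w (cmod z) * indicator unit_disc z * ennreal (1 / pi)) * F z \<partial>lborel)"
    unfolding disc_measure_def by (rule nn_integral_density) auto
  also have "\<dots> = (\<integral>\<^sup>+r\<in>{0..}. ennreal r * (\<integral>\<^sup>+x\<in>{0..<2*pi}. (w (cmod (r * cis x)) * indicator unit_disc (r * cis x)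
      * ennreal (1 / pi)) * F (r * cis x) \<partial>lborel) \<partial>lborel)"
    by (rule nn_integral_polar) simp
  also have "\<dots> = (\<integral>\<^sup>+s\<in>{0..<1}. w s * ennreal (s / pi) *
      (\<integral>\<^sup>+x\<in>{0..<2*pi}. F (of_real s * cis x) \<partial>lborel) \<partial>lborel)"
  proof (intro nn_integral_cong)
    fix r :: real
    show "ennreal r * (\<integral>\<^sup>+x\<in>{0..<2*pi}. (w (cmod (r * cis x)) * indicator unit_disc (r * cis x)
        * ennreal (1 / pi)) * F (r * cis x) \<partial>lborel) * indicator {0..} r
      = w r * ennreal (r / pi) * (\<integral>\<^sup>+x\<in>{0..<2*pi}. F (r * cis x) \<partial>lborel) * indicator {0..<1} r"
    proof (cases "0 \<le> r")
      case True
      have "(\<integral>\<^sup>+x\<in>{0..<2*pi}. (w (cmod (r * cis x)) * indicator unit_disc (r * cis x)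
          * ennreal (1 / pi)) * F (r * cis x) \<partial>lborel)
        = (\<integral>\<^sup>+x. (w r * indicator {0..<1} r * ennreal (1 / pi)) * (F (r * cis x) * indicator {0..<2*pi} x) \<partial>lborel)"
        using True by (intro nn_integral_cong) (auto simp: norm_mult mult_ac split: split_indicator)
      also have "\<dots> = (w r * indicator {0..<1} r * ennreal (1 / pi)) * (\<integral>\<^sup>+x\<in>{0..<2*pi}. F (r * cis x) \<partial>lborel)"
        by (rule nn_integral_cmult) simp
      finally show ?thesis
        using True by (simp add: mult_ac divide_inverse ennreal_mult)
    qed simp
  qed
  finally show ?thesis .
qed

lemma nn_integral_W_rotate:
  assumes F[measurable]: "F \<in> borel_measurable borel" and c: "cmod c = 1"
  shows "(\<integral>\<^sup>+z. F (c * z) \<partial>W) = (\<integral>\<^sup>+z. F z \<partial>W)"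
proof -
  have "(\<integral>\<^sup>+z. F (c * z) \<partial>W)
      = (\<integral>\<^sup>+z. (\<lambda>z. (w (cmod z) * indicator unit_disc z * ennreal (1 / pi)) * F z) (c * z) \<partial>lborel)"
    unfolding disc_measure_def using c
    by (subst nn_integral_density) (auto simp: norm_mult indicator_def intro!: nn_integral_cong)
  also have "\<dots> = (\<integral>\<^sup>+z. (w (cmod z) * indicator unit_disc z * ennreal (1 / pi)) * F z \<partial>lborel)"
    by (rule nn_integral_lborel_rotate) (use c in auto)
  also have "\<dots> = (\<integral>\<^sup>+z. F z \<partial>W)"
    unfolding disc_measure_def by (rule nn_integral_density[symmetric]) auto
  finally show ?thesis .
qed

lemma emeasure_W_boundary_ball_eq:
  assumes "cmod \<zeta> = 1"
  shows "emeasure W (boundary_ball \<zeta> t) = emeasure W (boundary_ball (- 1) t)"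
proof -
  have "emeasure W (boundary_ball \<zeta> t) = (\<integral>\<^sup>+z. indicator (boundary_ball \<zeta> t) z \<partial>W)"
    by simp
  also have "\<dots> = (\<integral>\<^sup>+z. indicator (boundary_ball \<zeta> t) (- \<zeta> * z) \<partial>W)"
    by (rule nn_integral_W_rotate[symmetric]) (use assms in auto)
  also have "\<dots> = (\<integral>\<^sup>+z. indicator (boundary_ball (- 1) t) z \<partial>W)"
  proof (intro nn_integral_cong)
    fix z
    have "cmod (\<zeta> - (- \<zeta> * z)) = cmod (- 1 - z)"
    proof -
      have "cmod (\<zeta> - (- \<zeta> * z)) = cmod (- \<zeta> * (- 1 - z))"
        by (simp add: algebra_simps)
      then show ?thesis using assms by (simp only: norm_mult norm_minus_cancel)
    qed
    then show "indicator (boundary_ball \<zeta> t) (- \<zeta> * z) = (indicator (boundary_ball (- 1) t) z :: ennreal)"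
      using assms by (simp add: boundary_ball_def indicator_def dist_norm norm_mult)
  qed
  also have "\<dots> = emeasure W (boundary_ball (- 1) t)"
    by simp
  finally show ?thesis .
qed

lemma emeasure_W_boundary_ball_le:
  assumes "cmod \<zeta> = 1" "0 < t" "t \<le> 1"
  shows "emeasure W (boundary_ball \<zeta> t) \<le> ennreal (3 * t) * weight_tail w (1 - t)"
proof -
  let ?B = "boundary_ball (- 1) t"
  have "emeasure W (boundary_ball \<zeta> t) = (\<integral>\<^sup>+z. indicator ?B z \<partial>W)"
    using emeasure_W_boundary_ball_eq[OF assms(1)] by simp
  also have "\<dots> = (\<integral>\<^sup>+s\<in>{0..<1}. w s * ennreal (s / pi) *
      (\<integral>\<^sup>+x\<in>{0..<2*pi}. indicator ?B (of_real s * cis x) \<partial>lborel) \<partial>lborel)"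
    by (rule nn_integral_W_polar) simp
  also have "\<dots> \<le> (\<integral>\<^sup>+s. ennreal (3 * t) * (w s * indicator {1-t..<1} s) \<partial>lborel)"
  proof (intro nn_integral_mono)
    fix s :: real
    \<comment> \<open>Both the radial distance to the circle and the distance to -1 are at most t,
      so the chord from \<open>cis x\<close> to -1 is at most 2 t and the angle at most 4 t. The arc
      has length 8 t, and 8 / pi \<le> 3 gives the constant.\<close>
    have bd: "s \<ge> 1 - t \<and> \<bar>x - pi\<bar> \<le> 4 * t"
      if "0 \<le> s" "0 \<le> x" "x < 2 * pi" "of_real s * cis x \<in> ?B" for x
    proof -
      have s: "s < 1" "cmod (of_real s * cis x + 1) \<le> t"
        using that by (auto simp: mem_boundary_ball_minus_one)
      have "1 - s \<le> t"
        using s(2) norm_triangle_ineq2[of 1 "- (of_real s * cis x)"] that(1)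
        by (simp add: norm_mult add.commute)
      have "cmod (cis x - of_real s * cis x) = 1 - s"
      proof -
        have "cmod (cis x - of_real s * cis x) = cmod (of_real (1 - s) * cis x)"
          by (simp add: algebra_simps)
        then show ?thesis using s(1) by (simp add: norm_mult del: of_real_diff)
      qed
      then have "cmod (cis x + 1) \<le> 2 * t"
        using norm_triangle_ineq[of "cis x - of_real s * cis x" "of_real s * cis x + 1"] s \<open>1 - s \<le> t\<close>
        by simp
      then have "\<bar>x - pi\<bar> / 2 \<le> 2 * t"
        using cmod_cis_minus_one_ge[of "x - pi"] that by (simp add: cis_plus_one abs_le_iff)
      then show ?thesis
        using \<open>1 - s \<le> t\<close> by simp
    qed
    show "w s * ennreal (s / pi) * (\<integral>\<^sup>+x\<in>{0..<2*pi}. indicator ?B (of_real s * cis x) \<partial>lborel) * indicator {0..<1} s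
        \<le> ennreal (3 * t) * (w s * indicator {1-t..<1} s)"
    proof (cases "0 \<le> s \<and> s < 1")
      case s: True
      have "(\<integral>\<^sup>+x\<in>{0..<2*pi}. indicator ?B (of_real s * cis x) \<partial>lborel)
          \<le> (\<integral>\<^sup>+x. indicator {1-t..<1} s * indicator {pi - 4 * t..pi + 4 * t} x \<partial>lborel)"
      proof (intro nn_integral_mono)
        fix x :: real
        show "indicator ?B (of_real s * cis x) * indicator {0..<2*pi} x
            \<le> (indicator {1-t..<1} s * indicator {pi - 4 * t..pi + 4 * t} x :: ennreal)"
          using bd[of x] s by (auto simp: indicator_def abs_le_iff)
      qed
      also have "\<dots> = indicator {1-t..<1} s * ennreal (8 * t)"
        using assms(2) by (simp add: nn_integral_cmult)
      finally have "w s * ennreal (s / pi) * (\<integral>\<^sup>+x\<in>{0..<2*pi}. indicator ?B (of_real s * cis x) \<partial>lborel)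
          \<le> w s * ennreal (s / pi) * (indicator {1-t..<1} s * ennreal (8 * t))"
        by (intro mult_left_mono) auto
      also have "\<dots> = (ennreal (s / pi) * ennreal (8 * t)) * (w s * indicator {1-t..<1} s)"
        by (simp add: mult_ac)
      also have "\<dots> \<le> ennreal (3 * t) * (w s * indicator {1-t..<1} s)"
      proof (intro mult_right_mono)
        have "s * (8 * t) \<le> 1 * (8 * t)"
          using s assms(2) by (intro mult_right_mono) auto
        moreover have "8 * t \<le> 3 * t * pi"
          using assms(2) pi_gt3 mult_left_mono[of 3 pi "3 * t"] by simp
        ultimately have "s / pi * (8 * t) \<le> 3 * t"
          by (simp add: field_simps)
        then show "ennreal (s / pi) * ennreal (8 * t) \<le> ennreal (3 * t)"
          using s assms(2) by (simp flip: ennreal_mult)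
      qed simp
      finally show ?thesis
        using s by simp
    qed auto
  qed
  also have "\<dots> = ennreal (3 * t) * weight_tail w (1 - t)"
    unfolding weight_tail_def by (rule nn_integral_cmult) simp
  finally show ?thesis .
qed

text \<open>The ball about -1 contains the polar rectangle with 1 - s \<le> t / 2 and angle within t
  / 2 of pi. There s \<ge> 1 / 2, which accounts for the 2 in the denominator.\<close>

lemma emeasure_W_boundary_ball_ge:
  assumes "cmod \<zeta> = 1" "0 < t" "t \<le> 1"
  shows "ennreal (t / (2 * pi)) * weight_tail w (1 - t / 2) \<le> emeasure W (boundary_ball \<zeta> t)"
proof -
  let ?B = "boundary_ball (- 1) t"
  have "ennreal (t / (2 * pi)) * weight_tail w (1 - t / 2) = (\<integral>\<^sup>+s. ennreal (t / (2 * pi)) * (w s * indicator {1-t/2..<1} s) \<partial>lborel)"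
    unfolding weight_tail_def by (rule nn_integral_cmult[symmetric]) simp
  also have "\<dots> \<le> (\<integral>\<^sup>+s\<in>{0..<1}. w s * ennreal (s / pi) *
      (\<integral>\<^sup>+x\<in>{0..<2*pi}. indicator ?B (of_real s * cis x) \<partial>lborel) \<partial>lborel)"
  proof (intro nn_integral_mono)
    fix s :: real
    show "ennreal (t / (2 * pi)) * (w s * indicator {1-t/2..<1} s) \<le>
      w s * ennreal (s / pi) * (\<integral>\<^sup>+x\<in>{0..<2*pi}. indicator ?B (of_real s * cis x) \<partial>lborel) * indicator {0..<1} s"
    proof (cases "1 - t / 2 \<le> s \<and> s < 1")
      case s: True
      then have s': "1 / 2 \<le> s"
        using assms(3) by linarith
      have "of_real s * cis x \<in> ?B" if "pi - t / 2 \<le> x" "x \<le> pi + t / 2" for x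
      proof -
        have "cmod (cis x + 1) \<le> t / 2"
          using cmod_cis_minus_one_le[of "x - pi"] that by (simp add: cis_plus_one abs_le_iff)
        moreover have "cmod (of_real s * cis x - cis x) = 1 - s"
        proof -
          have "cmod (of_real s * cis x - cis x) = cmod (of_real (s - 1) * cis x)"
            by (simp add: algebra_simps)
          then show ?thesis using s by (simp add: norm_mult del: of_real_diff)
        qed
        ultimately have "cmod (of_real s * cis x + 1) \<le> t"
          using norm_triangle_ineq[of "of_real s * cis x - cis x" "cis x + 1"] s by simp
        then show ?thesis
          using s s' by (auto simp: mem_boundary_ball_minus_one)
      qed
      then have "(\<integral>\<^sup>+x. indicator {pi - t / 2..pi + t / 2} x \<partial>lborel)
          \<le> (\<integral>\<^sup>+x\<in>{0..<2*pi}. indicator ?B (of_real s * cis x) \<partial>lborel)"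
        using assms pi_gt3 by (intro nn_integral_mono) (auto simp: indicator_def abs_le_iff)
      then have "ennreal t \<le> (\<integral>\<^sup>+x\<in>{0..<2*pi}. indicator ?B (of_real s * cis x) \<partial>lborel)"
        using assms by simp
      then have "w s * ennreal (s / pi) * ennreal t \<le>
          w s * ennreal (s / pi) * (\<integral>\<^sup>+x\<in>{0..<2*pi}. indicator ?B (of_real s * cis x) \<partial>lborel)"
        by (intro mult_left_mono) auto
      moreover have "ennreal (t / (2 * pi)) * w s \<le> w s * ennreal (s / pi) * ennreal t"
      proof -
        have "t / (2 * pi) \<le> s / pi * t"
          using s' assms(2) mult_right_mono[of "1/2" s t] by (simp add: field_simps)
        then have "ennreal (t / (2 * pi)) \<le> ennreal (s / pi) * ennreal t"
          using s' assms(2) by (simp flip: ennreal_mult)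
        then have "ennreal (t / (2 * pi)) * w s \<le> (ennreal (s / pi) * ennreal t) * w s"
          by (rule mult_right_mono) simp
        then show ?thesis by (simp add: mult_ac)
      qed
      ultimately show ?thesis
        using s s' by simp
    qed auto
  qed
  also have "\<dots> = (\<integral>\<^sup>+z. indicator ?B z \<partial>W)"
    by (rule nn_integral_W_polar[symmetric]) simp
  also have "\<dots> = emeasure W (boundary_ball \<zeta> t)"
    using emeasure_W_boundary_ball_eq[OF assms(1)] by simp
  finally show ?thesis .
qed

lemma emeasure_W_le: "emeasure W A \<le> ennreal 2 * weight_tail w 0"
proof (cases "A \<in> sets borel")
  case A[measurable]: True
  have "emeasure W A = (\<integral>\<^sup>+z. indicator A z \<partial>W)"
    by simp
  also have "\<dots> = (\<integral>\<^sup>+s\<in>{0..<1}. w s * ennreal (s / pi) *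
      (\<integral>\<^sup>+x\<in>{0..<2*pi}. indicator A (of_real s * cis x) \<partial>lborel) \<partial>lborel)"
    by (rule nn_integral_W_polar) simp
  also have "\<dots> \<le> (\<integral>\<^sup>+s. ennreal 2 * (w s * indicator {0..<1} s) \<partial>lborel)"
  proof (intro nn_integral_mono)
    fix s :: real
    have "(\<integral>\<^sup>+x\<in>{0..<2*pi}. indicator A (of_real s * cis x) \<partial>lborel) \<le> (\<integral>\<^sup>+x. indicator {0..<2*pi} x \<partial>lborel)"
      by (intro nn_integral_mono) (auto split: split_indicator)
    also have "\<dots> = ennreal (2 * pi)"
      by simp
    finally have "w s * ennreal (s / pi) * (\<integral>\<^sup>+x\<in>{0..<2*pi}. indicator A (of_real s * cis x) \<partial>lborel)
        \<le> w s * ennreal (s / pi) * ennreal (2 * pi)"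
      by (intro mult_left_mono) auto
    moreover have "ennreal (s / pi) * ennreal (2 * pi) \<le> ennreal 2" if "0 \<le> s" "s < 1"
      using that by (subst ennreal_mult[symmetric]) (auto intro!: ennreal_leI simp del: ennreal_numeral)
    then have "w s * (ennreal (s / pi) * ennreal (2 * pi)) \<le> w s * ennreal 2" if "0 \<le> s" "s < 1"
      using that by (intro mult_left_mono) auto
    ultimately show "w s * ennreal (s / pi) * (\<integral>\<^sup>+x\<in>{0..<2*pi}. indicator A (of_real s * cis x) \<partial>lborel)
        * indicator {0..<1} s \<le> ennreal 2 * (w s * indicator {0..<1} s)"
      by (auto simp: mult_ac split: split_indicator)
  qed
  also have "\<dots> = ennreal 2 * weight_tail w 0"
    unfolding weight_tail_def by (rule nn_integral_cmult) simp
  finally show ?thesis .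
qed (simp add: emeasure_notin_sets)

lemma finite_W: "finite_measure W"
proof (rule finite_measureI)
  have "ennreal 2 * weight_tail w 0 < \<infinity>"
    using tail_finite by (simp add: ennreal_mult_less_top)
  then show "emeasure W (space W) \<noteq> \<infinity>"
    using emeasure_W_le[of "space W"] by (auto simp del: ennreal_numeral)
qed

text \<open>For small t the ball of radius 2 t has mass at most 6 t times the tail at 1 - 2 t, and
  the ball of radius t at least t / (2 pi) times the tail at 1 - t / 2. The quotient 6 * 2 pi gives
  12 pi, and two doublings of the tail give C * C.\<close>

definition "D = 12 * pi * (C * C)"

lemma D_pos: "0 < D"
  using C_pos by (simp add: D_def)

lemma emeasure_W_doubling:
  assumes \<zeta>: "cmod \<zeta> = 1" and t: "0 < t"
  shows "emeasure W (boundary_ball \<zeta> (2 * t)) \<le> ennreal D * emeasure W (boundary_ball \<zeta> t)"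
proof -
  have half: "ennreal (6 * r) * weight_tail w (1 - 2 * r) \<le> ennreal D * emeasure W (boundary_ball \<zeta> r)"
    if r: "0 < r" "r \<le> 1 / 2" for r
  proof -
    have "weight_tail w (1 - 2 * r) \<le> ennreal C * weight_tail w (1 - r)"
      using tail_doubling[of "1 - 2 * r"] r by (simp add: diff_divide_distrib)
    also have "\<dots> \<le> ennreal C * (ennreal C * weight_tail w (1 - r / 2))"
      using tail_doubling[of "1 - r"] r
      by (intro mult_left_mono) (auto simp: diff_divide_distrib)
    finally have "ennreal (6 * r) * weight_tail w (1 - 2 * r) \<le> ennreal (6 * r) * (ennreal C * (ennreal C * weight_tail w (1 - r / 2)))"
      by (rule mult_left_mono) simp
    also have "\<dots> = ennreal D * (ennreal (r / (2 * pi)) * weight_tail w (1 - r / 2))"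
      using r C_pos by (simp add: D_def mult.assoc[symmetric] ennreal_mult[symmetric]) (simp add: mult_ac)
    also have "\<dots> \<le> ennreal D * emeasure W (boundary_ball \<zeta> r)"
      using emeasure_W_boundary_ball_ge[OF \<zeta>, of r] r by (intro mult_left_mono) auto
    finally show ?thesis .
  qed
  show ?thesis
  proof (cases "t \<le> 1 / 2")
    case True
    then show ?thesis
      using emeasure_W_boundary_ball_le[OF \<zeta>, of "2 * t"] half[of t] t by simp
  next
    case False
    \<comment> \<open>For large t the total mass is compared with the ball of radius 1 / 2; the 3 is
      6 r at r = 1 / 2.\<close>
    have "emeasure W (boundary_ball \<zeta> (2 * t)) \<le> ennreal 3 * weight_tail w 0"
      using emeasure_W_le[of "boundary_ball \<zeta> (2 * t)"] mult_right_mono[of "ennreal 2" "ennreal 3" "weight_tail w 0"]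
      by (auto intro: order_trans)
    also have "\<dots> \<le> ennreal D * emeasure W (boundary_ball \<zeta> (1 / 2))"
      using half[of "1/2"] by simp
    also have "\<dots> \<le> ennreal D * emeasure W (boundary_ball \<zeta> t)"
      using False by (intro mult_left_mono emeasure_mono boundary_ball_mono) auto
    finally show ?thesis .
  qed
qed

lemma emeasure_W_doubling_power:
  assumes "cmod \<zeta> = 1" "0 < t"
  shows "emeasure W (boundary_ball \<zeta> (2 ^ k * t)) \<le> ennreal (D ^ k) * emeasure W (boundary_ball \<zeta> t)"
proof (induction k)
  case (Suc k)
  have "emeasure W (boundary_ball \<zeta> (2 ^ Suc k * t)) \<le> ennreal D * emeasure W (boundary_ball \<zeta> (2 ^ k * t))"
    using emeasure_W_doubling[of \<zeta> "2 ^ k * t"] assms by (simp add: mult.assoc)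
  also have "\<dots> \<le> ennreal D * (ennreal (D ^ k) * emeasure W (boundary_ball \<zeta> t))"
    by (intro mult_left_mono Suc) simp
  also have "\<dots> = ennreal (D ^ Suc k) * emeasure W (boundary_ball \<zeta> t)"
    using D_pos by (simp add: ennreal_mult mult.assoc)
  finally show ?case .
qed simp

end

section \<open>Kernels with fast decay and pointwise estimates\<close>

text \<open>The least k with d \<le> 2^k \<tau> works: if k = j + 1, minimality gives \<tau> / d <
  2^(-j), one power of two short of 2^(-k), whence the factor 2 powr \<beta>.\<close>

lemma dyadic_decay:
  fixes d \<tau> \<beta> :: real
  assumes "0 < \<tau>" "0 \<le> d" "0 < \<beta>"
  shows "\<exists>k. d \<le> 2 ^ k * \<tau> \<and> min 1 (\<tau> / d) powr \<beta> \<le> 2 powr \<beta> * (1 / 2 powr \<beta>) ^ k"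
proof -
  define k where "k = (LEAST k. d \<le> 2 ^ k * \<tau>)"
  have ex: "\<exists>k. d \<le> 2 ^ k * \<tau>"
    using real_arch_pow[of 2 "d / \<tau>"] assms(1) by (auto simp: field_simps intro: less_imp_le)
  have k: "d \<le> 2 ^ k * \<tau>"
    unfolding k_def using ex by (rule LeastI_ex)
  have "min 1 (\<tau> / d) \<le> 2 * (1 / 2) ^ k"
  proof (cases k)
    case (Suc j)
    then have d: "2 ^ j * \<tau> < d"
      using not_less_Least[of j "\<lambda>k. d \<le> 2 ^ k * \<tau>"] by (simp add: k_def)
    moreover have "0 < 2 ^ j * \<tau>"
      using assms by simp
    ultimately have "0 < d"
      by linarith
    then have "\<tau> / d \<le> (1 / 2) ^ j"
      using d by (simp add: field_simps power_one_over)
    then show ?thesis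
      by (simp add: Suc)
  qed simp
  then have "min 1 (\<tau> / d) powr \<beta> \<le> (2 * (1 / 2) ^ k) powr \<beta>"
    using assms by (intro powr_mono2) auto
  also have "\<dots> = 2 powr \<beta> * (1 / 2 powr \<beta>) ^ k"
    by (simp add: powr_mult powr_divide power_one_over powr_powr powr_realpow[symmetric] mult.commute)
  finally show ?thesis
    using k by blast
qed

section \<open>Exhaustion of the disc and measurability of holomorphic functions\<close>

lemma fsigma_unit_disc: "fsigma unit_disc"
proof -
  have "unit_disc = (\<Union>n. cball (0 :: complex) (1 - 1 / real (Suc n)))"
  proof (intro subset_antisym subsetI)
    fix z :: complex assume "z \<in> unit_disc"
    then have "0 < 1 - cmod z" by simp
    then obtain n where "1 / real (Suc n) < 1 - cmod z"
      by (rule nat_approx_posE)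
    then show "z \<in> (\<Union>n. cball 0 (1 - 1 / real (Suc n)))"
      by (intro UN_I[of n]) auto
  next
    fix z :: complex assume "z \<in> (\<Union>n. cball 0 (1 - 1 / real (Suc n)))"
    then obtain n where "cmod z \<le> 1 - 1 / real (Suc n)"
      by auto
    moreover have "0 < 1 / real (Suc n)" by simp
    ultimately have "cmod z < 1"
      by linarith
    then show "z \<in> unit_disc"
      by simp
  qed
  then show ?thesis
    by (metis closed_cball fsigma.intros)
qed

text \<open>Holomorphy says nothing about the values of f outside the disc, so f is cut off before
  it is treated as a Borel function on the plane.\<close>

lemma borel_measurable_indicator_disc_holomorphic:
  assumes "f holomorphic_on unit_disc"
  shows "(\<lambda>z. indicator unit_disc z *\<^sub>R f z) \<in> borel_measurable borel"
  using holomorphic_on_imp_continuous_on[OF assms]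
  by (intro borel_measurable_continuous_on_indicator) auto

lemma borel_measurable_disc_powr:
  assumes "f holomorphic_on unit_disc"
  shows "(\<lambda>z. ennreal (cmod (f z) powr \<alpha>) * indicator unit_disc z) \<in> borel_measurable borel"
proof -
  note borel_measurable_indicator_disc_holomorphic[OF assms, measurable]
  have "(\<lambda>z. ennreal (cmod (f z) powr \<alpha>) * indicator unit_disc z)
      = (\<lambda>z. ennreal (cmod (indicator unit_disc z *\<^sub>R f z) powr \<alpha>) * indicator unit_disc z)"
    by (auto simp: fun_eq_iff split: split_indicator)
  also have "\<dots> \<in> borel_measurable borel"
    by measurable
  finally show ?thesis .
qed

context radial_weight
begin

text \<open>On the dyadic ball of radius 2^k \<tau> the kernel is at most a multiple of 2^(-k
  \<beta>), while the mass has grown by at most D^k. The assumption 2 D \<le> 2 powr \<beta> makes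
  the ratio at most 1 / 2, and the geometric series sums to 2. The lemma serves twice: with h = 1
  for the norm of the test functions and with a power of |f| for the pointwise bound.\<close>

lemma decay_integral_le:
  fixes h :: "complex \<Rightarrow> ennreal"
  assumes h[measurable]: "h \<in> borel_measurable borel"
    and \<zeta>: "cmod \<zeta> = 1" and \<tau>: "0 < \<tau>" "\<tau> \<le> 2" and \<beta>: "2 * D \<le> 2 powr \<beta>" "0 < \<beta>"
    and avg: "\<And>t. \<tau> \<le> t \<Longrightarrow> t \<le> 2 \<Longrightarrow>
      (\<integral>\<^sup>+z\<in>boundary_ball \<zeta> t. h z \<partial>W) \<le> L * emeasure W (boundary_ball \<zeta> t)"
  shows "(\<integral>\<^sup>+z\<in>unit_disc. h z * ennreal (min 1 (\<tau> / cmod (z - \<zeta>)) powr \<beta>) \<partial>W)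
    \<le> ennreal (2 * 2 powr \<beta>) * L * emeasure W (boundary_ball \<zeta> \<tau>)"
proof -
  let ?B = "\<lambda>k. boundary_ball \<zeta> (2 ^ k * \<tau>)"
  let ?c = "\<lambda>k. ennreal (2 powr \<beta> * (1 / 2 powr \<beta>) ^ k)"
  let ?E = "emeasure W (boundary_ball \<zeta> \<tau>)"
  \<comment> \<open>Beyond radius 2 the ball is the whole disc, so larger dyadic radii give nothing
    new.\<close>
  have avg': "(\<integral>\<^sup>+z\<in>boundary_ball \<zeta> t. h z \<partial>W) \<le> L * emeasure W (boundary_ball \<zeta> t)" if "\<tau> \<le> t" for t
  proof (cases "t \<le> 2")
    case False
    then have "boundary_ball \<zeta> t = boundary_ball \<zeta> 2"
      using boundary_ball_eq_disc[OF \<zeta>] by simp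
    then show ?thesis
      using avg[of 2] \<tau> by simp
  qed (use avg that in simp)
  have "(\<integral>\<^sup>+z\<in>unit_disc. h z * ennreal (min 1 (\<tau> / cmod (z - \<zeta>)) powr \<beta>) \<partial>W)
      \<le> (\<integral>\<^sup>+z. (\<Sum>k. ?c k * (h z * indicator (?B k) z)) \<partial>W)"
  proof (intro nn_integral_mono)
    fix z
    show "h z * ennreal (min 1 (\<tau> / cmod (z - \<zeta>)) powr \<beta>) * indicator unit_disc z
        \<le> (\<Sum>k. ?c k * (h z * indicator (?B k) z))"
    proof (cases "z \<in> unit_disc")
      case True
      obtain k where k: "cmod (z - \<zeta>) \<le> 2 ^ k * \<tau>"
          "min 1 (\<tau> / cmod (z - \<zeta>)) powr \<beta> \<le> 2 powr \<beta> * (1 / 2 powr \<beta>) ^ k"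
        using dyadic_decay[OF \<tau>(1) norm_ge_zero \<beta>(2)] by blast
      have "z \<in> ?B k"
        using True k(1) by (simp add: boundary_ball_def dist_norm norm_minus_commute)
      then have "h z * ennreal (min 1 (\<tau> / cmod (z - \<zeta>)) powr \<beta>) \<le> ?c k * (h z * indicator (?B k) z)"
        using k(2) by (subst mult.commute) (auto intro!: mult_right_mono ennreal_leI)
      also have "\<dots> = (\<Sum>k\<in>{k}. ?c k * (h z * indicator (?B k) z))"
        by simp
      also have "\<dots> \<le> (\<Sum>k. ?c k * (h z * indicator (?B k) z))"
        by (rule sum_le_suminf) auto
      finally show ?thesis
        using True by simp
    qed simp
  qed
  also have "\<dots> = (\<Sum>k. ?c k * (\<integral>\<^sup>+z\<in>?B k. h z \<partial>W))"
    by (subst nn_integral_suminf) (auto simp: nn_integral_cmult)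
  also have "\<dots> \<le> (\<Sum>k. ennreal (2 powr \<beta> * (1 / 2) ^ k) * (L * ?E))"
  proof (intro suminf_le allI)
    fix k
    have "?c k * (\<integral>\<^sup>+z\<in>?B k. h z \<partial>W) \<le> ?c k * (L * (ennreal (D ^ k) * ?E))"
      using \<tau>(1) mult_right_mono[of 1 "2 ^ k" \<tau>]
      by (intro mult_left_mono order_trans[OF avg'[of "2 ^ k * \<tau>"]]
          emeasure_W_doubling_power[OF \<zeta> \<tau>(1), of k]) auto
    also have "\<dots> = (?c k * ennreal (D ^ k)) * (L * ?E)"
      by (simp add: mult_ac)
    also have "\<dots> \<le> ennreal (2 powr \<beta> * (1 / 2) ^ k) * (L * ?E)"
    proof (rule mult_right_mono)
      have "(D / 2 powr \<beta>) ^ k \<le> (1 / 2) ^ k"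
        using \<beta>(1) D_pos by (intro power_mono) (auto simp: field_simps)
      then have "2 powr \<beta> * (D / 2 powr \<beta>) ^ k \<le> 2 powr \<beta> * (1 / 2) ^ k"
        by (rule mult_left_mono) simp
      then have "2 powr \<beta> * (1 / 2 powr \<beta>) ^ k * D ^ k \<le> 2 powr \<beta> * (1 / 2) ^ k"
        by (simp add: power_divide)
      then show "?c k * ennreal (D ^ k) \<le> ennreal (2 powr \<beta> * (1 / 2) ^ k)"
        using D_pos by (subst ennreal_mult[symmetric]) (auto intro: ennreal_leI)
    qed simp
    finally show "?c k * (\<integral>\<^sup>+z\<in>?B k. h z \<partial>W) \<le> ennreal (2 powr \<beta> * (1 / 2) ^ k) * (L * ?E)" .
  qed auto
  also have "\<dots> = (\<Sum>k. ennreal (2 powr \<beta> * (1 / 2) ^ k)) * (L * ?E)"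
    by (rule ennreal_suminf_multc)
  also have "(\<Sum>k. ennreal (2 powr \<beta> * (1 / 2) ^ k)) = ennreal (2 powr \<beta> * 2)"
  proof (rule suminf_ennreal_eq)
    show "(\<lambda>k. 2 powr \<beta> * (1 / 2) ^ k) sums (2 powr \<beta> * 2)"
      using geometric_sums[of "1 / 2 :: real"] by (intro sums_mult) simp
  qed simp
  finally show ?thesis
    by (simp add: mult_ac)
qed

text \<open>From |u - z| \<ge> \<tau> / 2 and |z - \<zeta>| = \<tau> it follows that |u - \<zeta>|
  \<le> 3 |u - z|, so the decay can be measured from the boundary point at the cost of 3^(m + 1).
  The factor 4^m comes from (s^2 - |z|^2) / s \<le> 4 \<tau>, where s \<ge> 1 / 2 is used.\<close>

lemma circle_kernel_le:
  fixes z u \<zeta> :: complex and s :: real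
  assumes z: "z = of_real (cmod z) * \<zeta>" "cmod z < 1" "cmod \<zeta> = 1" and \<tau>: "\<tau> = 1 - cmod z"
    and s: "1 - \<tau> / 2 \<le> s" "s < 1" and u: "cmod u = s"
  shows "circle_kernel m s z u \<le> (4 ^ m * 3 ^ (m + 1)) / \<tau> * min 1 (\<tau> / cmod (u - \<zeta>)) powr real (m + 1)"
proof -
  have t: "0 < \<tau>" "\<tau> \<le> 1" "1 / 2 \<le> s" "cmod z \<le> s"
    using z(2) norm_ge_zero[of z] \<tau> s by linarith+
  have "\<tau> / 2 \<le> cmod (u - z)"
    using norm_triangle_ineq2[of u z] u s \<tau> by linarith
  moreover have "cmod (z - \<zeta>) = \<tau>"
  proof -
    have "cmod (z - \<zeta>) = cmod (of_real (cmod z - 1) * \<zeta>)"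
      by (subst z(1)) (simp add: algebra_simps)
    then show ?thesis
      using z \<tau> by (simp add: norm_mult del: of_real_diff)
  qed
  then have "cmod (u - \<zeta>) \<le> cmod (u - z) + \<tau>"
    using norm_triangle_ineq[of "u - z" "z - \<zeta>"] by simp
  ultimately have d: "cmod (u - \<zeta>) \<le> 3 * cmod (u - z)" "\<tau> \<le> 3 * cmod (u - z)" "0 < cmod (u - z)"
    using t by linarith+
  have "cmod (u - \<zeta>) > 0"
    using u s(2) z(3) by auto
  then have "\<tau> / cmod (u - z) \<le> 3 * min 1 (\<tau> / cmod (u - \<zeta>))"
    using d t by (auto simp: min_def field_simps)
  then have "(\<tau> / cmod (u - z)) ^ (m + 1) \<le> (3 * min 1 (\<tau> / cmod (u - \<zeta>))) ^ (m + 1)"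
    using t by (intro power_mono) auto
  also have "\<dots> = 3 ^ (m + 1) * min 1 (\<tau> / cmod (u - \<zeta>)) powr real (m + 1)"
    using t \<open>cmod (u - \<zeta>) > 0\<close> by (subst powr_realpow) (auto simp: power_mult_distrib)
  finally have A: "(\<tau> / cmod (u - z)) ^ (m + 1) \<le> 3 ^ (m + 1) * min 1 (\<tau> / cmod (u - \<zeta>)) powr real (m + 1)" .
  have "s\<^sup>2 - (cmod z)\<^sup>2 \<le> 2 * \<tau>"
  proof -
    have "s\<^sup>2 - (cmod z)\<^sup>2 = (s - cmod z) * (s + cmod z)"
      by (simp add: power2_eq_square algebra_simps)
    also have "\<dots> \<le> \<tau> * 2"
      using t s z \<tau> by (intro mult_mono) auto
    finally show ?thesis by simp
  qed
  moreover have "4 * \<tau> * (1 / 2) \<le> 4 * \<tau> * s"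
    using t by (intro mult_left_mono) auto
  ultimately have "s\<^sup>2 - (cmod z)\<^sup>2 \<le> 4 * \<tau> * s"
    by linarith
  then have "(s\<^sup>2 - (cmod z)\<^sup>2) / s \<le> 4 * \<tau>"
    using t by (simp add: divide_le_eq)
  moreover have "0 \<le> (s\<^sup>2 - (cmod z)\<^sup>2) / s"
    using t by (simp add: power_mono)
  ultimately have "s * ((s\<^sup>2 - (cmod z)\<^sup>2) / s) ^ m \<le> 1 * (4 * \<tau>) ^ m"
    using t s by (intro mult_mono power_mono) auto
  then have "circle_kernel m s z u \<le> (4 * \<tau>) ^ m / cmod (u - z) ^ (m + 1)"
    unfolding circle_kernel_def using d(3) by (intro divide_right_mono) auto
  also have "\<dots> = 4 ^ m / \<tau> * (\<tau> / cmod (u - z)) ^ (m + 1)"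
    using t by (simp add: power_mult_distrib power_divide)
  also have "\<dots> \<le> 4 ^ m / \<tau> * (3 ^ (m + 1) * min 1 (\<tau> / cmod (u - \<zeta>)) powr real (m + 1))"
    using t by (intro mult_left_mono A) auto
  finally show ?thesis
    by (simp add: mult_ac)
qed

text \<open>In order: the kernel bound without its 1 / \<tau>, the dyadic summation with \<beta> = m
  + 1, the constant 3 from the mass of a boundary ball, and one doubling of the tail.\<close>

definition pointwise_const :: "nat \<Rightarrow> real" where
  "pointwise_const m = 4 ^ m * 3 ^ (m + 1) * (2 * 2 powr real (m + 1)) * 3 * C"

text \<open>The mean value inequality is integrated against \<open>w\<close> over the radii \<open>s \<ge> (1 + |z|) / 2\<close>; almost
  all of these circles avoid the zeros of \<open>f\<close>.\<close>

lemma pointwise_le_averages: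
  assumes f: "f holomorphic_on unit_disc" and \<alpha>: "0 < \<alpha>"
    and z: "z = of_real (cmod z) * \<zeta>" "cmod z < 1" "cmod \<zeta> = 1" and m: "D \<le> 2 ^ m"
    and L: "0 \<le> L"
    and avg: "\<And>t. 1 - cmod z \<le> t \<Longrightarrow> t \<le> 2 \<Longrightarrow>
      (\<integral>\<^sup>+u\<in>boundary_ball \<zeta> t. ennreal (cmod (f u) powr \<alpha>) \<partial>W) \<le> ennreal L * emeasure W (boundary_ball \<zeta> t)"
  shows "cmod (f z) powr \<alpha> \<le> pointwise_const m * L"
proof (cases "f z = 0")
  case True
  then show ?thesis
    using C_pos L by (simp add: pointwise_const_def)
next
  case False
  define \<tau> where "\<tau> = 1 - cmod z"
  define \<rho> where "\<rho> = 1 - \<tau> / 2"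
  have \<tau>: "0 < \<tau>" "\<tau> \<le> 1"
    using z by (auto simp: \<tau>_def)
  have \<rho>: "1 / 2 \<le> \<rho>" "\<rho> < 1" "cmod z < \<rho>"
    using \<tau> \<tau>_def \<rho>_def by linarith+
  define A where "A = 4 ^ m * 3 ^ (m + 1) / \<tau>"
  have A: "0 \<le> A"
    using \<tau> by (simp add: A_def)
  define h where "h u = ennreal (cmod (f u) powr \<alpha>) * indicator unit_disc u" for u
  have h[measurable]: "h \<in> borel_measurable borel"
    unfolding h_def using f by (rule borel_measurable_disc_powr)
  define \<kappa> where "\<kappa> u = min 1 (\<tau> / cmod (u - \<zeta>)) powr real (m + 1)" for u
  have [measurable]: "\<kappa> \<in> borel_measurable borel"
    unfolding \<kappa>_def by measurable
  let ?k = "\<lambda>u. h u * ennreal (\<kappa> u) * indicator unit_disc u"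
  let ?Z = "{u \<in> unit_disc. f u = 0}"
  have "countable ?Z"
  proof (cases "f constant_on unit_disc")
    case True
    moreover have "z \<in> unit_disc"
      using z by simp
    ultimately have "?Z = {}"
      using False unfolding constant_on_def by fastforce
    then show ?thesis by (simp only: countable_empty)
  next
    case False
    then show ?thesis
      by (intro holomorphic_countable_zeros[OF f]) (auto intro: fsigma_unit_disc)
  qed
  then have "countable (cmod ` ?Z)"
    by (rule countable_image)
  then have AE: "AE s in lborel. s \<notin> cmod ` ?Z"
    by (intro AE_not_in countable_imp_null_set_lborel)
  have circ: "ennreal (2 * pi * cmod (f z) powr \<alpha>) \<le> ennreal A * (\<integral>\<^sup>+x\<in>{0..<2*pi}. ?k (of_real s * cis x) \<partial>lborel)"
    if s: "\<rho> \<le> s" "s < 1" "s \<notin> cmod ` ?Z" for s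
  proof -
    have "ennreal (2 * pi * cmod (f z) powr \<alpha>) \<le> (\<integral>\<^sup>+x\<in>{0..<2*pi}.
        ennreal (cmod (f (of_real s * cis x)) powr \<alpha> * circle_kernel m s z (of_real s * cis x)) \<partial>lborel)"
      using s \<rho> by (intro powr_norm_le_circle_integral[OF f _ _ _ \<alpha>]) auto
    also have "\<dots> \<le> (\<integral>\<^sup>+x. ennreal A * (?k (of_real s * cis x) * indicator {0..<2*pi} x) \<partial>lborel)"
    proof (intro nn_integral_mono)
      fix x :: real
      let ?u = "of_real s * cis x"
      have u: "cmod ?u = s"
        using s \<rho> by (simp add: norm_mult)
      have "circle_kernel m s z ?u \<le> A * \<kappa> ?u"
        using circle_kernel_le[OF z \<tau>_def _ s(2) u, of m] s(1) unfolding A_def \<kappa>_def \<rho>_def by simp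
      then have "cmod (f ?u) powr \<alpha> * circle_kernel m s z ?u \<le> cmod (f ?u) powr \<alpha> * (A * \<kappa> ?u)"
        by (rule mult_left_mono) simp
      then have "ennreal (cmod (f ?u) powr \<alpha> * circle_kernel m s z ?u) \<le> ennreal A * ?k ?u"
        using u s(2) A by (simp add: h_def ennreal_mult[symmetric] \<kappa>_def ennreal_leI mult_ac)
      then show "ennreal (cmod (f ?u) powr \<alpha> * circle_kernel m s z ?u) * indicator {0..<2*pi} x
          \<le> ennreal A * (?k ?u * indicator {0..<2*pi} x)"
        by (auto split: split_indicator)
    qed
    also have "\<dots> = ennreal A * (\<integral>\<^sup>+x\<in>{0..<2*pi}. ?k (of_real s * cis x) \<partial>lborel)"
      by (rule nn_integral_cmult) simp
    finally show ?thesis .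
  qed
  have "ennreal (cmod (f z) powr \<alpha>) * weight_tail w \<rho>
      = (\<integral>\<^sup>+s. ennreal (cmod (f z) powr \<alpha>) * (w s * indicator {\<rho>..<1} s) \<partial>lborel)"
    unfolding weight_tail_def by (rule nn_integral_cmult[symmetric]) simp
  also have "\<dots> \<le> (\<integral>\<^sup>+s. ennreal A * (w s * ennreal (s / pi) *
      (\<integral>\<^sup>+x\<in>{0..<2*pi}. ?k (of_real s * cis x) \<partial>lborel) * indicator {0..<1} s) \<partial>lborel)"
  proof (intro nn_integral_mono_AE, use AE in eventually_elim)
    case (elim s)
    show ?case
    proof (cases "\<rho> \<le> s \<and> s < 1")
      case s: True
      \<comment> \<open>The circle estimate carries 2 pi on the left and polar coordinates
        contribute s / pi; their product 2 s is at least 1 on these radii.\<close>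
      have "cmod (f z) powr \<alpha> * 1 \<le> cmod (f z) powr \<alpha> * (2 * s)"
        using s \<rho> by (intro mult_left_mono) auto
      then have "cmod (f z) powr \<alpha> \<le> (s / pi) * (2 * pi * cmod (f z) powr \<alpha>)"
        by (simp add: mult_ac)
      then have "ennreal (cmod (f z) powr \<alpha>) \<le> ennreal (s / pi) * ennreal (2 * pi * cmod (f z) powr \<alpha>)"
        using s \<rho> by (subst ennreal_mult[symmetric]) (auto intro: ennreal_leI)
      also have "\<dots> \<le> ennreal (s / pi) * (ennreal A * (\<integral>\<^sup>+x\<in>{0..<2*pi}. ?k (of_real s * cis x) \<partial>lborel))"
        using circ[of s] s elim by (intro mult_left_mono) auto
      finally have "ennreal (cmod (f z) powr \<alpha>) * w s \<le>
          ennreal (s / pi) * (ennreal A * (\<integral>\<^sup>+x\<in>{0..<2*pi}. ?k (of_real s * cis x) \<partial>lborel)) * w s"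
        by (rule mult_right_mono) simp
      then show ?thesis
        using s \<rho> by (simp add: mult_ac)
    qed auto
  qed
  also have "\<dots> = ennreal A * (\<integral>\<^sup>+s\<in>{0..<1}. w s * ennreal (s / pi) *
      (\<integral>\<^sup>+x\<in>{0..<2*pi}. ?k (of_real s * cis x) \<partial>lborel) \<partial>lborel)"
    by (rule nn_integral_cmult) simp
  also have "\<dots> = ennreal A * (\<integral>\<^sup>+u. ?k u \<partial>W)"
    by (subst nn_integral_W_polar) auto
  also have "\<dots> \<le> ennreal A * (ennreal (2 * 2 powr real (m + 1)) * ennreal L * emeasure W (boundary_ball \<zeta> \<tau>))"
    unfolding \<kappa>_def
  proof (intro mult_left_mono decay_integral_le)
    fix t :: real assume t: "\<tau> \<le> t" "t \<le> 2"
    have "(\<integral>\<^sup>+u\<in>boundary_ball \<zeta> t. h u \<partial>W) = (\<integral>\<^sup>+u\<in>boundary_ball \<zeta> t. ennreal (cmod (f u) powr \<alpha>) \<partial>W)"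
      by (intro nn_integral_cong) (auto simp: h_def boundary_ball_def split: split_indicator)
    then show "(\<integral>\<^sup>+u\<in>boundary_ball \<zeta> t. h u \<partial>W) \<le> ennreal L * emeasure W (boundary_ball \<zeta> t)"
      using avg[of t] t \<tau>_def by simp
  next
    show "2 * D \<le> 2 powr real (m + 1)"
      using m by (subst powr_realpow) auto
  qed (use z \<tau> in auto)
  \<comment> \<open>The factor \<tau> from the mass of the ball cancels 1 / \<tau> in
    \<open>A\<close>, and one doubling moves the tail from 1 - \<tau> to \<rho>. The same positive
    finite tail then stands on both sides.\<close>
  also have "\<dots> \<le> ennreal A * (ennreal (2 * 2 powr real (m + 1)) * ennreal L * (ennreal (3 * \<tau>) * (ennreal C * weight_tail w \<rho>)))"
  proof (intro mult_left_mono)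
    have "emeasure W (boundary_ball \<zeta> \<tau>) \<le> ennreal (3 * \<tau>) * weight_tail w (1 - \<tau>)"
      using \<tau> by (intro emeasure_W_boundary_ball_le z)
    also have "\<dots> \<le> ennreal (3 * \<tau>) * (ennreal C * weight_tail w \<rho>)"
      using tail_doubling[of "1 - \<tau>"] \<tau> by (intro mult_left_mono) (auto simp: \<rho>_def diff_divide_distrib)
    finally show "emeasure W (boundary_ball \<zeta> \<tau>) \<le> ennreal (3 * \<tau>) * (ennreal C * weight_tail w \<rho>)" .
  qed auto
  also have "\<dots> = ennreal (pointwise_const m * L) * weight_tail w \<rho>"
    using A \<tau> L C_pos
    by (simp add: mult.assoc[symmetric] ennreal_mult[symmetric] pointwise_const_def A_def)
      (simp add: mult_ac)
  finally have "ennreal (cmod (f z) powr \<alpha>) * weight_tail w \<rho> \<le> ennreal (pointwise_const m * L) * weight_tail w \<rho>" .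
  moreover have "weight_tail w \<rho> \<noteq> 0" "weight_tail w \<rho> \<noteq> top"
    using tail_pos[of \<rho>] tail_antimono[of 0 \<rho> w] tail_finite \<rho> by (auto simp: top_unique)
  ultimately have "ennreal (cmod (f z) powr \<alpha>) \<le> ennreal (pointwise_const m * L)"
    by (metis ennreal_mult_le_mult_iff mult.commute)
  then show ?thesis
    using C_pos L by (subst (asm) ennreal_le_iff) (auto simp: pointwise_const_def)
qed

end

section \<open>The Carleson embedding\<close>

text \<open>The summation step of the covering argument: subadditivity of N over the enlarged balls
  against countable additivity of H dM over the disjoint small ones.\<close>

lemma emeasure_UN_le_disjoint_integrals:
  assumes C: "countable C" and B: "\<And>i. i \<in> C \<Longrightarrow> B i \<in> sets N"
    and A: "\<And>i. i \<in> C \<Longrightarrow> A i \<in> sets M" "disjoint_family_on A C"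
    and H[measurable]: "H \<in> borel_measurable M"
    and le: "\<And>i. i \<in> C \<Longrightarrow> emeasure N (B i) \<le> k * (\<integral>\<^sup>+z\<in>A i. H z \<partial>M)"
  shows "emeasure N (\<Union>i\<in>C. B i) \<le> k * (\<integral>\<^sup>+z. H z \<partial>M)"
proof -
  \<comment> \<open>The countable index set is enumerated by naturals; indices outside
    \<open>I\<close> receive the empty set.\<close>
  define I where "I = to_nat_on C ` C"
  define e where "e = from_nat_into C"
  have e: "e n \<in> C" if "n \<in> I" for n
    using that C by (auto simp: I_def e_def)
  have surj: "\<exists>n\<in>I. e n = i" if "i \<in> C" for i
    using that C by (auto simp: I_def e_def)
  have inj: "n = n'" if "n \<in> I" "n' \<in> I" "e n = e n'" for n n'
    using that C by (auto simp: I_def e_def)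
  define B' where "B' n = (if n \<in> I then B (e n) else {})" for n
  define A' where "A' n = (if n \<in> I then A (e n) else {})" for n
  have A'[measurable]: "A' n \<in> sets M" for n
    using A(1) e by (simp add: A'_def)
  have disj: "disjoint_family A'"
    unfolding disjoint_family_on_def
  proof (intro ballI impI)
    fix n n' :: nat assume "n \<noteq> n'"
    then show "A' n \<inter> A' n' = {}"
      using disjoint_family_onD[OF A(2) e e, of n n'] inj[of n n'] by (auto simp: A'_def)
  qed
  have "(\<Union>i\<in>C. B i) = (\<Union>n\<in>I. B (e n))"
    using surj e by auto
  also have "\<dots> = (\<Union>n. B' n)"
    unfolding B'_def by (auto split: if_splits)
  finally have eq: "(\<Union>i\<in>C. B i) = (\<Union>n. B' n)" .
  have "range B' \<subseteq> sets N"
    using B e by (auto simp: B'_def)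
  then have "emeasure N (\<Union>i\<in>C. B i) \<le> (\<Sum>n. emeasure N (B' n))"
    unfolding eq by (rule emeasure_subadditive_countably)
  also have "\<dots> \<le> (\<Sum>n. k * emeasure (density M H) (A' n))"
  proof (intro suminf_le allI)
    fix n
    show "emeasure N (B' n) \<le> k * emeasure (density M H) (A' n)"
      using le[OF e] by (simp add: emeasure_density B'_def A'_def A(1) e)
  qed auto
  also have "\<dots> = k * emeasure (density M H) (\<Union>n. A' n)"
    using suminf_emeasure[of A' "density M H"] disj by (subst ennreal_suminf_cmult) (auto simp: image_subset_iff)
  also have "\<dots> \<le> k * emeasure (density M H) (space M)"
    using emeasure_space[of "density M H"] by (intro mult_left_mono) auto
  also have "\<dots> = k * (\<integral>\<^sup>+z. H z \<partial>M)"
    by (simp add: emeasure_density cong: nn_integral_cong)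
  finally show ?thesis .
qed

text \<open>The layer-cake formula for a power. The open interval makes the integrand at level t the
  indicator of a strict level set {t < x}.\<close>

lemma nn_integral_powr_deriv:
  fixes x s :: real
  assumes "0 \<le> x" "1 < s"
  shows "ennreal (x powr s) = (\<integral>\<^sup>+t. ennreal (s * t powr (s - 1)) * indicator {0<..<x} t \<partial>lborel)"
proof -
  have "((\<lambda>t. s * t powr (s - 1)) has_integral s * (x powr (s - 1 + 1) / (s - 1 + 1))) {0..x}"
    using assms by (intro has_integral_mult_right has_integral_powr_from_0) auto
  then have I: "((\<lambda>t. s * t powr (s - 1)) has_integral x powr s) {0..x}"
    using assms by simp
  have "ennreal (x powr s) = (\<integral>\<^sup>+t. ennreal (indicator {0..x} t * (s * t powr (s - 1))) \<partial>lborel)"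
    by (rule nn_integral_has_integral_lebesgue[OF _ I, symmetric]) (use assms in simp)
  also have "\<dots> = (\<integral>\<^sup>+t. ennreal (s * t powr (s - 1)) * indicator {0<..<x} t \<partial>lborel)"
  proof (rule nn_integral_cong_AE)
    show "AE t in lborel. ennreal (indicator {0..x} t * (s * t powr (s - 1)))
        = ennreal (s * t powr (s - 1)) * indicator {0<..<x} t"
      using AE_lborel_singleton[of 0] AE_lborel_singleton[of x]
      by eventually_elim (auto split: split_indicator)
  qed
  finally show ?thesis .
qed

context radial_weight
begin

text \<open>The factor 2 \<sigma> comes from differentiating x^(2 \<sigma>), D powr (3 * \<sigma>)
  from enlarging the Vitali balls, and the last factor from passing between the level of the
  function and the level of its averages.\<close>

definition embed_const :: "nat \<Rightarrow> real \<Rightarrow> real" where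
  "embed_const m \<sigma> = 2 * \<sigma> * D powr (3 * \<sigma>) * (2 * pointwise_const m) powr (2 * \<sigma>)"

lemma pointwise_const_pos: "0 < pointwise_const m"
  using C_pos by (simp add: pointwise_const_def)

text \<open>Since the ball averages of \<open>g\<close> are bounded through \<open>L2\<close>, all covering balls satisfy
  \<open>W(\<Delta>) \<le> l\<^bsup>-2\<^esup>\<close>. This linearises \<open>W(\<Delta>)\<^bsup>\<sigma>\<^esup>\<close>, so that the contributions of disjoint balls can be added.\<close>

lemma emeasure_level_set_le:
  fixes g :: "complex \<Rightarrow> real" and N :: "complex measure"
  assumes g[measurable]: "g \<in> borel_measurable borel" and g0: "\<And>z. 0 \<le> g z"
    and L2: "(\<integral>\<^sup>+z. ennreal ((g z)\<^sup>2) \<partial>W) \<le> 1"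
    and pw: "\<And>z L. 0 < L \<Longrightarrow> K * L < g z \<Longrightarrow> \<exists>\<zeta> t. cmod \<zeta> = 1 \<and> 0 < t \<and> t \<le> 2 \<and> z \<in> boundary_ball \<zeta> t \<and>
      ennreal L * emeasure W (boundary_ball \<zeta> t) < (\<integral>\<^sup>+u\<in>boundary_ball \<zeta> t. ennreal (g u) \<partial>W)"
    and K: "0 < K" and \<sigma>: "1 \<le> \<sigma>" and M: "0 \<le> M" and N[measurable_cong]: "sets N = sets borel"
    and carleson: "\<And>\<zeta> t. cmod \<zeta> = 1 \<Longrightarrow> 0 < t \<Longrightarrow>
      emeasure N (boundary_ball \<zeta> t) \<le> ennreal (M * measure W (boundary_ball \<zeta> t) powr \<sigma>)"
    and l: "0 < l"
  shows "emeasure N {z. K * (2 * l) < g z} \<le> ennreal (M * D powr (3 * \<sigma>) * l powr (1 - 2 * \<sigma>)) *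
    (\<integral>\<^sup>+z. ennreal (g z) * indicator {z. l < g z} z \<partial>W)"
proof -
  interpret W: finite_measure W
    by (rule finite_W)
  let ?E = "{z. K * (2 * l) < g z}"
  \<comment> \<open>The part of g above l. Since g \<le> g^2 / l there, the bound on the square
    integral makes its integral at most 1 / l.\<close>
  define H where "H z = ennreal (g z) * indicator {z. l < g z} z" for z
  have [measurable]: "H \<in> borel_measurable borel"
    unfolding H_def by measurable
  have H_le: "(\<integral>\<^sup>+z. H z \<partial>W) \<le> ennreal (1 / l)"
  proof -
    have "(\<integral>\<^sup>+z. H z \<partial>W) \<le> (\<integral>\<^sup>+z. ennreal (1 / l) * ennreal ((g z)\<^sup>2) \<partial>W)"
    proof (intro nn_integral_mono)
      fix z
      have "g z \<le> 1 / l * (g z)\<^sup>2" if "l < g z"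
        using that l by (simp add: field_simps power2_eq_square)
      then show "H z \<le> ennreal (1 / l) * ennreal ((g z)\<^sup>2)"
        using l g0[of z] by (auto simp: H_def ennreal_mult[symmetric] ennreal_leI split: split_indicator)
    qed
    also have "\<dots> = ennreal (1 / l) * (\<integral>\<^sup>+z. ennreal ((g z)\<^sup>2) \<partial>W)"
      by (rule nn_integral_cmult) simp
    also have "\<dots> \<le> ennreal (1 / l) * 1"
      using L2 by (rule mult_left_mono) simp
    finally show ?thesis by simp
  qed
  have "\<forall>z\<in>?E. \<exists>\<zeta> t. cmod \<zeta> = 1 \<and> 0 < t \<and> t \<le> 2 \<and> z \<in> boundary_ball \<zeta> t \<and>
      ennreal (2 * l) * emeasure W (boundary_ball \<zeta> t) < (\<integral>\<^sup>+u\<in>boundary_ball \<zeta> t. ennreal (g u) \<partial>W)"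
    using l by (intro ballI pw) auto
  then obtain \<zeta> where "\<forall>z\<in>?E. \<exists>t. cmod (\<zeta> z) = 1 \<and> 0 < t \<and> t \<le> 2 \<and> z \<in> boundary_ball (\<zeta> z) t \<and>
      ennreal (2 * l) * emeasure W (boundary_ball (\<zeta> z) t) < (\<integral>\<^sup>+u\<in>boundary_ball (\<zeta> z) t. ennreal (g u) \<partial>W)"
    by (rule bchoice[THEN exE])
  then obtain t where t: "\<forall>z\<in>?E. cmod (\<zeta> z) = 1 \<and> 0 < t z \<and> t z \<le> 2 \<and> z \<in> boundary_ball (\<zeta> z) (t z) \<and>
      ennreal (2 * l) * emeasure W (boundary_ball (\<zeta> z) (t z)) < (\<integral>\<^sup>+u\<in>boundary_ball (\<zeta> z) (t z). ennreal (g u) \<partial>W)"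
    by (rule bchoice[THEN exE])
  have \<zeta>t: "cmod (\<zeta> z) = 1" "0 < t z \<and> t z \<le> 2" "z \<in> boundary_ball (\<zeta> z) (t z)"
      "ennreal (2 * l) * emeasure W (boundary_ball (\<zeta> z) (t z)) < (\<integral>\<^sup>+u\<in>boundary_ball (\<zeta> z) (t z). ennreal (g u) \<partial>W)"
    if "z \<in> ?E" for z
    using bspec[OF t that] by blast+
  \<comment> \<open>On a ball whose average of g exceeds 2 l, the values of g up to l contribute at
    most l W(\<Delta>), that is less than half; the part above l supplies the rest. This is the
    reason for the level 2 l.\<close>
  have avgH: "ennreal l * emeasure W (boundary_ball (\<zeta> z) (t z)) \<le> (\<integral>\<^sup>+u\<in>boundary_ball (\<zeta> z) (t z). H u \<partial>W)"
    if z: "z \<in> ?E" for z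
  proof -
    let ?B = "boundary_ball (\<zeta> z) (t z)"
    have "ennreal l * emeasure W ?B + ennreal l * emeasure W ?B = ennreal (2 * l) * emeasure W ?B"
      using l by (simp flip: distrib_right ennreal_plus)
    also have "\<dots> \<le> (\<integral>\<^sup>+u\<in>?B. ennreal (g u) \<partial>W)"
      using \<zeta>t(4)[OF z] by simp
    also have "\<dots> \<le> (\<integral>\<^sup>+u. H u * indicator ?B u + ennreal l * indicator ?B u \<partial>W)"
      by (intro nn_integral_mono) (auto simp: H_def not_less intro: ennreal_leI split: split_indicator)
    also have "\<dots> = ennreal l * emeasure W ?B + (\<integral>\<^sup>+u\<in>?B. H u \<partial>W)"
      by (simp add: nn_integral_add nn_integral_cmult_indicator add.commute)
    finally show ?thesis
      by (simp add: ennreal_add_left_cancel_le ennreal_mult_eq_top_iff)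
  qed
  have "?E \<subseteq> (\<Union>z\<in>?E. cball (\<zeta> z) (t z))"
    using \<zeta>t(3) by (auto simp: boundary_ball_def)
  then obtain Q where Q: "countable Q" "Q \<subseteq> ?E"
      "pairwise (\<lambda>i j. disjnt (cball (\<zeta> i) (t i)) (cball (\<zeta> j) (t j))) Q"
      "?E \<subseteq> (\<Union>i\<in>Q. cball (\<zeta> i) (5 * t i))"
    using Vitali_covering_lemma_cballs[of ?E \<zeta> t ?E 2] \<zeta>t(2) by auto
  let ?k = "M * D powr (3 * \<sigma>) * l powr (1 - 2 * \<sigma>)"
  \<comment> \<open>The Vitali factor 5 is rounded up to 8 = 2^3, so that three doublings
    suffice.\<close>
  have "emeasure N ?E \<le> emeasure N (\<Union>i\<in>Q. boundary_ball (\<zeta> i) (8 * t i))"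
  proof (rule emeasure_mono)
    show "?E \<subseteq> (\<Union>i\<in>Q. boundary_ball (\<zeta> i) (8 * t i))"
    proof
      fix z assume z: "z \<in> ?E"
      then obtain i where i: "i \<in> Q" "z \<in> cball (\<zeta> i) (5 * t i)"
        using subsetD[OF Q(4) z] by (elim UN_E)
      then have "0 < t i"
        using \<zeta>t(2)[OF subsetD[OF Q(2) i(1)]] by simp
      moreover have "z \<in> unit_disc"
        using \<zeta>t(3)[OF z] by (simp add: boundary_ball_def)
      ultimately have "z \<in> boundary_ball (\<zeta> i) (8 * t i)"
        using i(2) by (simp add: boundary_ball_def)
      then show "z \<in> (\<Union>i\<in>Q. boundary_ball (\<zeta> i) (8 * t i))"
        by (rule UN_I[OF i(1)])
    qed
    show "(\<Union>i\<in>Q. boundary_ball (\<zeta> i) (8 * t i)) \<in> sets N"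
      unfolding N by (intro sets.countable_UN''[OF Q(1)] boundary_ball_borel)
  qed
  also have "\<dots> \<le> ennreal ?k * (\<integral>\<^sup>+z. H z \<partial>W)"
  proof (rule emeasure_UN_le_disjoint_integrals[where A = "\<lambda>i. boundary_ball (\<zeta> i) (t i)"])
    show "disjoint_family_on (\<lambda>i. boundary_ball (\<zeta> i) (t i)) Q"
      using Q(3) by (auto simp: disjoint_family_on_def pairwise_def disjnt_def boundary_ball_def)
    fix i assume "i \<in> Q"
    then have i: "i \<in> ?E"
      using Q(2) by auto
    let ?B = "boundary_ball (\<zeta> i) (t i)"
    define x where "x = measure W ?B"
    have x: "emeasure W ?B = ennreal x" "0 \<le> x"
      by (simp_all add: x_def W.emeasure_eq_measure)
    have "ennreal (l * x) \<le> (\<integral>\<^sup>+u\<in>?B. H u \<partial>W)"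
      using avgH[OF i] l x by (simp add: ennreal_mult)
    also have "\<dots> \<le> (\<integral>\<^sup>+u. H u \<partial>W)"
      by (intro nn_integral_mono) (auto split: split_indicator)
    also note H_le
    finally have "l * x \<le> 1 / l"
      using l by simp
    then have xl: "x \<le> l powr (- 2)"
    proof -
      have "l powr (- 2) = 1 / (l * l)"
        using l by (simp add: powr_minus powr_numeral power2_eq_square divide_inverse)
      moreover have "x \<le> 1 / (l * l)"
        using \<open>l * x \<le> 1 / l\<close> l by (simp add: field_simps)
      ultimately show ?thesis by (simp only:)
    qed
    have W8: "measure W (boundary_ball (\<zeta> i) (8 * t i)) \<le> D ^ 3 * x"
    proof -
      have "emeasure W (boundary_ball (\<zeta> i) (2 ^ 3 * t i)) \<le> ennreal (D ^ 3) * emeasure W ?B"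
        using \<zeta>t(1,2)[OF i] by (intro emeasure_W_doubling_power) auto
      then show ?thesis
        using x(2) D_pos by (simp add: x_def W.emeasure_eq_measure ennreal_mult[symmetric])
    qed
    have "emeasure N (boundary_ball (\<zeta> i) (8 * t i)) \<le> ennreal (M * measure W (boundary_ball (\<zeta> i) (8 * t i)) powr \<sigma>)"
      using \<zeta>t(1,2)[OF i] by (intro carleson) auto
    also have "\<dots> \<le> ennreal (?k * (l * x))"
    proof (intro ennreal_leI)
      have "measure W (boundary_ball (\<zeta> i) (8 * t i)) powr \<sigma> \<le> (D ^ 3 * x) powr \<sigma>"
        using W8 \<sigma> by (intro powr_mono2) auto
      also have "\<dots> = D powr (3 * \<sigma>) * x powr \<sigma>"
      proof -
        have "D ^ 3 = D powr 3"
          using D_pos by (simp add: powr_numeral)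
        then have "(D ^ 3) powr \<sigma> = D powr (3 * \<sigma>)"
          by (simp only: powr_powr)
        then show ?thesis
          using D_pos x(2) by (simp add: powr_mult)
      qed
      also have "x powr \<sigma> \<le> x * l powr (2 - 2 * \<sigma>)"
      proof (cases "x = 0")
        case False
        then have "x powr \<sigma> = x * x powr (\<sigma> - 1)"
          using x(2) by (simp add: powr_diff)
        also have "x powr (\<sigma> - 1) \<le> (l powr (- 2)) powr (\<sigma> - 1)"
          using xl x(2) \<sigma> by (intro powr_mono2) auto
        also have "(l powr (- 2)) powr (\<sigma> - 1) = l powr (2 - 2 * \<sigma>)"
          by (simp add: powr_powr algebra_simps)
        finally show ?thesis
          using x(2) by (simp add: mult_left_mono)
      qed (use \<sigma> in simp)
      also have "x * l powr (2 - 2 * \<sigma>) = l powr (1 - 2 * \<sigma>) * (l * x)"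
      proof -
        have "l powr (2 - 2 * \<sigma>) = l powr ((1 - 2 * \<sigma>) + 1)"
          by (simp add: algebra_simps)
        also have "\<dots> = l powr (1 - 2 * \<sigma>) * l"
          using l by (simp only: powr_add) simp
        finally show ?thesis by simp
      qed
      finally have "measure W (boundary_ball (\<zeta> i) (8 * t i)) powr \<sigma> \<le> D powr (3 * \<sigma>) * (l powr (1 - 2 * \<sigma>) * (l * x))"
        by (simp add: mult_left_mono)
      then show "M * measure W (boundary_ball (\<zeta> i) (8 * t i)) powr \<sigma> \<le> ?k * (l * x)"
        using M by (simp add: mult_left_mono mult.assoc)
    qed
    also have "\<dots> = ennreal ?k * (ennreal l * emeasure W ?B)"
      using M l x by (simp add: ennreal_mult)
    also have "\<dots> \<le> ennreal ?k * (\<integral>\<^sup>+u\<in>?B. H u \<partial>W)"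
      by (intro mult_left_mono avgH i) simp
    finally show "emeasure N (boundary_ball (\<zeta> i) (8 * t i)) \<le> ennreal ?k * (\<integral>\<^sup>+u\<in>?B. H u \<partial>W)" .
  qed (use Q N in auto)
  finally show ?thesis
    unfolding H_def .
qed

text \<open>With g = |f|^(p/2) on the disc and \<sigma> = q / p, the hypothesis bounds the integral
  of g^2 against W and the claim concerns g^(2 \<sigma>) against N. The weak estimate sees only the
  part of g above a multiple of the level, so that interchanging integrals leads back to
  g^2.\<close>

theorem carleson_embedding:
  fixes N :: "complex measure"
  assumes f: "f holomorphic_on unit_disc" and p: "0 < p" "p \<le> q"
    and norm: "(\<integral>\<^sup>+z\<in>unit_disc. ennreal (cmod (f z) powr p) \<partial>W) \<le> 1"
    and M: "0 \<le> M" and N[measurable_cong]: "sets N = sets borel" "sigma_finite_measure N"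
    and carleson: "\<And>\<zeta> t. cmod \<zeta> = 1 \<Longrightarrow> 0 < t \<Longrightarrow>
      emeasure N (boundary_ball \<zeta> t) \<le> ennreal (M * measure W (boundary_ball \<zeta> t) powr (q / p))"
    and m: "D \<le> 2 ^ m"
  shows "(\<integral>\<^sup>+z\<in>unit_disc. ennreal (cmod (f z) powr q) \<partial>N) \<le> ennreal (embed_const m (q / p) * M)"
proof -
  interpret N: sigma_finite_measure N
    by (rule N(2))
  interpret W: finite_measure W
    by (rule finite_W)
  interpret NL: pair_sigma_finite N lborel ..
  interpret WL: pair_sigma_finite W lborel ..
  define \<sigma> where "\<sigma> = q / p"
  have \<sigma>: "1 \<le> \<sigma>"
    using p by (simp add: \<sigma>_def)
  define K where "K = pointwise_const m"
  have K: "0 < K"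
    using pointwise_const_pos by (simp add: K_def)
  define g where "g z = cmod (indicator unit_disc z *\<^sub>R f z) powr (p / 2)" for z
  note borel_measurable_indicator_disc_holomorphic[OF f, measurable]
  have g[measurable]: "g \<in> borel_measurable borel"
    unfolding g_def by measurable
  have g_in: "g z = cmod (f z) powr (p / 2)" if "z \<in> unit_disc" for z
    using that by (simp add: g_def)
  have g_out: "g z = 0" if "z \<notin> unit_disc" for z
    using that by (simp add: g_def)
  have g0: "0 \<le> g z" for z
    by (simp add: g_def)
  have sq: "(g z)\<^sup>2 = indicator unit_disc z * cmod (f z) powr p" for z
  proof (cases "z \<in> unit_disc")
    case True
    then show ?thesis
      using powr_add[of "cmod (f z)" "p / 2" "p / 2"] by (simp add: g_in power2_eq_square)
  qed (simp add: g_out)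
  have L2: "(\<integral>\<^sup>+z. ennreal ((g z)\<^sup>2) \<partial>W) \<le> 1"
  proof -
    have "(\<integral>\<^sup>+z. ennreal ((g z)\<^sup>2) \<partial>W) = (\<integral>\<^sup>+z\<in>unit_disc. ennreal (cmod (f z) powr p) \<partial>W)"
      by (intro nn_integral_cong) (auto simp: sq split: split_indicator)
    then show ?thesis using norm by simp
  qed
  have pw: "\<exists>\<zeta> t. cmod \<zeta> = 1 \<and> 0 < t \<and> t \<le> 2 \<and> z \<in> boundary_ball \<zeta> t \<and>
      ennreal L * emeasure W (boundary_ball \<zeta> t) < (\<integral>\<^sup>+u\<in>boundary_ball \<zeta> t. ennreal (g u) \<partial>W)"
    if L: "0 < L" "K * L < g z" for z L
  proof -
    have "0 < K * L"
      using K L by simp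
    then have z: "z \<in> unit_disc"
      using L(2) g_out[of z] by force
    define \<zeta> where "\<zeta> = (if z = 0 then 1 else z / of_real (cmod z))"
    have \<zeta>: "cmod \<zeta> = 1" "z = of_real (cmod z) * \<zeta>"
      by (auto simp: \<zeta>_def norm_divide)
    \<comment> \<open>Contraposition of the pointwise estimate: if all averages over these radii
      were at most L, then g z \<le> K * L.\<close>
    have "\<exists>t. 1 - cmod z \<le> t \<and> t \<le> 2 \<and> \<not> (\<integral>\<^sup>+u\<in>boundary_ball \<zeta> t. ennreal (cmod (f u) powr (p / 2)) \<partial>W)
        \<le> ennreal L * emeasure W (boundary_ball \<zeta> t)"
    proof (rule ccontr)
      assume "\<not> ?thesis"
      then have "cmod (f z) powr (p / 2) \<le> pointwise_const m * L"
        using z p L by (intro pointwise_le_averages[OF f _ \<zeta>(2) _ \<zeta>(1) m]) auto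
      then show False
        using L(2) z by (simp add: g_in K_def)
    qed
    then obtain t where t: "1 - cmod z \<le> t" "t \<le> 2"
        "ennreal L * emeasure W (boundary_ball \<zeta> t) < (\<integral>\<^sup>+u\<in>boundary_ball \<zeta> t. ennreal (cmod (f u) powr (p / 2)) \<partial>W)"
      by (auto simp: not_le)
    have "cmod (\<zeta> - z) = 1 - cmod z"
    proof -
      have "cmod (\<zeta> - z) = cmod (of_real (1 - cmod z) * \<zeta>)"
        by (subst \<zeta>(2)) (simp add: algebra_simps)
      then show ?thesis
        using z \<zeta>(1) by (simp add: norm_mult del: of_real_diff)
    qed
    then have "z \<in> boundary_ball \<zeta> t"
      using z t by (simp add: boundary_ball_def dist_norm)
    moreover have "(\<integral>\<^sup>+u\<in>boundary_ball \<zeta> t. ennreal (cmod (f u) powr (p / 2)) \<partial>W)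
        = (\<integral>\<^sup>+u\<in>boundary_ball \<zeta> t. ennreal (g u) \<partial>W)"
      by (intro nn_integral_cong) (auto simp: g_in boundary_ball_def split: split_indicator)
    ultimately show ?thesis
      using \<zeta>(1) t z by (intro exI[of _ \<zeta>] exI[of _ t]) auto
  qed
  define A where "A = 2 * \<sigma> * (M * D powr (3 * \<sigma>)) * (2 * K) powr (2 * \<sigma> - 1)"
  have A: "0 \<le> A"
    using \<sigma> M by (simp add: A_def)
  \<comment> \<open>The power x^(2 \<sigma> - 1) of the layer-cake density cancels against l^(1 - 2
    \<sigma>) from the weak estimate, so \<open>A\<close> does not depend on the level x.\<close>
  have level: "ennreal (2 * \<sigma> * x powr (2 * \<sigma> - 1)) * emeasure N {z. x < g z} \<le>
      ennreal A * (\<integral>\<^sup>+z. ennreal (g z) * indicator {z. x / (2 * K) < g z} z \<partial>W)" if x: "0 < x" for x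
  proof -
    define l where "l = x / (2 * K)"
    have l: "0 < l" "K * (2 * l) = x"
      using x K by (auto simp: l_def)
    have "emeasure N {z. x < g z} \<le> ennreal (M * D powr (3 * \<sigma>) * l powr (1 - 2 * \<sigma>)) *
        (\<integral>\<^sup>+z. ennreal (g z) * indicator {z. l < g z} z \<partial>W)"
      using emeasure_level_set_le[OF g g0 L2 pw K \<sigma> M N(1) carleson[folded \<sigma>_def] l(1)] l(2) by simp
    then have "ennreal (2 * \<sigma> * x powr (2 * \<sigma> - 1)) * emeasure N {z. x < g z} \<le>
        ennreal (2 * \<sigma> * x powr (2 * \<sigma> - 1)) * (ennreal (M * D powr (3 * \<sigma>) * l powr (1 - 2 * \<sigma>)) *
        (\<integral>\<^sup>+z. ennreal (g z) * indicator {z. l < g z} z \<partial>W))"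
      by (rule mult_left_mono) simp
    also have "\<dots> = ennreal (2 * \<sigma> * x powr (2 * \<sigma> - 1) * (M * D powr (3 * \<sigma>) * l powr (1 - 2 * \<sigma>))) *
        (\<integral>\<^sup>+z. ennreal (g z) * indicator {z. l < g z} z \<partial>W)"
      using \<sigma> M by (simp add: ennreal_mult mult.assoc)
    also have "2 * \<sigma> * x powr (2 * \<sigma> - 1) * (M * D powr (3 * \<sigma>) * l powr (1 - 2 * \<sigma>)) = A"
    proof -
      have "x powr (2 * \<sigma> - 1) = (2 * K) powr (2 * \<sigma> - 1) * l powr (2 * \<sigma> - 1)"
        using l K by (simp add: powr_mult mult_ac flip: l(2))
      moreover have "l powr (2 * \<sigma> - 1) * l powr (1 - 2 * \<sigma>) = 1"
        using l(1) by (simp flip: powr_add)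
      ultimately show ?thesis
        by (simp add: A_def)
    qed
    finally show ?thesis
      by (simp add: l_def)
  qed
  have "(\<integral>\<^sup>+z\<in>unit_disc. ennreal (cmod (f z) powr q) \<partial>N) = (\<integral>\<^sup>+z. ennreal (g z powr (2 * \<sigma>)) \<partial>N)"
    using p \<sigma> by (intro nn_integral_cong) (auto simp: g_in g_out powr_powr \<sigma>_def split: split_indicator)
  also have "\<dots> = (\<integral>\<^sup>+z. \<integral>\<^sup>+x. ennreal (2 * \<sigma> * x powr (2 * \<sigma> - 1)) * indicator {0<..<g z} x \<partial>lborel \<partial>N)"
    using \<sigma> g0 by (intro nn_integral_cong nn_integral_powr_deriv) auto
  also have "\<dots> = (\<integral>\<^sup>+x. \<integral>\<^sup>+z. ennreal (2 * \<sigma> * x powr (2 * \<sigma> - 1)) * indicator {0<..<g z} x \<partial>N \<partial>lborel)"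
    by (rule NL.Fubini'[symmetric]) (simp add: greaterThanLessThan_def greaterThan_def lessThan_def indicator_inter_arith)
  also have "\<dots> \<le> (\<integral>\<^sup>+x. \<integral>\<^sup>+z. ennreal A * (ennreal (g z) * indicator {0<..<2 * K * g z} x) \<partial>W \<partial>lborel)"
  proof (intro nn_integral_mono)
    fix x :: real
    show "(\<integral>\<^sup>+z. ennreal (2 * \<sigma> * x powr (2 * \<sigma> - 1)) * indicator {0<..<g z} x \<partial>N) \<le>
        (\<integral>\<^sup>+z. ennreal A * (ennreal (g z) * indicator {0<..<2 * K * g z} x) \<partial>W)"
    proof (cases "0 < x")
      case True
      have "(\<integral>\<^sup>+z. ennreal (2 * \<sigma> * x powr (2 * \<sigma> - 1)) * indicator {0<..<g z} x \<partial>N)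
          = (\<integral>\<^sup>+z. ennreal (2 * \<sigma> * x powr (2 * \<sigma> - 1)) * indicator {z. x < g z} z \<partial>N)"
        using True by (intro nn_integral_cong) (auto split: split_indicator)
      also have "\<dots> = ennreal (2 * \<sigma> * x powr (2 * \<sigma> - 1)) * emeasure N {z. x < g z}"
        by (rule nn_integral_cmult_indicator) measurable
      also note level[OF True]
      also have "ennreal A * (\<integral>\<^sup>+z. ennreal (g z) * indicator {z. x / (2 * K) < g z} z \<partial>W)
          = (\<integral>\<^sup>+z. ennreal A * (ennreal (g z) * indicator {z. x / (2 * K) < g z} z) \<partial>W)"
        by (rule nn_integral_cmult[symmetric]) measurable
      also have "\<dots> = (\<integral>\<^sup>+z. ennreal A * (ennreal (g z) * indicator {0<..<2 * K * g z} x) \<partial>W)"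
        using True K by (intro nn_integral_cong) (auto simp: field_simps split: split_indicator)
      finally show ?thesis .
    qed simp
  qed
  also have "\<dots> = (\<integral>\<^sup>+z. \<integral>\<^sup>+x. ennreal A * (ennreal (g z) * indicator {0<..<2 * K * g z} x) \<partial>lborel \<partial>W)"
    by (rule WL.Fubini') (simp add: greaterThanLessThan_def greaterThan_def lessThan_def indicator_inter_arith)
  \<comment> \<open>The level runs over an interval of length 2 K g, which supplies the second
    factor g.\<close>
  also have "\<dots> = (\<integral>\<^sup>+z. ennreal (A * (2 * K)) * ennreal ((g z)\<^sup>2) \<partial>W)"
  proof (intro nn_integral_cong)
    fix z
    have "(\<integral>\<^sup>+x. ennreal A * (ennreal (g z) * indicator {0<..<2 * K * g z} x) \<partial>lborel)
        = (\<integral>\<^sup>+x. ennreal (A * g z) * indicator {0<..<2 * K * g z} x \<partial>lborel)"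
      using A g0 by (simp add: ennreal_mult mult.assoc)
    also have "\<dots> = ennreal (A * g z) * ennreal (2 * K * g z)"
      using K g0 by (subst nn_integral_cmult_indicator) auto
    also have "\<dots> = ennreal (A * (2 * K)) * ennreal ((g z)\<^sup>2)"
      using A g0 K by (simp add: ennreal_mult[symmetric] power2_eq_square mult_ac)
    finally show "(\<integral>\<^sup>+x. ennreal A * (ennreal (g z) * indicator {0<..<2 * K * g z} x) \<partial>lborel)
        = ennreal (A * (2 * K)) * ennreal ((g z)\<^sup>2)" .
  qed
  also have "\<dots> = ennreal (A * (2 * K)) * (\<integral>\<^sup>+z. ennreal ((g z)\<^sup>2) \<partial>W)"
    by (rule nn_integral_cmult) measurable
  also have "\<dots> \<le> ennreal (A * (2 * K)) * 1"
    by (intro mult_left_mono L2) simp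
  also have "A * (2 * K) = embed_const m (q / p) * M"
  proof -
    have "(2 * K) powr (2 * \<sigma>) = (2 * K) powr (2 * \<sigma> - 1 + 1)"
      by simp
    also have "\<dots> = (2 * K) powr (2 * \<sigma> - 1) * (2 * K)"
      using K by (simp only: powr_add) simp
    finally show ?thesis
      by (simp add: A_def embed_const_def K_def \<sigma>_def)
  qed
  finally show ?thesis by simp
qed

end

section \<open>Doubling weights and Carleson squares\<close>

lemma borel_measurable_lebesgue_cong_AE:
  assumes g: "g \<in> borel_measurable lborel" and ae: "AE x in lborel. f x = g x"
  shows "f \<in> borel_measurable lebesgue"
proof (rule measurableI)
  fix A :: "'b set" assume A: "A \<in> sets borel"
  have "AE x in lebesgue. f x = g x"
    using ae by (rule AE_completion)
  then have "AE x in lebesgue. x \<in> g -` A \<inter> space lebesgue \<longleftrightarrow> x \<in> f -` A \<inter> space lebesgue"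
    by eventually_elim simp
  moreover have "g -` A \<inter> space lebesgue \<in> sets lebesgue"
    using measurable_sets[OF measurable_completion[OF g] A] .
  ultimately show "f -` A \<inter> space lebesgue \<in> sets lebesgue"
    by (rule completion.in_sets_AE) simp
qed simp

text \<open>The distribution of |z| has a density, so the circles over a null set of radii form a
  null set in the plane.\<close>

lemma AE_lborel_cmod:
  assumes "AE r in lborel. P r"
  shows "AE z in lborel. P (cmod z)"
proof -
  obtain S where S: "{r \<in> space lborel. \<not> P r} \<subseteq> S" "S \<in> null_sets lborel"
    using assms by (auto elim: AE_E simp: null_sets_def)
  have [measurable]: "S \<in> sets borel"
    using S(2) by auto
  have "AE r in lborel. r \<notin> S"
    using S(2) by (rule AE_not_in)
  then have "AE r in density lborel (\<lambda>r. ennreal (2 * pi * r) * indicator {0..} r). r \<notin> S"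
    by (subst AE_density) auto
  then have "AE r in distr lborel borel cmod. r \<notin> S"
    unfolding distr_lborel_cmod .
  then have "AE z in lborel. cmod z \<notin> S"
    by (subst (asm) AE_distr_iff) auto
  then show ?thesis
    by eventually_elim (use S(1) in auto)
qed

lemma nn_integral_dA:
  assumes "h \<in> borel_measurable lebesgue"
  shows "(\<integral>\<^sup>+z. h z \<partial>dA) = (\<integral>\<^sup>+z. ennreal (1 / pi) * h z \<partial>lborel)"
  unfolding dA_def using assms by (subst nn_integral_density) (auto simp: nn_integral_completion)

text \<open>Links the given weight, whose profile is only Lebesgue measurable, to a Borel profile.
  Almost everywhere agreement suffices because \<omega> enters only through integrals.\<close>

locale disc_weight = radial_weight +
  fixes \<omega> :: "complex \<Rightarrow> real"
  assumes \<omega>_pos: "\<And>z. z \<in> unit_disc \<Longrightarrow> 0 < \<omega> z"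
    and \<omega>_AE: "AE z in lborel. z \<in> unit_disc \<longrightarrow> ennreal (\<omega> z) = w (cmod z)"
begin

lemma nn_integral_weight:
  assumes h: "(\<lambda>z. ennreal (h z) * indicator unit_disc z) \<in> borel_measurable borel" "\<And>z. 0 \<le> h z"
  shows "(\<integral>\<^sup>+z\<in>unit_disc. ennreal (h z * \<omega> z) \<partial>dA) = (\<integral>\<^sup>+z\<in>unit_disc. ennreal (h z) \<partial>W)"
proof -
  have ae: "AE z in lborel. ennreal (h z * \<omega> z) * indicator unit_disc z
      = (ennreal (h z) * indicator unit_disc z) * w (cmod z)"
    using \<omega>_AE
    by eventually_elim (use h(2) \<omega>_pos in \<open>auto simp: ennreal_mult less_imp_le split: split_indicator\<close>)
  have "(\<lambda>z. ennreal (h z * \<omega> z) * indicator unit_disc z) \<in> borel_measurable lebesgue"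
    by (rule borel_measurable_lebesgue_cong_AE[OF _ ae]) (use h(1) in measurable)
  then have "(\<integral>\<^sup>+z\<in>unit_disc. ennreal (h z * \<omega> z) \<partial>dA)
      = (\<integral>\<^sup>+z. ennreal (1 / pi) * (ennreal (h z * \<omega> z) * indicator unit_disc z) \<partial>lborel)"
    by (rule nn_integral_dA)
  also have "\<dots> = (\<integral>\<^sup>+z. (w (cmod z) * indicator unit_disc z * ennreal (1 / pi)) *
      (ennreal (h z) * indicator unit_disc z) \<partial>lborel)"
  proof (rule nn_integral_cong_AE, use ae in eventually_elim)
    case (elim z)
    show ?case
      unfolding elim by (simp add: mult_ac split: split_indicator)
  qed
  also have "\<dots> = (\<integral>\<^sup>+z\<in>unit_disc. ennreal (h z) \<partial>W)"
    unfolding disc_measure_def using h(1) by (subst nn_integral_density) auto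
  finally show ?thesis .
qed

lemma set_integral_weight:
  assumes S[measurable]: "S \<in> sets borel" and "S \<subseteq> unit_disc"
  shows "(LINT z:S|dA. \<omega> z) = measure W S"
proof -
  let ?h = "\<lambda>z. indicator S z :: real"
  have ae: "AE z in lborel. indicator S z *\<^sub>R \<omega> z = indicator S z * enn2real (w (cmod z))"
    using \<omega>_AE
  proof eventually_elim
    case (elim z)
    show ?case
    proof (cases "z \<in> S")
      case True
      then have "w (cmod z) = ennreal (\<omega> z)" "0 \<le> \<omega> z"
        using elim \<omega>_pos[of z] assms(2) by auto
      then show ?thesis
        by simp
    qed simp
  qed
  have meas: "(\<lambda>z. indicator S z *\<^sub>R \<omega> z) \<in> borel_measurable lebesgue"
    by (rule borel_measurable_lebesgue_cong_AE[OF _ ae]) measurable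
  then have meas': "(\<lambda>z. indicator S z *\<^sub>R \<omega> z) \<in> borel_measurable dA"
    by (simp add: dA_def)
  have "(LINT z:S|dA. \<omega> z) = enn2real (\<integral>\<^sup>+z. ennreal (indicator S z *\<^sub>R \<omega> z) \<partial>dA)"
    unfolding set_lebesgue_integral_def using assms(2) \<omega>_pos
    by (intro integral_eq_nn_integral meas') (auto intro!: AE_I2 mult_nonneg_nonneg less_imp_le split: split_indicator)
  also have "(\<integral>\<^sup>+z. ennreal (indicator S z *\<^sub>R \<omega> z) \<partial>dA) = (\<integral>\<^sup>+z\<in>unit_disc. ennreal (?h z * \<omega> z) \<partial>dA)"
    using assms(2) by (intro nn_integral_cong) (auto split: split_indicator)
  also have "\<dots> = (\<integral>\<^sup>+z\<in>unit_disc. ennreal (?h z) \<partial>W)"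
    by (rule nn_integral_weight) auto
  also have "\<dots> = (\<integral>\<^sup>+z. indicator S z \<partial>W)"
    using assms(2) by (intro nn_integral_cong) (auto split: split_indicator)
  also have "enn2real \<dots> = measure W S"
    by (simp add: measure_def)
  finally show ?thesis .
qed

end

text \<open>The profile, cut off outside (0, 1), has a Borel version with the same tails. Agreement
  for almost every radius becomes agreement for almost every point of the disc.\<close>

lemma D_hat_disc_weight:
  assumes "\<omega> \<in> D_hat"
  obtains w C where "disc_weight w C \<omega>"
proof -
  let ?\<phi> = "\<lambda>r::real. indicator {0<..<1} r *\<^sub>R \<omega> (of_real r)"
  have wt: "weight \<omega>"
    using assms by (simp add: D_hat_def)
  have \<omega>': "\<forall>z\<in>unit_disc. 0 < \<omega> z \<and> \<omega> z = \<omega> (of_real (cmod z))"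
    using wt unfolding weight_def by (rule conjunct1)
  note \<omega> = bspec[OF \<omega>', THEN conjunct1] bspec[OF \<omega>', THEN conjunct2, symmetric]
  have int: "integrable lebesgue ?\<phi>"
    using wt unfolding weight_def set_integrable_def by (rule conjunct2)
  have \<phi>_pos: "0 \<le> ?\<phi> r" for r
    using \<omega>(1)[of "of_real r"] by (auto split: split_indicator)
  obtain g where g[measurable]: "g \<in> borel_measurable lborel" and ae: "AE r in lborel. ?\<phi> r = g r"
    using completion_ex_borel_measurable_real[OF borel_measurable_integrable[OF int]] by (elim bexE)
  define w where "w r = ennreal (g r)" for r
  have w[measurable]: "w \<in> borel_measurable borel"
    using g unfolding w_def by simp
  have tail_eq: "weight_tail w r = ennreal (weight_hat \<omega> r)" if r: "0 \<le> r" for r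
  proof -
    have eq: "AE s in lborel. indicator {r..<1} s *\<^sub>R \<omega> (of_real s) = indicator {r..<1} s *\<^sub>R ?\<phi> s"
      using AE_lborel_singleton[of 0] by eventually_elim (use r in \<open>auto split: split_indicator\<close>)
    have I: "integrable lebesgue (\<lambda>s. indicator {r..<1} s *\<^sub>R ?\<phi> s)"
      by (rule integrable_mult_indicator[OF _ int]) simp
    have "weight_tail w r = (\<integral>\<^sup>+s. ennreal (indicator {r..<1} s *\<^sub>R ?\<phi> s) \<partial>lborel)"
      unfolding weight_tail_def w_def
    proof (rule nn_integral_cong_AE, use ae in eventually_elim)
      case (elim s)
      show ?case
        by (simp only: elim) (simp split: split_indicator)
    qed
    also have "\<dots> = (\<integral>\<^sup>+s. ennreal (indicator {r..<1} s *\<^sub>R ?\<phi> s) \<partial>lebesgue)"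
      by (simp only: nn_integral_completion)
    also have "\<dots> = ennreal (\<integral>s. indicator {r..<1} s *\<^sub>R ?\<phi> s \<partial>lebesgue)"
      using \<phi>_pos by (intro nn_integral_eq_integral[OF I]) (auto intro!: AE_I2 split: split_indicator)
    also have "(\<integral>s. indicator {r..<1} s *\<^sub>R ?\<phi> s \<partial>lebesgue) = weight_hat \<omega> r"
      unfolding weight_hat_def set_lebesgue_integral_def
    proof (rule integral_cong_AE)
      show "(\<lambda>s. indicator {r..<1} s *\<^sub>R ?\<phi> s) \<in> borel_measurable lebesgue"
        using I by (rule borel_measurable_integrable)
      show ae': "AE s in lebesgue. indicator {r..<1} s *\<^sub>R ?\<phi> s = indicator {r..<1} s *\<^sub>R \<omega> (of_real s)"
        using AE_completion[OF eq] by eventually_elim simp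
      show "(\<lambda>s. indicator {r..<1} s *\<^sub>R \<omega> (of_real s)) \<in> borel_measurable lebesgue"
      proof (rule borel_measurable_lebesgue_cong_AE)
        show "AE s in lborel. indicator {r..<1} s *\<^sub>R \<omega> (of_real s) = indicator {r..<1} s *\<^sub>R g s"
          using eq ae by eventually_elim (simp only:)
      qed simp
    qed
    finally show ?thesis .
  qed
  have hat_nonneg: "0 \<le> weight_hat \<omega> r" if "0 \<le> r" for r
    unfolding weight_hat_def set_lebesgue_integral_def
  proof (rule integral_nonneg_AE, rule AE_I2)
    fix s
    show "0 \<le> indicator {r..<1} s *\<^sub>R \<omega> (of_real s)"
      using \<omega>(1)[of "of_real s"] that by (auto split: split_indicator)
  qed
  obtain C where C: "0 < C" "\<And>r. 0 < r \<Longrightarrow> r < 1 \<Longrightarrow> weight_hat \<omega> r < C * weight_hat \<omega> ((1 + r) / 2)"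
    using assms by (auto simp: D_hat_def)
  have tail_pos: "0 < weight_tail w r" if r: "0 \<le> r" "r < 1" for r
  proof -
    \<comment> \<open>Positivity is read off from the strictness of the doubling inequality. As that
      inequality is assumed only for positive radii, it is used at the midpoint \<rho> of r and
      1.\<close>
    define \<rho> where "\<rho> = (1 + r) / 2"
    have \<rho>: "0 < \<rho>" "\<rho> < 1" "r \<le> (1 + \<rho>) / 2"
      using r by (auto simp: \<rho>_def field_simps)
    have "0 < C * weight_hat \<omega> ((1 + \<rho>) / 2)"
      using C(2)[OF \<rho>(1,2)] hat_nonneg[of \<rho>] \<rho> by linarith
    then have "0 < weight_hat \<omega> ((1 + \<rho>) / 2)"
      using C(1) by (simp add: zero_less_mult_iff)
    then have "0 < weight_tail w ((1 + \<rho>) / 2)"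
      using \<rho> by (subst tail_eq) auto
    also have "\<dots> \<le> weight_tail w r"
      by (rule tail_antimono) (rule \<rho>)
    finally show ?thesis .
  qed
  \<comment> \<open>The quotient takes care of r = 0, where membership in \<open>D_hat\<close> gives
    no inequality.\<close>
  define C' where "C' = max C (weight_hat \<omega> 0 / weight_hat \<omega> (1 / 2))"
  have half: "0 < weight_hat \<omega> (1 / 2)"
    using tail_pos[of "1 / 2"] by (simp add: tail_eq)
  have "disc_weight w C' \<omega>"
  proof
    show "w \<in> borel_measurable borel" by (rule w)
    show "weight_tail w 0 < \<infinity>" by (simp add: tail_eq)
    show "0 < weight_tail w r" if "0 \<le> r" "r < 1" for r
      using tail_pos[OF that] .
    show "0 < C'" using C(1) by (simp add: C'_def)
    show "weight_tail w r \<le> ennreal C' * weight_tail w ((1 + r) / 2)" if r: "0 \<le> r" "r < 1" for r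
    proof -
      have "weight_hat \<omega> r \<le> C' * weight_hat \<omega> ((1 + r) / 2)"
      proof (cases "r = 0")
        case True
        have "weight_hat \<omega> 0 / weight_hat \<omega> (1 / 2) * weight_hat \<omega> (1 / 2) \<le> C' * weight_hat \<omega> (1 / 2)"
          using half by (intro mult_right_mono) (auto simp: C'_def)
        then show ?thesis
          using half True by simp
      next
        case False
        then have "weight_hat \<omega> r \<le> C * weight_hat \<omega> ((1 + r) / 2)"
          using C(2)[of r] r by simp
        also have "\<dots> \<le> C' * weight_hat \<omega> ((1 + r) / 2)"
          using r by (intro mult_right_mono hat_nonneg) (auto simp: C'_def)
        finally show ?thesis .
      qed
      then have "ennreal (weight_hat \<omega> r) \<le> ennreal (C' * weight_hat \<omega> ((1 + r) / 2))"
        by (rule ennreal_leI)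
      also have "\<dots> = ennreal C' * ennreal (weight_hat \<omega> ((1 + r) / 2))"
        using C(1) r by (intro ennreal_mult hat_nonneg) (auto simp: C'_def)
      finally show ?thesis
        using r by (simp add: tail_eq)
    qed
    show "0 < \<omega> z" if "z \<in> unit_disc" for z
      using \<omega>(1)[OF that] .
    have "AE z in lborel. ?\<phi> (cmod z) = g (cmod z)"
      using ae by (rule AE_lborel_cmod)
    then show "AE z in lborel. z \<in> unit_disc \<longrightarrow> ennreal (\<omega> z) = w (cmod z)"
      using AE_lborel_singleton[of 0]
    proof eventually_elim
      case (elim z)
      show ?case
      proof
        assume z: "z \<in> unit_disc"
        then have "?\<phi> (cmod z) = \<omega> z"
          using elim(2) \<omega>(2)[OF z] by simp
        then show "ennreal (\<omega> z) = w (cmod z)"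
          using elim(1) by (simp add: w_def)
      qed
    qed
  qed
  then show ?thesis by (rule that)
qed

section \<open>Geometry of Carleson squares\<close>

lemma abs_Arg_le_iff:
  assumes "0 \<le> h" "h \<le> pi"
  shows "\<bar>Arg u\<bar> \<le> h \<longleftrightarrow> cmod u * cos h \<le> Re u"
proof (cases "u = 0")
  case False
  have "Re u = cmod u * cos (Arg u)"
    using Re_rcis[of "cmod u" "Arg u"] by (simp only: rcis_cmod_Arg)
  then have "cmod u * cos h \<le> Re u \<longleftrightarrow> cos h \<le> cos \<bar>Arg u\<bar>"
    using False by simp
  also have "\<dots> \<longleftrightarrow> \<bar>Arg u\<bar> \<le> h"
    using assms Arg_bounded[of u] by (intro cos_mono_le_eq) auto
  finally show ?thesis by simp
qed (use assms in \<open>simp add: Arg_zero\<close>)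

text \<open>For z = r cis t with r > 0 the number a * cnj z is a positive multiple of a * cis (- t).
  The angular condition thus depends on z alone, not on the angle chosen to represent it.\<close>

lemma carleson_square_eq:
  assumes "a \<noteq> 0"
  shows "carleson_square a = {z. cmod a \<le> cmod z \<and> cmod z < 1 \<and> \<bar>Arg (a * cnj z)\<bar> \<le> (1 - cmod a) / 2}"
proof (intro subset_antisym subsetI)
  have a: "0 < cmod a" using assms by simp
  fix z assume "z \<in> carleson_square a"
  then obtain r t \<theta> where z: "z = of_real r * cis t" "cmod a \<le> r" "r < 1" "cis t = cis \<theta>"
      "\<bar>Arg (a * cis (- \<theta>))\<bar> \<le> (1 - cmod a) / 2"
    using assms by (auto simp: carleson_square_def carleson_arc_def)
  have "a * cnj z = of_real r * (a * cis (- \<theta>))"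
    by (simp add: z(1,4) cis_cnj)
  then have "Arg (a * cnj z) = Arg (a * cis (- \<theta>))"
    using order.strict_trans2[OF a z(2)] by (simp only: Arg_times_of_real)
  moreover have "0 < r"
    using z(2) a by linarith
  then have "cmod z = r"
    by (simp add: z(1) norm_mult)
  ultimately show "z \<in> {z. cmod a \<le> cmod z \<and> cmod z < 1 \<and> \<bar>Arg (a * cnj z)\<bar> \<le> (1 - cmod a) / 2}"
    using z(2,3,5) by simp
next
  have a: "0 < cmod a" using assms by simp
  fix z assume "z \<in> {z. cmod a \<le> cmod z \<and> cmod z < 1 \<and> \<bar>Arg (a * cnj z)\<bar> \<le> (1 - cmod a) / 2}"
  then have z: "cmod a \<le> cmod z" "cmod z < 1" "\<bar>Arg (a * cnj z)\<bar> \<le> (1 - cmod a) / 2"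
    by auto
  have zz: "z = of_real (cmod z) * cis (Arg z)"
    using rcis_cmod_Arg[of z] by (simp add: rcis_def)
  have "a * cnj z = of_real (cmod z) * (a * cis (- Arg z))"
    using arg_cong[OF zz, of cnj] by (simp add: cis_cnj)
  moreover have "0 < cmod z"
    using z(1) a by linarith
  ultimately have "Arg (a * cnj z) = Arg (a * cis (- Arg z))"
    by (simp only: Arg_times_of_real)
  then have "\<bar>Arg (a * cis (- Arg z))\<bar> \<le> (1 - cmod a) / 2"
    using z(3) by (simp only:)
  then have "cis (Arg z) \<in> carleson_arc a"
    unfolding carleson_arc_def by blast
  then have "\<exists>r t. z = of_real r * cis t \<and> cis t \<in> carleson_arc a \<and> cmod a \<le> r \<and> r < 1"
    using zz z(1,2) by blast
  then show "z \<in> carleson_square a"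
    using assms by (simp add: carleson_square_def)
qed

lemma borel_measurable_cnj [measurable]: "cnj \<in> borel_measurable borel"
  by (intro borel_measurable_continuous_onI continuous_intros)

text \<open>\<open>abs_Arg_le_iff\<close> replaces the discontinuous argument by an inequality
  between continuous functions of z.\<close>

lemma carleson_square_borel:
  assumes "cmod a < 1"
  shows "carleson_square a \<in> sets borel"
proof (cases "a = 0")
  case False
  have "1 - cmod a \<le> 2 * pi"
    using pi_gt3 norm_ge_zero[of a] by linarith
  then have h: "0 \<le> (1 - cmod a) / 2" "(1 - cmod a) / 2 \<le> pi"
    using assms by simp_all
  have "carleson_square a = {z. cmod a \<le> cmod z \<and> cmod z < 1 \<and>
      cmod (a * cnj z) * cos ((1 - cmod a) / 2) \<le> Re (a * cnj z)}"
    unfolding carleson_square_eq[OF False] abs_Arg_le_iff[OF h] ..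
  also have "\<dots> \<in> sets borel"
    by measurable
  finally show ?thesis .
qed (simp add: carleson_square_def)

lemma carleson_square_subset_disc: "carleson_square a \<subseteq> unit_disc"
proof (cases "a = 0")
  case False
  then show ?thesis by (auto simp: carleson_square_eq)
qed (simp add: carleson_square_def)

lemma exists_direction: "\<exists>\<zeta>. cmod \<zeta> = 1 \<and> a = of_real (cmod a) * \<zeta>"
proof (cases "a = 0")
  case False
  then show ?thesis
    by (intro exI[of _ "a / of_real (cmod a)"]) (simp add: norm_divide)
qed (intro exI[of _ 1], simp)

text \<open>With v = z / |z| the unit number \<open>cis (Arg (a * cnj z))\<close> is \<zeta> * cnj
  v; multiplying \<zeta> - v by cnj v turns the chord between the directions into a chord from
  1.\<close>

lemma cmod_direction_diff:
  assumes "cmod \<zeta> = 1" "a = of_real (cmod a) * \<zeta>" "a \<noteq> 0" "z \<noteq> 0"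
  shows "cmod (\<zeta> - z / of_real (cmod z)) = cmod (cis (Arg (a * cnj z)) - 1)"
proof -
  define v where "v = z / of_real (cmod z)"
  have v: "cmod v = 1" "v * cnj v = 1"
  proof -
    show v1: "cmod v = 1"
      using assms(4) by (simp add: v_def norm_divide)
    show "v * cnj v = 1"
      using complex_norm_square[of v] v1 by simp
  qed
  have e: "of_real (cmod a * cmod z) * cis (Arg (a * cnj z)) = a * cnj z"
    using rcis_cmod_Arg[of "a * cnj z"] by (simp only: rcis_def norm_mult complex_mod_cnj)
  have "cnj z = of_real (cmod z) * cnj v"
    using assms(4) by (simp add: v_def)
  from arg_cong2[OF assms(2) this, of "(*)"]
  have "a * cnj z = of_real (cmod a * cmod z) * (\<zeta> * cnj v)"
    by simp
  with e have "of_real (cmod a * cmod z) * cis (Arg (a * cnj z)) = of_real (cmod a * cmod z) * (\<zeta> * cnj v)"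
    by (simp only:)
  then have "cis (Arg (a * cnj z)) = \<zeta> * cnj v"
    using assms(3,4) by (subst (asm) mult_cancel_left) auto
  then have "cis (Arg (a * cnj z)) - 1 = (\<zeta> - v) * cnj v"
    using v(2) by (simp add: algebra_simps)
  then show ?thesis
    using v(1) by (simp only: norm_mult complex_mod_cnj mult_1_right flip: v_def)
qed

lemma cmod_diff_direction:
  assumes "z \<noteq> 0" "cmod z \<le> 1"
  shows "cmod (z / of_real (cmod z) - z) = 1 - cmod z"
proof -
  have "z / of_real (cmod z) - z = of_real (1 - cmod z) * (z / of_real (cmod z))"
    using assms(1) by (simp add: field_simps)
  then show ?thesis
    using assms by (simp only: norm_mult norm_divide) (simp del: of_real_diff)
qed

text \<open>Go from \<zeta> along the circle, at most (1 - |a|) / 2, and then radially, at most 1 -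
  |a|.\<close>

lemma carleson_square_subset:
  assumes \<zeta>: "cmod \<zeta> = 1" "a = of_real (cmod a) * \<zeta>" and a: "cmod a < 1"
  shows "carleson_square a \<subseteq> boundary_ball \<zeta> (2 * (1 - cmod a))"
proof (cases "a = 0")
  case True
  then show ?thesis
    using boundary_ball_eq_disc[OF \<zeta>(1), of 2] by (simp add: carleson_square_def)
next
  case False
  show ?thesis
  proof
    fix z assume "z \<in> carleson_square a"
    then have z: "cmod a \<le> cmod z" "cmod z < 1" "\<bar>Arg (a * cnj z)\<bar> \<le> (1 - cmod a) / 2"
      using False by (auto simp: carleson_square_eq)
    then have z0: "z \<noteq> 0"
      using False by auto
    have "cmod (\<zeta> - z) \<le> cmod (\<zeta> - z / of_real (cmod z)) + cmod (z / of_real (cmod z) - z)"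
      using norm_triangle_ineq[of "\<zeta> - z / of_real (cmod z)" "z / of_real (cmod z) - z"] by simp
    also have "\<dots> \<le> (1 - cmod a) / 2 + (1 - cmod a)"
      unfolding cmod_direction_diff[OF \<zeta> False z0] cmod_diff_direction[OF z0 less_imp_le[OF z(2)]]
      using z(1) by (intro add_mono order_trans[OF cmod_cis_minus_one_le z(3)]) auto
    also have "\<dots> \<le> 2 * (1 - cmod a)"
      using a by (simp add: field_simps)
    finally show "z \<in> boundary_ball \<zeta> (2 * (1 - cmod a))"
      using z by (simp add: boundary_ball_def dist_norm)
  qed
qed

text \<open>Radius (1 - |a|) / 8 bounds both the radial distance and the distance to \<zeta>, so the
  chord is at most a quarter of 1 - |a|. The angle is at most twice the chord, which is exactly the
  half-width of the arc.\<close>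

lemma subset_carleson_square:
  assumes \<zeta>: "cmod \<zeta> = 1" "a = of_real (cmod a) * \<zeta>" and a: "cmod a < 1"
  shows "boundary_ball \<zeta> ((1 - cmod a) / 8) \<subseteq> carleson_square a"
proof (cases "a = 0")
  case True
  then show ?thesis
    by (auto simp: carleson_square_def boundary_ball_def)
next
  case False
  show ?thesis
  proof
    fix z assume "z \<in> boundary_ball \<zeta> ((1 - cmod a) / 8)"
    then have z: "cmod (\<zeta> - z) \<le> (1 - cmod a) / 8" "cmod z < 1"
      by (auto simp: boundary_ball_def dist_norm)
    have z1: "1 - cmod z \<le> (1 - cmod a) / 8"
      using norm_triangle_ineq2[of \<zeta> z] z(1) \<zeta>(1) by linarith
    then have az: "cmod a \<le> cmod z"
      using a by simp
    then have z0: "z \<noteq> 0"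
      using False by auto
    have "cmod (\<zeta> - z / of_real (cmod z)) \<le> cmod (\<zeta> - z) + cmod (z / of_real (cmod z) - z)"
      using norm_triangle_ineq4[of "\<zeta> - z" "z / of_real (cmod z) - z"] by simp
    also have "\<dots> \<le> (1 - cmod a) / 4"
      using cmod_diff_direction[OF z0 less_imp_le[OF z(2)]] z z1 by simp
    finally have "cmod (cis (Arg (a * cnj z)) - 1) \<le> (1 - cmod a) / 4"
      using cmod_direction_diff[OF \<zeta> False z0] by simp
    moreover have "\<bar>Arg (a * cnj z)\<bar> \<le> pi"
      using Arg_bounded[of "a * cnj z"] by linarith
    ultimately have "\<bar>Arg (a * cnj z)\<bar> \<le> (1 - cmod a) / 2"
      using cmod_cis_minus_one_ge[of "Arg (a * cnj z)"] by linarith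
    then show "z \<in> carleson_square a"
      using az z False by (simp add: carleson_square_eq)
  qed
qed

context disc_weight
begin

sublocale W: finite_measure W
  by (rule finite_W)

lemma carleson_mass_eq:
  assumes "cmod a < 1"
  shows "carleson_mass \<omega> a = measure W (carleson_square a)"
  unfolding carleson_mass_def using assms
  by (intro set_integral_weight carleson_square_borel carleson_square_subset_disc)

lemma measure_W_doubling_power:
  assumes "cmod \<zeta> = 1" "0 < t"
  shows "measure W (boundary_ball \<zeta> (2 ^ k * t)) \<le> D ^ k * measure W (boundary_ball \<zeta> t)"
  using emeasure_W_doubling_power[OF assms, of k] D_pos
  by (simp add: W.emeasure_eq_measure ennreal_mult[symmetric])

lemma carleson_mass_le:
  assumes "cmod \<zeta> = 1" "a = of_real (cmod a) * \<zeta>" "cmod a < 1"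
  shows "carleson_mass \<omega> a \<le> D * measure W (boundary_ball \<zeta> (1 - cmod a))"
proof -
  have "carleson_mass \<omega> a \<le> measure W (boundary_ball \<zeta> (2 ^ 1 * (1 - cmod a)))"
    unfolding carleson_mass_eq[OF assms(3)] using carleson_square_subset[OF assms]
    by (intro W.finite_measure_mono) auto
  also have "\<dots> \<le> D ^ 1 * measure W (boundary_ball \<zeta> (1 - cmod a))"
    using assms by (intro measure_W_doubling_power) auto
  finally show ?thesis by simp
qed

lemma carleson_mass_ge:
  assumes "cmod \<zeta> = 1" "a = of_real (cmod a) * \<zeta>" "cmod a < 1"
  shows "measure W (boundary_ball \<zeta> (1 - cmod a)) \<le> D ^ 3 * carleson_mass \<omega> a"
proof -
  have "measure W (boundary_ball \<zeta> (2 ^ 3 * ((1 - cmod a) / 8)))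
      \<le> D ^ 3 * measure W (boundary_ball \<zeta> ((1 - cmod a) / 8))"
    using assms by (intro measure_W_doubling_power) auto
  also have "\<dots> \<le> D ^ 3 * carleson_mass \<omega> a"
    unfolding carleson_mass_eq[OF assms(3)] using subset_carleson_square[OF assms] D_pos carleson_square_borel[OF assms(3)]
    by (intro mult_left_mono W.finite_measure_mono) auto
  also have "2 ^ 3 * ((1 - cmod a) / 8) = 1 - cmod a"
    by simp
  finally show ?thesis .
qed

lemma measure_boundary_ball_pos:
  assumes "cmod \<zeta> = 1" "0 < t" "t \<le> 1"
  shows "0 < measure W (boundary_ball \<zeta> t)"
proof -
  have "0 < ennreal (t / (2 * pi)) * weight_tail w (1 - t / 2)"
    using assms tail_pos[of "1 - t / 2"] by (simp add: ennreal_zero_less_mult_iff)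
  also have "\<dots> \<le> ennreal (measure W (boundary_ball \<zeta> t))"
    using emeasure_W_boundary_ball_ge[OF assms] by (simp add: W.emeasure_eq_measure)
  finally show ?thesis by simp
qed

lemma carleson_mass_pos:
  assumes "cmod a < 1"
  shows "0 < carleson_mass \<omega> a"
proof -
  obtain \<zeta> where \<zeta>: "cmod \<zeta> = 1" "a = of_real (cmod a) * \<zeta>"
    using exists_direction by blast
  have "0 < D ^ 3 * carleson_mass \<omega> a"
    using carleson_mass_ge[OF \<zeta> assms] measure_boundary_ball_pos[OF \<zeta>(1), of "1 - cmod a"] assms by simp
  then show ?thesis
    using D_pos by (simp add: zero_less_mult_iff)
qed

end

section \<open>Test functions and the operator norm\<close>

lemma ennpowr_mono:
  assumes "x \<le> y" "0 \<le> s"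
  shows "ennpowr x s \<le> ennpowr y s"
proof (cases "y = \<infinity>")
  case False
  then have "x \<noteq> \<infinity>" "enn2real x \<le> enn2real y"
    using assms(1) by (auto simp: top_unique enn2real_mono top.not_eq_extremum)
  then show ?thesis
    using False assms(2) by (auto simp: ennpowr_def intro!: ennreal_leI powr_mono2)
qed (simp add: ennpowr_def)

lemma ennpowr_inverse:
  assumes "0 < q"
  shows "ennpowr (ennpowr x (1 / q)) q = x"
proof (cases "x = \<infinity>")
  case False
  then obtain r where "x = ennreal r" "0 \<le> r"
    by (cases x) auto
  then show ?thesis
    using assms by (simp add: ennpowr_def powr_powr)
qed (simp add: ennpowr_def)

lemma ennpowr_one [simp]: "ennpowr 1 s = 1"
  by (simp add: ennpowr_def)

context disc_weight
begin

section \<open>Modulus, holomorphy and norm of the test functions\<close>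

lemma norm_test_fun:
  assumes "cmod a < 1"
  shows "cmod (test_fun \<omega> a p \<gamma> z) =
    ((1 - (cmod a)\<^sup>2) / cmod (1 - cnj a * z)) powr ((\<gamma> + 1) / p) / carleson_mass \<omega> a powr (1 / p)"
proof -
  have "0 \<le> 1 - (cmod a)\<^sup>2"
    using assms by (simp add: power_le_one)
  then show ?thesis
    unfolding test_fun_def norm_mult norm_of_real
    by (subst norm_powr_real_powr') (simp_all add: norm_divide del: of_real_diff)
qed

lemma norm_test_fun_powr:
  assumes "cmod a < 1" "0 < p"
  shows "cmod (test_fun \<omega> a p \<gamma> z) powr q =
    ((1 - (cmod a)\<^sup>2) / cmod (1 - cnj a * z)) powr ((\<gamma> + 1) * (q / p)) / carleson_mass \<omega> a powr (q / p)"
proof -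
  have "(r powr ((\<gamma> + 1) / p) / carleson_mass \<omega> a powr (1 / p)) powr q
      = r powr ((\<gamma> + 1) * (q / p)) / carleson_mass \<omega> a powr (q / p)" for r
    using assms(2) by (simp add: powr_divide powr_powr)
  then show ?thesis
    unfolding norm_test_fun[OF assms(1)] .
qed

lemma Re_one_minus_pos:
  assumes "cmod a < 1" "cmod z < 1"
  shows "0 < Re (1 - cnj a * z)"
proof -
  have "cmod (cnj a * z) < 1"
    using assms mult_strict_mono'[of "cmod a" 1 "cmod z" 1] by (simp add: norm_mult)
  then show ?thesis
    using complex_Re_le_cmod[of "cnj a * z"] by simp
qed

lemma one_minus_nonzero:
  assumes "cmod a < 1" "cmod z < 1"
  shows "1 - cnj a * z \<noteq> 0"
proof
  assume "1 - cnj a * z = 0"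
  with Re_one_minus_pos[OF assms] show False
    by (simp only: zero_complex.simps less_irrefl)
qed

lemma holomorphic_test_fun:
  assumes a: "cmod a < 1"
  shows "test_fun \<omega> a p \<gamma> holomorphic_on unit_disc"
proof -
  have a2: "0 < 1 - (cmod a)\<^sup>2"
    using a by (simp add: power_less_one_iff)
  have "of_real (1 - (cmod a)\<^sup>2) / (1 - cnj a * z) \<notin> \<real>\<^sub>\<le>\<^sub>0" if z: "z \<in> unit_disc" for z
  proof
    assume *: "of_real (1 - (cmod a)\<^sup>2) / (1 - cnj a * z) \<in> \<real>\<^sub>\<le>\<^sub>0"
    have R: "0 < Re (1 - cnj a * z)"
      using Re_one_minus_pos[OF a] z by simp
    have "Re (of_real (1 - (cmod a)\<^sup>2) / (1 - cnj a * z)) = (1 - (cmod a)\<^sup>2) * Re (1 - cnj a * z) / (cmod (1 - cnj a * z))\<^sup>2"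
      by (simp only: Re_divide_of_real Re_complex_div_eq_0 Re_divide Re_complex_of_real Im_complex_of_real cmod_power2) simp
    also have "\<dots> > 0"
      using R a2 one_minus_nonzero[OF a, of z] z
      by (intro divide_pos_pos mult_pos_pos zero_less_power) (simp_all only: zero_less_norm_iff mem_ball_0 simp_thms)
    finally show False
      using * by (auto simp: complex_nonpos_Reals_iff)
  qed
  moreover have "1 - cnj a * z \<noteq> 0" if "z \<in> unit_disc" for z
    using one_minus_nonzero[OF a, of z] that by simp
  ultimately show ?thesis
    unfolding test_fun_def by (intro holomorphic_intros) auto
qed

text \<open>Put \<tau> = 1 - |a|. The numerator is at most 2 \<tau>. The denominator equals |\<zeta>
  - |a| z|, and |a| z is within \<tau> of z; since it is also at least \<tau>, it is at least half
  of |z - \<zeta>|.\<close>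

lemma test_ratio_le:
  assumes \<zeta>: "cmod \<zeta> = 1" "a = of_real (cmod a) * \<zeta>" and a: "cmod a < 1" and z: "cmod z < 1"
  shows "(1 - (cmod a)\<^sup>2) / cmod (1 - cnj a * z) \<le> 4 * min 1 ((1 - cmod a) / cmod (z - \<zeta>))"
proof -
  let ?\<tau> = "1 - cmod a"
  have "(1 - (cmod a)\<^sup>2) = ?\<tau> * (1 + cmod a)"
    by (simp add: power2_eq_square algebra_simps)
  also have "\<dots> \<le> ?\<tau> * 2"
    using a by (intro mult_left_mono) auto
  finally have num: "1 - (cmod a)\<^sup>2 \<le> 2 * ?\<tau>"
    by simp
  have "cmod (cnj a * z) \<le> cmod a * 1"
    using z unfolding norm_mult complex_mod_cnj by (intro mult_left_mono) auto
  then have den1: "?\<tau> \<le> cmod (1 - cnj a * z)"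
    using norm_triangle_ineq2[of 1 "cnj a * z"] by simp
  have "cmod (1 - cnj a * z) = cmod (\<zeta> * cnj \<zeta> - cnj a * z)"
    using complex_norm_square[of \<zeta>] \<zeta>(1) by simp
  also have "\<zeta> * cnj \<zeta> - cnj a * z = cnj \<zeta> * (\<zeta> - of_real (cmod a) * z)"
    using arg_cong[OF \<zeta>(2), of cnj] by (simp add: algebra_simps)
  also have "cmod \<dots> = cmod (\<zeta> - of_real (cmod a) * z)"
    using \<zeta>(1) by (simp add: norm_mult)
  finally have eq: "cmod (1 - cnj a * z) = cmod (\<zeta> - of_real (cmod a) * z)" .
  have "cmod (of_real (cmod a) * z - z) = cmod (of_real ?\<tau> * z)"
    by (subst norm_minus_commute) (simp add: algebra_simps)
  also have "\<dots> \<le> ?\<tau> * 1"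
    using a z unfolding norm_mult norm_of_real by (intro mult_mono) auto
  finally have "cmod (\<zeta> - z) \<le> cmod (1 - cnj a * z) + ?\<tau>"
    unfolding eq using norm_triangle_ineq[of "\<zeta> - of_real (cmod a) * z" "of_real (cmod a) * z - z"] by simp
  then have den2: "cmod (z - \<zeta>) \<le> 2 * cmod (1 - cnj a * z)"
    using den1 by (simp add: norm_minus_commute)
  have pos: "0 < cmod (z - \<zeta>)" "0 < cmod (1 - cnj a * z)"
    using z \<zeta>(1) den1 a by auto
  have "(1 - (cmod a)\<^sup>2) / cmod (1 - cnj a * z) \<le> 2 * ?\<tau> / cmod (1 - cnj a * z)"
    using num pos by (intro divide_right_mono) auto
  also have "\<dots> \<le> 4 * min 1 (?\<tau> / cmod (z - \<zeta>))"
  proof -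
    have "2 * ?\<tau> / cmod (1 - cnj a * z) \<le> 4 * 1"
      using den1 pos a by (simp add: divide_le_eq)
    moreover have "2 * ?\<tau> / cmod (1 - cnj a * z) \<le> 4 * (?\<tau> / cmod (z - \<zeta>))"
    proof -
      have "?\<tau> * cmod (z - \<zeta>) \<le> ?\<tau> * (2 * cmod (1 - cnj a * z))"
        using den2 a by (intro mult_left_mono) auto
      moreover have "2 * s / x \<le> 4 * (s / y)" if "s * y \<le> s * (2 * x)" "0 < x" "0 < y" for s x y :: real
        using that by (simp add: divide_simps mult_ac)
      ultimately show ?thesis
        using pos by blast
    qed
    ultimately show ?thesis
      by (simp add: min_def)
  qed
  finally show ?thesis .
qed

text \<open>The three factors come from the bound 4 in \<open>test_ratio_le\<close>, the dyadic
  summation with \<beta> = \<gamma> + 1, and the comparison of the boundary ball with the Carleson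
  square.\<close>

definition test_const :: "real \<Rightarrow> real" where
  "test_const \<gamma> = 4 powr (\<gamma> + 1) * (2 * 2 powr (\<gamma> + 1)) * D ^ 3"

lemma test_const_pos: "0 < test_const \<gamma>"
  using D_pos by (simp add: test_const_def)

text \<open>The p-th power decays with exponent \<gamma> + 1 whatever p is, so the dyadic sum
  applies with h = 1 and L = 1. Its growth condition on \<beta> is the origin of the threshold for
  \<gamma>.\<close>

lemma test_fun_integral_le:
  assumes a: "cmod a < 1" and p: "0 < p" and \<gamma>: "0 < \<gamma>" "2 * D \<le> 2 powr (\<gamma> + 1)"
  shows "(\<integral>\<^sup>+z\<in>unit_disc. ennreal (cmod (test_fun \<omega> a p \<gamma> z) powr p) \<partial>W) \<le> ennreal (test_const \<gamma>)"
proof -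
  obtain \<zeta> where \<zeta>: "cmod \<zeta> = 1" "a = of_real (cmod a) * \<zeta>"
    using exists_direction by blast
  let ?m = "carleson_mass \<omega> a" and ?\<tau> = "1 - cmod a"
  have m: "0 < ?m"
    using carleson_mass_pos[OF a] .
  let ?\<kappa> = "\<lambda>z. min 1 (?\<tau> / cmod (z - \<zeta>)) powr (\<gamma> + 1)"
  have "(\<integral>\<^sup>+z\<in>unit_disc. ennreal (cmod (test_fun \<omega> a p \<gamma> z) powr p) \<partial>W)
      \<le> (\<integral>\<^sup>+z. ennreal (4 powr (\<gamma> + 1) / ?m) * (1 * ennreal (?\<kappa> z) * indicator unit_disc z) \<partial>W)"
  proof (intro nn_integral_mono)
    fix z
    have "cmod (test_fun \<omega> a p \<gamma> z) powr p \<le> 4 powr (\<gamma> + 1) / ?m * ?\<kappa> z" if z: "cmod z < 1"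
    proof -
      have "((1 - (cmod a)\<^sup>2) / cmod (1 - cnj a * z)) powr (\<gamma> + 1) \<le> (4 * min 1 (?\<tau> / cmod (z - \<zeta>))) powr (\<gamma> + 1)"
        using a \<gamma> by (intro powr_mono2 test_ratio_le[OF \<zeta> a z]) (auto simp: power_le_one)
      also have "\<dots> = 4 powr (\<gamma> + 1) * ?\<kappa> z"
        using a by (intro powr_mult) 
      finally show ?thesis
        using p m by (simp add: norm_test_fun_powr[OF a p] divide_right_mono)
    qed
    then show "ennreal (cmod (test_fun \<omega> a p \<gamma> z) powr p) * indicator unit_disc z
        \<le> ennreal (4 powr (\<gamma> + 1) / ?m) * (1 * ennreal (?\<kappa> z) * indicator unit_disc z)"
      using m by (auto simp: ennreal_mult[symmetric] intro!: ennreal_leI split: split_indicator)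
  qed
  also have "\<dots> = ennreal (4 powr (\<gamma> + 1) / ?m) * (\<integral>\<^sup>+z\<in>unit_disc. 1 * ennreal (?\<kappa> z) \<partial>W)"
    by (rule nn_integral_cmult) measurable
  also have "\<dots> \<le> ennreal (4 powr (\<gamma> + 1) / ?m) *
      (ennreal (2 * 2 powr (\<gamma> + 1)) * 1 * emeasure W (boundary_ball \<zeta> ?\<tau>))"
    using a \<gamma> \<zeta> order_trans[OF _ norm_ge_zero[of a], of "- 1"]
    by (intro mult_left_mono decay_integral_le) auto
  also have "\<dots> \<le> ennreal (4 powr (\<gamma> + 1) / ?m) * (ennreal (2 * 2 powr (\<gamma> + 1)) * 1 * ennreal (D ^ 3 * ?m))"
    using carleson_mass_ge[OF \<zeta> a] by (intro mult_left_mono) (auto simp: W.emeasure_eq_measure intro: ennreal_leI)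
  also have "\<dots> = ennreal (test_const \<gamma>)"
    using m D_pos by (simp add: ennreal_mult[symmetric] test_const_def)
  finally show ?thesis .
qed

lemma bergman_norm_eq:
  assumes "f holomorphic_on unit_disc"
  shows "bergman_norm \<omega> p f = ennpowr (\<integral>\<^sup>+z\<in>unit_disc. ennreal (cmod (f z) powr p) \<partial>W) (1 / p)"
  unfolding bergman_norm_def
  using nn_integral_weight[OF borel_measurable_disc_powr[OF assms, of p]] by simp

lemma bergman_norm_le_one_iff:
  assumes "f holomorphic_on unit_disc" "0 < p"
  shows "bergman_norm \<omega> p f \<le> 1 \<longleftrightarrow> (\<integral>\<^sup>+z\<in>unit_disc. ennreal (cmod (f z) powr p) \<partial>W) \<le> 1"
proof -
  let ?I = "\<integral>\<^sup>+z\<in>unit_disc. ennreal (cmod (f z) powr p) \<partial>W"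
  have "?I \<le> 1" if "ennpowr ?I (1 / p) \<le> 1"
    using ennpowr_mono[OF that, of p] assms(2) by (simp add: ennpowr_inverse)
  moreover have "ennpowr ?I (1 / p) \<le> 1" if "?I \<le> 1"
    using ennpowr_mono[OF that, of "1 / p"] assms(2) by simp
  ultimately show ?thesis
    unfolding bergman_norm_eq[OF assms(1)] by blast
qed

section \<open>The operator and the test integrals for fixed u, \<phi> and \<mu>\<close>

context
  fixes u \<phi> :: "complex \<Rightarrow> complex" and \<mu> :: "complex measure" and p q :: real
  assumes u: "u \<in> borel_measurable (restrict_space borel unit_disc)"
    and \<phi>: "\<phi> holomorphic_on unit_disc" "\<phi> ` unit_disc \<subseteq> unit_disc"
    and \<mu>: "sets \<mu> = sets (restrict_space borel unit_disc)"
    and p: "0 < p" and pq: "p \<le> q"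
begin

lemma space_\<mu>: "space \<mu> = unit_disc"
  using sets_eq_imp_space_eq[OF \<mu>] by (simp add: space_restrict_space)

lemma \<phi>_in_disc: "z \<in> space \<mu> \<Longrightarrow> cmod (\<phi> z) < 1"
  using \<phi>(2) by (auto simp: space_\<mu> image_subset_iff)

lemma measurable_\<mu>: "h \<in> borel_measurable \<mu> \<longleftrightarrow> h \<in> borel_measurable (restrict_space borel unit_disc)"
  by (simp cong: measurable_cong_sets add: \<mu>)

lemma u_measurable [measurable]: "u \<in> borel_measurable \<mu>"
  using u by (simp add: measurable_\<mu>)

lemma \<phi>_measurable [measurable]: "\<phi> \<in> borel_measurable \<mu>"
  unfolding measurable_\<mu>
  by (intro borel_measurable_continuous_on_restrict holomorphic_on_imp_continuous_on \<phi>)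

lemma holomorphic_comp_measurable:
  assumes "f holomorphic_on unit_disc"
  shows "(\<lambda>z. f (\<phi> z)) \<in> borel_measurable \<mu>"
  unfolding measurable_\<mu>
  using holomorphic_on_imp_continuous_on[OF holomorphic_on_compose_gen[OF \<phi>(1) assms \<phi>(2)]]
  by (intro borel_measurable_continuous_on_restrict) (simp add: o_def)

definition "comp_norm = ennpowr (op_norm (bergman_space \<omega> p) (bergman_norm \<omega> p) (Lq_norm \<mu> q) (weighted_comp u \<phi>)) q"

definition "test_integral \<gamma> a = (\<integral>\<^sup>+z. ennreal (cmod (test_fun \<omega> a p \<gamma> (\<phi> z)) powr q * cmod (u z) powr q) \<partial>\<mu>)"

lemma integral_le_comp_norm:
  assumes f: "f holomorphic_on unit_disc"
    and le: "(\<integral>\<^sup>+z\<in>unit_disc. ennreal (cmod (f z) powr p) \<partial>W) \<le> 1"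
  shows "(\<integral>\<^sup>+z. ennreal (cmod (u z * f (\<phi> z)) powr q) \<partial>\<mu>) \<le> comp_norm"
proof -
  let ?I = "\<integral>\<^sup>+z. ennreal (cmod (u z * f (\<phi> z)) powr q) \<partial>\<mu>"
  have n: "bergman_norm \<omega> p f \<le> 1"
    using le bergman_norm_le_one_iff[OF f p] by simp
  then have "bergman_norm \<omega> p f < \<infinity>"
    by (rule order.strict_trans1) simp
  then have "f \<in> {f \<in> bergman_space \<omega> p. bergman_norm \<omega> p f \<le> 1}"
    using f n by (simp add: bergman_space_def)
  then have "Lq_norm \<mu> q (weighted_comp u \<phi> f) \<le> op_norm (bergman_space \<omega> p) (bergman_norm \<omega> p) (Lq_norm \<mu> q) (weighted_comp u \<phi>)"
    unfolding op_norm_def by (rule SUP_upper)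
  then have "ennpowr (ennpowr ?I (1 / q)) q \<le> comp_norm"
    unfolding comp_norm_def using p pq by (intro ennpowr_mono) (auto simp: Lq_norm_def weighted_comp_def)
  then show ?thesis
    using p pq by (simp add: ennpowr_inverse)
qed

lemma comp_norm_le:
  assumes "\<And>f. f holomorphic_on unit_disc \<Longrightarrow> (\<integral>\<^sup>+z\<in>unit_disc. ennreal (cmod (f z) powr p) \<partial>W) \<le> 1 \<Longrightarrow>
    (\<integral>\<^sup>+z. ennreal (cmod (u z * f (\<phi> z)) powr q) \<partial>\<mu>) \<le> X"
  shows "comp_norm \<le> X"
proof -
  have "op_norm (bergman_space \<omega> p) (bergman_norm \<omega> p) (Lq_norm \<mu> q) (weighted_comp u \<phi>) \<le> ennpowr X (1 / q)"
    unfolding op_norm_def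
  proof (rule SUP_least)
    fix f assume f: "f \<in> {f \<in> bergman_space \<omega> p. bergman_norm \<omega> p f \<le> 1}"
    then have "f holomorphic_on unit_disc"
      by (simp add: bergman_space_def)
    then show "Lq_norm \<mu> q (weighted_comp u \<phi> f) \<le> ennpowr X (1 / q)"
      unfolding Lq_norm_def weighted_comp_def using f p pq
      by (intro ennpowr_mono assms) (auto simp: bergman_norm_le_one_iff)
  qed
  then have "comp_norm \<le> ennpowr (ennpowr X (1 / q)) q"
    unfolding comp_norm_def using p pq by (intro ennpowr_mono) auto
  then show ?thesis
    using p pq by (simp add: ennpowr_inverse)
qed

text \<open>Scaling by K powr (- (1 / p)), where K is \<open>test_const \<gamma>\<close>, puts the
  test function into the unit ball of the Bergman space; undoing the scaling in the q-th power costs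
  K powr (q / p).\<close>

lemma test_integral_le_comp_norm:
  assumes a: "a \<in> unit_disc" and \<gamma>: "0 < \<gamma>" "2 * D \<le> 2 powr (\<gamma> + 1)"
  shows "test_integral \<gamma> a \<le> ennreal (test_const \<gamma> powr (q / p)) * comp_norm"
proof -
  let ?F = "test_fun \<omega> a p \<gamma>" and ?K = "test_const \<gamma>"
  have K: "0 < ?K"
    by (rule test_const_pos)
  have F: "?F holomorphic_on unit_disc"
    using a by (intro holomorphic_test_fun) simp
  define f where "f z = of_real (?K powr (- (1 / p))) * ?F z" for z
  have f: "f holomorphic_on unit_disc"
    unfolding f_def by (intro holomorphic_intros F)
  have fpow: "cmod (f z) powr s = ?K powr (- (s / p)) * cmod (?F z) powr s" for z s
    by (simp add: f_def norm_mult powr_mult powr_powr)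
  have "(\<integral>\<^sup>+z\<in>unit_disc. ennreal (cmod (f z) powr p) \<partial>W)
      = (\<integral>\<^sup>+z. ennreal (?K powr (- 1)) * (ennreal (cmod (?F z) powr p) * indicator unit_disc z) \<partial>W)"
    using p by (intro nn_integral_cong) (auto simp: fpow ennreal_mult[symmetric] split: split_indicator)
  also have "\<dots> = ennreal (?K powr (- 1)) * (\<integral>\<^sup>+z\<in>unit_disc. ennreal (cmod (?F z) powr p) \<partial>W)"
    using borel_measurable_disc_powr[OF F] by (intro nn_integral_cmult) simp
  also have "\<dots> \<le> ennreal (?K powr (- 1)) * ennreal ?K"
    using a p \<gamma> by (intro mult_left_mono test_fun_integral_le) auto
  also have "\<dots> = 1"
    using K by (simp add: ennreal_mult[symmetric] powr_minus)
  finally have "(\<integral>\<^sup>+z. ennreal (cmod (u z * f (\<phi> z)) powr q) \<partial>\<mu>) \<le> comp_norm"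
    by (rule integral_le_comp_norm[OF f])
  then have le: "ennreal (?K powr (q / p)) * (\<integral>\<^sup>+z. ennreal (cmod (u z * f (\<phi> z)) powr q) \<partial>\<mu>)
      \<le> ennreal (?K powr (q / p)) * comp_norm"
    by (rule mult_left_mono) simp
  have [measurable]: "(\<lambda>z. f (\<phi> z)) \<in> borel_measurable \<mu>"
    using f by (rule holomorphic_comp_measurable)
  have "test_integral \<gamma> a = (\<integral>\<^sup>+z. ennreal (?K powr (q / p)) * ennreal (cmod (u z * f (\<phi> z)) powr q) \<partial>\<mu>)"
    unfolding test_integral_def
  proof (intro nn_integral_cong)
    fix z
    have "?K powr (q / p) * ?K powr (- (q / p)) = 1"
      using K by (simp flip: powr_add)
    then have "cmod (?F (\<phi> z)) powr q * cmod (u z) powr q = ?K powr (q / p) * cmod (u z * f (\<phi> z)) powr q"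
      by (simp add: norm_mult powr_mult fpow)
    then show "ennreal (cmod (?F (\<phi> z)) powr q * cmod (u z) powr q)
        = ennreal (?K powr (q / p)) * ennreal (cmod (u z * f (\<phi> z)) powr q)"
      by (simp add: ennreal_mult)
  qed
  also have "\<dots> = ennreal (?K powr (q / p)) * (\<integral>\<^sup>+z. ennreal (cmod (u z * f (\<phi> z)) powr q) \<partial>\<mu>)"
    by (rule nn_integral_cmult) measurable
  also note le
  finally show ?thesis .
qed

text \<open>Turns the weighted composition operator into an embedding: the q-th power integral of u
  (f o \<phi>) against \<mu> is that of f against this measure. It lives on the Borel sets of the
  plane but charges only the disc.\<close>

definition "pushforward = distr (density \<mu> (\<lambda>z. ennreal (cmod (u z) powr q))) borel \<phi>"

lemma nn_integral_push:
  assumes [measurable]: "h \<in> borel_measurable borel"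
  shows "(\<integral>\<^sup>+z. h z \<partial>pushforward) = (\<integral>\<^sup>+z. ennreal (cmod (u z) powr q) * h (\<phi> z) \<partial>\<mu>)"
  unfolding pushforward_def by (subst nn_integral_distr) (auto simp: nn_integral_density)

text \<open>Chebyshev's inequality for the test function on S.\<close>

lemma test_integral_ge:
  assumes a: "cmod a < 1" and S[measurable]: "S \<in> sets borel"
    and c: "\<And>z. z \<in> S \<Longrightarrow> cmod z < 1 \<Longrightarrow> c \<le> cmod (test_fun \<omega> a p \<gamma> z) powr q" "0 < c"
  shows "emeasure pushforward S \<le> ennreal (1 / c) * test_integral \<gamma> a"
proof -
  have F: "test_fun \<omega> a p \<gamma> holomorphic_on unit_disc"
    using a by (rule holomorphic_test_fun)
  have [measurable]: "(\<lambda>z. test_fun \<omega> a p \<gamma> (\<phi> z)) \<in> borel_measurable \<mu>"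
    using F by (rule holomorphic_comp_measurable)
  have "emeasure pushforward S = (\<integral>\<^sup>+z. indicator S z \<partial>pushforward)"
    by (simp add: pushforward_def)
  also have "\<dots> = (\<integral>\<^sup>+z. ennreal (cmod (u z) powr q) * indicator S (\<phi> z) \<partial>\<mu>)"
    by (rule nn_integral_push) simp
  also have "\<dots> \<le> (\<integral>\<^sup>+z. ennreal (1 / c) * ennreal (cmod (test_fun \<omega> a p \<gamma> (\<phi> z)) powr q * cmod (u z) powr q) \<partial>\<mu>)"
  proof (intro nn_integral_mono)
    fix z assume "z \<in> space \<mu>"
    then have z: "cmod (\<phi> z) < 1"
      by (rule \<phi>_in_disc)
    show "ennreal (cmod (u z) powr q) * indicator S (\<phi> z) \<le>
        ennreal (1 / c) * ennreal (cmod (test_fun \<omega> a p \<gamma> (\<phi> z)) powr q * cmod (u z) powr q)"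
    proof (cases "\<phi> z \<in> S")
      case True
      have "c * cmod (u z) powr q \<le> cmod (test_fun \<omega> a p \<gamma> (\<phi> z)) powr q * cmod (u z) powr q"
        using c(1)[OF True z] by (rule mult_right_mono) simp
      then have "cmod (u z) powr q \<le> 1 / c * (cmod (test_fun \<omega> a p \<gamma> (\<phi> z)) powr q * cmod (u z) powr q)"
        using c(2) by (simp add: field_simps)
      then show ?thesis
        using True c(2) by (simp add: ennreal_mult[symmetric] ennreal_leI)
    qed simp
  qed
  also have "\<dots> = ennreal (1 / c) * test_integral \<gamma> a"
    unfolding test_integral_def by (rule nn_integral_cmult) measurable
  finally show ?thesis .
qed

text \<open>The first factor comes from the lower bound 1 / 2 for the base of the test function on
  the ball, the second from bounding the mass of the Carleson square by that of the ball.\<close>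

definition carleson_const :: "real \<Rightarrow> real" where
  "carleson_const \<gamma> = 2 powr ((\<gamma> + 1) * (q / p)) * D powr (q / p)"

text \<open>The test function belonging to a = (1 - t) \<zeta> is large on the whole ball: there |1
  - cnj a * z| \<le> 2 t, while 1 - |a|^2 \<ge> t. For t > 1 the choice a = 0 gives a constant test
  function, which explains the truncation \<open>t'\<close>.\<close>

lemma push_carleson:
  assumes \<gamma>: "0 < \<gamma>" and b: "\<And>a. cmod a < 1 \<Longrightarrow> test_integral \<gamma> a \<le> ennreal b" "0 \<le> b"
    and \<zeta>: "cmod \<zeta> = 1" and t: "0 < t"
  shows "emeasure pushforward (boundary_ball \<zeta> t) \<le> ennreal (carleson_const \<gamma> * b * measure W (boundary_ball \<zeta> t) powr (q / p))"
proof -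
  define t' where "t' = min t 1"
  have t': "0 < t'" "t' \<le> 1" "t' \<le> t"
    using t by (auto simp: t'_def)
  define a where "a = of_real (1 - t') * \<zeta>"
  have na: "cmod a = 1 - t'"
    using t' \<zeta> by (simp add: a_def norm_mult del: of_real_diff)
  have a: "cmod a < 1" "a = of_real (cmod a) * \<zeta>"
  proof -
    show "cmod a < 1"
      using t' na by simp
    show "a = of_real (cmod a) * \<zeta>"
      unfolding na by (rule a_def)
  qed
  let ?m = "carleson_mass \<omega> a"
  have m: "0 < ?m"
    using carleson_mass_pos[OF a(1)] .
  define c where "c = (1 / 2) powr ((\<gamma> + 1) * (q / p)) / ?m powr (q / p)"
  have c: "0 < c"
    using m by (simp add: c_def)
  have "emeasure pushforward (boundary_ball \<zeta> t) \<le> ennreal (1 / c) * test_integral \<gamma> a"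
  proof (rule test_integral_ge[OF a(1) boundary_ball_borel _ c])
    fix z assume z: "z \<in> boundary_ball \<zeta> t" "cmod z < 1"
    have "1 / 2 \<le> (1 - (cmod a)\<^sup>2) / cmod (1 - cnj a * z)"
    proof (cases "t \<le> 1")
      case True
      then have tt: "t' = t" by (simp add: t'_def)
      have "1 - cnj a * z = (1 - cnj \<zeta> * z) + of_real t * (cnj \<zeta> * z)"
        by (simp add: a_def tt algebra_simps)
      moreover have "1 - cnj \<zeta> * z = cnj \<zeta> * (\<zeta> - z)"
        using complex_norm_square[of \<zeta>] \<zeta> by (simp add: algebra_simps)
      ultimately have "cmod (1 - cnj a * z) \<le> cmod (cnj \<zeta> * (\<zeta> - z)) + cmod (of_real t * (cnj \<zeta> * z))"
        using norm_triangle_ineq by metis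
      also have "\<dots> \<le> t + t * 1"
        using z t \<zeta> by (intro add_mono) (auto simp: norm_mult boundary_ball_def dist_norm)
      finally have le: "cmod (1 - cnj a * z) \<le> 2 * t"
        by simp
      have pos: "0 < cmod (1 - cnj a * z)"
        using one_minus_nonzero[OF a(1) z(2)] by simp
      have "1 - (cmod a)\<^sup>2 = t + t * (1 - t)"
        by (simp add: na tt power2_eq_square algebra_simps)
      moreover have "0 \<le> t * (1 - t)"
        using t True by simp
      ultimately have "t \<le> 1 - (cmod a)\<^sup>2"
        by linarith
      then show ?thesis
        using le pos by (simp add: le_divide_eq)
    next
      case False
      then have "a = 0" by (simp add: a_def t'_def)
      then show ?thesis by simp
    qed
    then have "(1 / 2) powr ((\<gamma> + 1) * (q / p)) \<le> ((1 - (cmod a)\<^sup>2) / cmod (1 - cnj a * z)) powr ((\<gamma> + 1) * (q / p))"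
      using \<gamma> p pq by (intro powr_mono2) auto
    then show "c \<le> cmod (test_fun \<omega> a p \<gamma> z) powr q"
      unfolding norm_test_fun_powr[OF a(1) p] c_def using m by (intro divide_right_mono) auto
  qed
  also have "\<dots> \<le> ennreal (1 / c) * ennreal b"
    by (intro mult_left_mono b a) simp
  also have "\<dots> = ennreal (2 powr ((\<gamma> + 1) * (q / p)) * ?m powr (q / p) * b)"
    using c b(2) by (simp add: ennreal_mult[symmetric] c_def powr_divide)
  also have "\<dots> \<le> ennreal (carleson_const \<gamma> * b * measure W (boundary_ball \<zeta> t) powr (q / p))"
  proof (rule ennreal_leI)
    have "?m \<le> D * measure W (boundary_ball \<zeta> t')"
      using carleson_mass_le[OF \<zeta> a(2,1)] by (simp add: na)
    also have "\<dots> \<le> D * measure W (boundary_ball \<zeta> t)"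
      using D_pos boundary_ball_mono[OF t'(3)] by (intro mult_left_mono W.finite_measure_mono) auto
    finally have "?m powr (q / p) \<le> (D * measure W (boundary_ball \<zeta> t)) powr (q / p)"
      using m p pq by (intro powr_mono2) auto
    also have "\<dots> = D powr (q / p) * measure W (boundary_ball \<zeta> t) powr (q / p)"
      using D_pos by (intro powr_mult) 
    finally have "2 powr ((\<gamma> + 1) * (q / p)) * b * ?m powr (q / p) \<le>
        2 powr ((\<gamma> + 1) * (q / p)) * b * (D powr (q / p) * measure W (boundary_ball \<zeta> t) powr (q / p))"
      using b(2) by (intro mult_left_mono) auto
    then show "2 powr ((\<gamma> + 1) * (q / p)) * ?m powr (q / p) * b
        \<le> carleson_const \<gamma> * b * measure W (boundary_ball \<zeta> t) powr (q / p)"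
      by (simp add: carleson_const_def mult_ac)
  qed
  finally show ?thesis .
qed

lemma comp_norm_le_test_integrals:
  assumes \<gamma>: "0 < \<gamma>" and b: "\<And>a. cmod a < 1 \<Longrightarrow> test_integral \<gamma> a \<le> ennreal b" "0 \<le> b"
    and m: "D \<le> 2 ^ m"
  shows "comp_norm \<le> ennreal (embed_const m (q / p) * carleson_const \<gamma> * b)"
proof (rule comp_norm_le)
  fix f assume f: "f holomorphic_on unit_disc" "(\<integral>\<^sup>+z\<in>unit_disc. ennreal (cmod (f z) powr p) \<partial>W) \<le> 1"
  have cc: "0 \<le> carleson_const \<gamma>"
    by (simp add: carleson_const_def)
  have sets_push: "sets pushforward = sets borel" and space_push: "space pushforward = UNIV"
    by (simp_all add: pushforward_def)
  \<comment> \<open>No finiteness of \<mu> is assumed. It is the Carleson condition on the ball of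
    radius 2, the whole disc, that makes the pushforward finite and Tonelli's theorem
    available.\<close>
  have "emeasure pushforward UNIV = emeasure pushforward (boundary_ball 1 2)"
  proof -
    have "emeasure pushforward UNIV = (\<integral>\<^sup>+z. indicator UNIV z \<partial>pushforward)"
      by (simp add: sets_push space_push)
    also have "\<dots> = (\<integral>\<^sup>+z. ennreal (cmod (u z) powr q) * indicator UNIV (\<phi> z) \<partial>\<mu>)"
      by (rule nn_integral_push) simp
    also have "\<dots> = (\<integral>\<^sup>+z. ennreal (cmod (u z) powr q) * indicator (boundary_ball 1 2) (\<phi> z) \<partial>\<mu>)"
      by (intro nn_integral_cong) (simp add: boundary_ball_eq_disc \<phi>_in_disc)
    also have "\<dots> = (\<integral>\<^sup>+z. indicator (boundary_ball 1 2) z \<partial>pushforward)"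
      by (rule nn_integral_push[symmetric]) simp
    finally show ?thesis by (simp add: sets_push space_push)
  qed
  also have "\<dots> < \<infinity>"
    using push_carleson[OF \<gamma> b, of 1 2] by (auto intro: order.strict_trans1)
  finally have "finite_measure pushforward"
    by (intro finite_measureI) (simp add: space_push)
  then have sf: "sigma_finite_measure pushforward"
    by (rule finite_measure.axioms(1))
  have [measurable]: "(\<lambda>z. ennreal (cmod (f z) powr q) * indicator unit_disc z) \<in> borel_measurable borel"
    using f(1) by (rule borel_measurable_disc_powr)
  have "(\<integral>\<^sup>+z. ennreal (cmod (u z * f (\<phi> z)) powr q) \<partial>\<mu>)
      = (\<integral>\<^sup>+z. ennreal (cmod (u z) powr q) * (ennreal (cmod (f (\<phi> z)) powr q) * indicator unit_disc (\<phi> z)) \<partial>\<mu>)"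
    by (intro nn_integral_cong) (simp add: \<phi>_in_disc norm_mult powr_mult ennreal_mult)
  also have "\<dots> = (\<integral>\<^sup>+z\<in>unit_disc. ennreal (cmod (f z) powr q) \<partial>pushforward)"
    by (rule nn_integral_push[symmetric]) measurable
  also have "\<dots> \<le> ennreal (embed_const m (q / p) * (carleson_const \<gamma> * b))"
    using cc b(2) by (intro carleson_embedding[OF f(1) p pq f(2) _ sets_push sf _ m] push_carleson[OF \<gamma> b]) auto
  finally show "(\<integral>\<^sup>+z. ennreal (cmod (u z * f (\<phi> z)) powr q) \<partial>\<mu>) \<le> ennreal (embed_const m (q / p) * carleson_const \<gamma> * b)"
    by (simp add: mult.assoc)
qed

end

end

section \<open>The two inequalities combined, with constants uniform in u, \<phi> and \<mu>\<close>

theorem theorem1: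
  fixes \<omega> :: "complex \<Rightarrow> real" and p q :: real
  assumes "\<omega> \<in> D_hat" and "0 < p" and "p \<le> q"
  shows "\<exists>\<gamma>\<^sub>0>0. \<forall>\<gamma>>\<gamma>\<^sub>0. \<exists>C>0.
    \<forall>(u :: complex \<Rightarrow> complex) (\<phi> :: complex \<Rightarrow> complex) (\<mu> :: complex measure).
      u \<in> borel_measurable (restrict_space borel unit_disc) \<longrightarrow>
      \<phi> holomorphic_on unit_disc \<longrightarrow>
      \<phi> ` unit_disc \<subseteq> unit_disc \<longrightarrow>
      sets \<mu> = sets (restrict_space borel unit_disc) \<longrightarrow>
      (let A = ennpowr (op_norm (bergman_space \<omega> p) (bergman_norm \<omega> p) (Lq_norm \<mu> q)
                 (weighted_comp u \<phi>)) q;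
           B = (SUP a\<in>unit_disc. \<integral>\<^sup>+z. ennreal (cmod (test_fun \<omega> a p \<gamma> (\<phi> z)) powr q
                  * cmod (u z) powr q) \<partial>\<mu>)
       in ennreal (1 / C) * B \<le> A \<and> A \<le> ennreal C * B)"
proof -
  obtain w C0 where "disc_weight w C0 \<omega>"
    using D_hat_disc_weight[OF assms(1)] .
  then interpret disc_weight w C0 \<omega> .
  obtain m where m: "D \<le> 2 ^ m"
    using real_arch_pow[of 2 D] by (auto intro: less_imp_le)
  define K where "K \<gamma> = max (test_const \<gamma> powr (q / p)) (embed_const m (q / p) * carleson_const p q \<gamma>)" for \<gamma>
  have K: "0 < K \<gamma>" for \<gamma>
    using test_const_pos[of \<gamma>] by (simp add: K_def less_max_iff_disj)
  show ?thesis
  \<comment> \<open>The logarithm is the decay condition 2 D \<le> 2 powr (\<gamma> + 1) in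
    disguise, and the 1 keeps the threshold positive. \<open>D\<close> depends on the weight alone;
    p and q enter through \<open>K\<close>.\<close>
  proof (rule exI[of _ "max 1 (log 2 D)"], intro conjI allI impI)
    fix \<gamma> assume \<gamma>: "max 1 (log 2 D) < \<gamma>"
    have \<gamma>0: "0 < \<gamma>"
      using \<gamma> by simp
    have "D \<le> 2 powr \<gamma>"
      using \<gamma> D_pos by (simp flip: log_le_iff)
    then have \<gamma>D: "2 * D \<le> 2 powr (\<gamma> + 1)"
      by (simp add: powr_add)
    show "\<exists>C>0. \<forall>(u :: complex \<Rightarrow> complex) (\<phi> :: complex \<Rightarrow> complex) (\<mu> :: complex measure).
      u \<in> borel_measurable (restrict_space borel unit_disc) \<longrightarrow>
      \<phi> holomorphic_on unit_disc \<longrightarrow>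
      \<phi> ` unit_disc \<subseteq> unit_disc \<longrightarrow>
      sets \<mu> = sets (restrict_space borel unit_disc) \<longrightarrow>
      (let A = ennpowr (op_norm (bergman_space \<omega> p) (bergman_norm \<omega> p) (Lq_norm \<mu> q)
                 (weighted_comp u \<phi>)) q;
           B = (SUP a\<in>unit_disc. \<integral>\<^sup>+z. ennreal (cmod (test_fun \<omega> a p \<gamma> (\<phi> z)) powr q
                  * cmod (u z) powr q) \<partial>\<mu>)
       in ennreal (1 / C) * B \<le> A \<and> A \<le> ennreal C * B)"
    proof (rule exI[of _ "K \<gamma>"], intro conjI K allI impI)
      fix u \<phi> :: "complex \<Rightarrow> complex" and \<mu> :: "complex measure"
      assume hyps: "u \<in> borel_measurable (restrict_space borel unit_disc)" "\<phi> holomorphic_on unit_disc"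
        "\<phi> ` unit_disc \<subseteq> unit_disc" "sets \<mu> = sets (restrict_space borel unit_disc)"
      note ctx = hyps assms(2,3)
      define A where "A = comp_norm u \<phi> \<mu> p q"
      define B where "B = (SUP a\<in>unit_disc. test_integral u \<phi> \<mu> p q \<gamma> a)"
      have "B \<le> ennreal (K \<gamma>) * A"
        unfolding B_def
      proof (rule SUP_least)
        fix a :: complex assume "a \<in> unit_disc"
        then have "test_integral u \<phi> \<mu> p q \<gamma> a \<le> ennreal (test_const \<gamma> powr (q / p)) * A"
          unfolding A_def by (intro test_integral_le_comp_norm[OF ctx _ \<gamma>0 \<gamma>D])
        also have "\<dots> \<le> ennreal (K \<gamma>) * A"
          by (intro mult_right_mono ennreal_leI) (auto simp: K_def)
        finally show "test_integral u \<phi> \<mu> p q \<gamma> a \<le> ennreal (K \<gamma>) * A" .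
      qed
      then have "ennreal (1 / K \<gamma>) * B \<le> ennreal (1 / K \<gamma>) * (ennreal (K \<gamma>) * A)"
        by (rule mult_left_mono) simp
      also have "\<dots> = A"
        using K[of \<gamma>] by (simp add: mult.assoc[symmetric] ennreal_mult[symmetric])
      finally have lower: "ennreal (1 / K \<gamma>) * B \<le> A" .
      have upper: "A \<le> ennreal (K \<gamma>) * B"
      \<comment> \<open>A real Carleson constant b exists only for a finite supremum; otherwise the
        right-hand side is infinite because \<open>K \<gamma>\<close> is positive.\<close>
      proof (cases "B = \<infinity>")
        case True
        then show ?thesis
          using K[of \<gamma>] by (simp add: ennreal_mult_top)
      next
        case False
        then obtain b where b: "B = ennreal b" "0 \<le> b"
          by (cases B) auto
        have "test_integral u \<phi> \<mu> p q \<gamma> a \<le> ennreal b" if "cmod a < 1" for a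
          unfolding b(1)[symmetric] B_def using that by (intro SUP_upper) simp
        then have "A \<le> ennreal (embed_const m (q / p) * carleson_const p q \<gamma> * b)"
          unfolding A_def by (intro comp_norm_le_test_integrals[OF ctx \<gamma>0 _ b(2) m])
        also have "\<dots> \<le> ennreal (K \<gamma> * b)"
          using b(2) by (intro ennreal_leI mult_right_mono) (auto simp: K_def)
        also have "\<dots> = ennreal (K \<gamma>) * B"
          using K[of \<gamma>] b by (simp add: ennreal_mult)
        finally show ?thesis .
      qed
      show "let A = ennpowr (op_norm (bergman_space \<omega> p) (bergman_norm \<omega> p) (Lq_norm \<mu> q)
                 (weighted_comp u \<phi>)) q;
           B = (SUP a\<in>unit_disc. \<integral>\<^sup>+z. ennreal (cmod (test_fun \<omega> a p \<gamma> (\<phi> z)) powr q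
                  * cmod (u z) powr q) \<partial>\<mu>)
       in ennreal (1 / K \<gamma>) * B \<le> A \<and> A \<le> ennreal (K \<gamma>) * B"
        using lower upper
        unfolding A_def B_def comp_norm_def[OF ctx] test_integral_def[OF ctx] Let_def by blast
    qed
  qed simp
qed

end
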